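(* Let $d\ge2$, $\beta>0$, and let $F:\mathbb R^d\setminus\{0\}\to\mathbb R^d$ satisfy the assumption stated in the context. Let $(v_0,x_0)\in(\mathbb R^d\setminus\{0\})\times\mathbb R^d$ be deterministic and let $(B_t)_{t\ge0}$ be a $d$-dimensional Brownian motion. Then the equation $$V_t=v_0+B_t-\frac\beta2\int_0^tF(V_s)\,ds,\qquad X_t=x_0+\int_0^tV_s\,ds,\qquad t\ge0,$$ has a pathwise unique solution $(V_t,X_t)_{t\ge0}$, which is furthermore $(\mathbb R^d\setminus\{0\})\times\mathbb R^d$-valued.
   Context: Assumption on $F$: there are $C^\infty$ functions $\gamma:\mathbb S_{d-1}\to(0,\infty)$ ($\mathbb S_{d-1}$ being the unit sphere of $\mathbb R^d$) and $\Gamma:[0,\infty)\to(0,\infty)$ with $\Gamma(r)\sim r$ as $r\to\infty$ such that, with $U(v)=\Gamma(|v|)\gamma(v/|v|)$, one has $F(v)=\nabla[\log U(v)]=[U(v)]^{-1}\nabla U(v)$ for all $v\in\mathbb R^d\setminus\{0\}$. *)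

theory Defs
  imports "HOL-Probability.Probability" "HOL-Library.Landau_Symbols"
begin

text \<open>Class \<open>C\<^sup>k\<close> on an open subset of a Euclidean space, through iterated directional derivatives.\<close>

fun C_k_on :: "nat \<Rightarrow> ('a::euclidean_space \<Rightarrow> 'b::real_normed_vector) \<Rightarrow> 'a set \<Rightarrow> bool" where
  "C_k_on 0 f W \<longleftrightarrow> continuous_on W f"
| "C_k_on (Suc k) f W \<longleftrightarrow>
     (\<forall>x\<in>W. f differentiable (at x)) \<and> (\<forall>h. C_k_on k (\<lambda>x. frechet_derivative f (at x) h) W)"

text \<open>Smoothness on an arbitrary subset \<open>S\<close> (here the unit sphere and the closed half-line): \<open>f\<close> is
  locally the restriction to \<open>S\<close> of a \<open>C\<^sup>\<infinity>\<close> function on an open set of the ambient space. The values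
  of \<open>f\<close> outside \<open>S\<close> are irrelevant.\<close>

definition smooth_on :: "('a::euclidean_space \<Rightarrow> 'b::real_normed_vector) \<Rightarrow> 'a set \<Rightarrow> bool" where
  "smooth_on f S \<longleftrightarrow>
     (\<forall>x\<in>S. \<exists>W g. open W \<and> x \<in> W \<and> (\<forall>k. C_k_on k g W) \<and> (\<forall>y\<in>S \<inter> W. g y = f y))"

text \<open>The value of \<open>F\<close> at the origin is unconstrained. Since \<open>U > 0\<close> away from the origin,
  \<open>\<nabla>(ln U) = U\<^sup>-\<^sup>1 \<nabla>U\<close> holds there by the chain rule.\<close>

definition drift_assumption :: "(real ^ 'n \<Rightarrow> real ^ 'n) \<Rightarrow> bool" where
  "drift_assumption F \<longleftrightarrow>
     (\<exists>(\<gamma> :: real ^ 'n \<Rightarrow> real) (\<Gamma> :: real \<Rightarrow> real).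
        smooth_on \<gamma> (sphere 0 1) \<and> (\<forall>u\<in>sphere 0 1. \<gamma> u > 0) \<and>
        smooth_on \<Gamma> {0..} \<and> (\<forall>r\<ge>0. \<Gamma> r > 0) \<and>
        \<Gamma> \<sim>[at_top] (\<lambda>r. r) \<and>
        (\<forall>v. v \<noteq> 0 \<longrightarrow> GDERIV (\<lambda>w. ln (\<Gamma> (norm w) * \<gamma> (w /\<^sub>R norm w))) v :> F v))"

text \<open>Processes are functions of a real time, of which only the values at times \<open>t \<ge> 0\<close> matter.\<close>

definition natural_filtration ::
    "'w measure \<Rightarrow> (real \<Rightarrow> 'w \<Rightarrow> real ^ 'n) \<Rightarrow> real \<Rightarrow> 'w measure" where
  "natural_filtration M B t =
     sigma (space M) {B s -` A \<inter> space M | s A. 0 \<le> s \<and> s \<le> t \<and> A \<in> sets borel}"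

definition augmented_filtration :: "'w measure \<Rightarrow> (real \<Rightarrow> 'w measure) \<Rightarrow> real \<Rightarrow> 'w measure" where
  "augmented_filtration M G t = sigma (space M) (sets (G t) \<union> null_sets M)"

text \<open>The initial value is \<open>0\<close>; the law of an increment is given by the density of \<open>N(0, (t - s) I)\<close>
  (\<open>normal_density\<close> takes the standard deviation, not the variance).\<close>

definition brownian_motion_wrt ::
    "'w measure \<Rightarrow> (real \<Rightarrow> 'w measure) \<Rightarrow> (real \<Rightarrow> 'w \<Rightarrow> real ^ 'n) \<Rightarrow> bool" where
  "brownian_motion_wrt M G B \<longleftrightarrow>
     prob_space M \<and>
     (\<forall>t\<ge>0. subalgebra M (G t)) \<and>
     (\<forall>s t. 0 \<le> s \<and> s \<le> t \<longrightarrow> subalgebra (G t) (G s)) \<and>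
     (\<forall>t\<ge>0. B t \<in> borel_measurable (G t)) \<and>
     (AE \<omega> in M. B 0 \<omega> = 0) \<and>
     (AE \<omega> in M. continuous_on {0..} (\<lambda>t. B t \<omega>)) \<and>
     (\<forall>s t. 0 \<le> s \<and> s < t \<longrightarrow>
        prob_space.indep_set M (sets (G s))
          {(\<lambda>\<omega>. B t \<omega> - B s \<omega>) -` A \<inter> space M | A. A \<in> sets borel} \<and>
        distributed M lborel (\<lambda>\<omega>. B t \<omega> - B s \<omega>)
          (\<lambda>x. ennreal (\<Prod>i\<in>UNIV. normal_density 0 (sqrt (t - s)) (x $ i))))"

definition brownian_motion :: "'w measure \<Rightarrow> (real \<Rightarrow> 'w \<Rightarrow> real ^ 'n) \<Rightarrow> bool" where
  "brownian_motion M B \<longleftrightarrow> brownian_motion_wrt M (natural_filtration M B) B"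

text \<open>A solution is a priori allowed to visit the origin in velocity, with an arbitrary fixed value
  \<open>F 0\<close>. Integrability is required explicitly because the Bochner integral of a non-integrable
  function is \<open>0\<close> by convention.\<close>

definition kinetic_solution ::
    "'w measure \<Rightarrow> (real \<Rightarrow> 'w measure) \<Rightarrow> (real \<Rightarrow> 'w \<Rightarrow> real ^ 'n) \<Rightarrow>
     (real ^ 'n \<Rightarrow> real ^ 'n) \<Rightarrow> real \<Rightarrow> real ^ 'n \<Rightarrow> real ^ 'n \<Rightarrow>
     (real \<Rightarrow> 'w \<Rightarrow> real ^ 'n) \<Rightarrow> (real \<Rightarrow> 'w \<Rightarrow> real ^ 'n) \<Rightarrow> bool" where
  "kinetic_solution M G B F \<beta> v\<^sub>0 x\<^sub>0 V X \<longleftrightarrow>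
     (\<forall>t\<ge>0. V t \<in> borel_measurable (G t) \<and> X t \<in> borel_measurable (G t)) \<and>
     (AE \<omega> in M.
        continuous_on {0..} (\<lambda>t. V t \<omega>) \<and> continuous_on {0..} (\<lambda>t. X t \<omega>) \<and>
        (\<forall>t\<ge>0.
           set_integrable lborel {0..t} (\<lambda>s. F (V s \<omega>)) \<and>
           V t \<omega> = v\<^sub>0 + B t \<omega> - (\<beta> / 2) *\<^sub>R (LINT s:{0..t}|lborel. F (V s \<omega>)) \<and>
           X t \<omega> = x\<^sub>0 + (LINT s:{0..t}|lborel. V s \<omega>)))"

end

theory Submission
  imports Defs
begin

text \<open>The noise is additive, so the equation is solved path by path: \<open>F\<close> is locally Lipschitz off the
  origin, and uniqueness, as well as existence up to the exit from an annulus, are deterministic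
  statements. What remains is that the velocity almost surely neither reaches \<open>0\<close> nor explodes. The
  radial part of \<open>F\<close> depends on \<open>|v|\<close> alone, so there is an explicit radial \<open>g \<ge> 0\<close> with \<open>L g = 1\<close>,
  and it tends to infinity both at \<open>0\<close> (as \<open>d \<ge> 2\<close>) and at infinity (as \<open>\<Gamma> r \<sim> r\<close>).
  Stochastic calculus is avoided by running the Euler scheme stopped at its exit from an annulus: a
  Taylor expansion and Gaussian moments bound the increase of \<open>E g\<close> over one step of length \<open>\<delta>\<close>
  by \<open>2 \<delta>\<close>, so the annulus is left before time \<open>T\<close> with probability at most
  \<open>(g v\<^sub>0 + 2 T) / m\<close>, where \<open>m\<close> is a lower bound of \<open>g\<close> outside the annulus. This bound passes to the limiting
  equation because the Euler scheme converges for every continuous path.\<close>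

section \<open>Locally Lipschitz maps\<close>

text \<open>The angular factor \<open>\<gamma>\<close> drops out of L g because L, applied to a
  radial function, sees \<open>F\<close> only through the inner product of F(v) with v, and
  \<open>\<gamma>\<close> is constant along rays: the product is r \<Gamma>'(r) / \<Gamma>(r). Hence
  L g = 1 becomes a linear first-order equation for g' in the variable q = |v|^2. Euler chains serve
  twice. One step involves only an independent Gaussian increment, so moments suffice; and a chain
  is an explicit function of finitely many values of the path, so the solution, written as an
  iterated limit of chains, is adapted. A fixed point chosen path by path would carry no
  measurability. The order of choices matters: the level m fixes the annulus, which fixes the
  truncated drift and the admissible mesh. The bound (g v0 + 2 T) / m retains none of these, so m
  can tend to infinity while T stays fixed. Uniqueness asks for local Lipschitz continuity only
  along the constructed path, so a competitor that might touch the origin is covered.\<close>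

text \<open>A notion at a single point, so that sums, products and compositions combine without
  tracking domains.\<close>

definition lipschitz_near :: "('a::metric_space \<Rightarrow> 'b::metric_space) \<Rightarrow> 'a \<Rightarrow> bool" where
  "lipschitz_near f x \<longleftrightarrow> (\<exists>e>0. \<exists>L. L-lipschitz_on (ball x e) f)"

lemma lipschitz_nearE:
  assumes "lipschitz_near f x"
  obtains e L where "e > 0" "L \<ge> 0" "\<And>y z. y \<in> ball x e \<Longrightarrow> z \<in> ball x e \<Longrightarrow> dist (f y) (f z) \<le> L * dist y z"
  using assms unfolding lipschitz_near_def lipschitz_on_def by blast

lemma lipschitz_nearI:
  assumes "e > 0" "\<And>y z. y \<in> ball x e \<Longrightarrow> z \<in> ball x e \<Longrightarrow> dist (f y) (f z) \<le> L * dist y z"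
  shows "lipschitz_near f x"
proof -
  have "\<bar>L\<bar>-lipschitz_on (ball x e) f"
  proof (rule lipschitz_onI)
    fix y z assume "y \<in> ball x e" "z \<in> ball x e"
    then have "dist (f y) (f z) \<le> L * dist y z" by (rule assms(2))
    also have "\<dots> \<le> \<bar>L\<bar> * dist y z" by (intro mult_right_mono) auto
    finally show "dist (f y) (f z) \<le> \<bar>L\<bar> * dist y z" .
  qed simp
  with assms(1) show ?thesis unfolding lipschitz_near_def by blast
qed

lemma lipschitz_near_isCont:
  assumes "lipschitz_near f x" shows "isCont f x"
proof -
  obtain e L where "e > 0" "L-lipschitz_on (ball x e) f"
    using assms unfolding lipschitz_near_def by blast
  then have "continuous_on (ball x e) f" by (auto intro: lipschitz_on_continuous_on)
  with \<open>e > 0\<close> show ?thesis by (simp add: continuous_on_eq_continuous_at)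
qed

lemma lipschitz_near_cong:
  assumes "lipschitz_near f x" "open S" "x \<in> S" "\<And>y. y \<in> S \<Longrightarrow> g y = f y"
  shows "lipschitz_near g x"
proof -
  obtain e L where e: "e > 0" "L \<ge> 0"
      "\<And>y z. y \<in> ball x e \<Longrightarrow> z \<in> ball x e \<Longrightarrow> dist (f y) (f z) \<le> L * dist y z"
    using lipschitz_nearE[OF assms(1)] by blast
  obtain d where d: "d > 0" "ball x d \<subseteq> S" using assms(2,3) openE by blast
  show ?thesis
    by (rule lipschitz_nearI[of "min e d" _ _ L]) (use e d assms(4) in \<open>auto simp: subset_iff\<close>)
qed

lemma lipschitz_near_const: "lipschitz_near (\<lambda>_. c) x"
  by (rule lipschitz_nearI[of 1 _ _ 0]) auto

lemma lipschitz_near_id: "lipschitz_near (\<lambda>x. x) x"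
  by (rule lipschitz_nearI[of 1 _ _ 1]) auto

lemma lipschitz_near_norm: "lipschitz_near norm x"
  by (rule lipschitz_nearI[of 1 _ _ 1]) (auto simp: dist_norm norm_triangle_ineq3)

lemma lipschitz_near_compose:
  assumes "lipschitz_near f x" "lipschitz_near g (f x)"
  shows "lipschitz_near (\<lambda>y. g (f y)) x"
proof -
  obtain e L where e: "e > 0" "L \<ge> 0"
      "\<And>y z. y \<in> ball x e \<Longrightarrow> z \<in> ball x e \<Longrightarrow> dist (f y) (f z) \<le> L * dist y z"
    using lipschitz_nearE[OF assms(1)] by blast
  obtain d K where d: "d > 0" "K \<ge> 0"
      "\<And>y z. y \<in> ball (f x) d \<Longrightarrow> z \<in> ball (f x) d \<Longrightarrow> dist (g y) (g z) \<le> K * dist y z"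
    using lipschitz_nearE[OF assms(2)] by blast
  obtain r where r: "r > 0" "\<And>y. dist x y < r \<Longrightarrow> dist (f x) (f y) < d"
    using lipschitz_near_isCont[OF assms(1)] d(1) unfolding continuous_at_eps_delta
    by (metis dist_commute)
  show ?thesis
  proof (rule lipschitz_nearI[of "min e r" _ _ "K * L"])
    fix y z assume yz: "y \<in> ball x (min e r)" "z \<in> ball x (min e r)"
    have "dist (g (f y)) (g (f z)) \<le> K * dist (f y) (f z)"
      using yz r(2) by (intro d(3)) auto
    also have "\<dots> \<le> K * (L * dist y z)"
      using yz d(2) by (intro mult_left_mono e(3)) auto
    finally show "dist (g (f y)) (g (f z)) \<le> K * L * dist y z" by (simp add: mult.assoc)
  qed (use e r in auto)
qed

lemma lipschitz_near_add:
  fixes f g :: "'a::metric_space \<Rightarrow> 'b::real_normed_vector"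
  assumes "lipschitz_near f x" "lipschitz_near g x"
  shows "lipschitz_near (\<lambda>y. f y + g y) x"
proof -
  obtain e L where e: "e > 0" "L \<ge> 0"
      "\<And>y z. y \<in> ball x e \<Longrightarrow> z \<in> ball x e \<Longrightarrow> dist (f y) (f z) \<le> L * dist y z"
    using lipschitz_nearE[OF assms(1)] by blast
  obtain d K where d: "d > 0" "K \<ge> 0"
      "\<And>y z. y \<in> ball x d \<Longrightarrow> z \<in> ball x d \<Longrightarrow> dist (g y) (g z) \<le> K * dist y z"
    using lipschitz_nearE[OF assms(2)] by blast
  show ?thesis
  proof (rule lipschitz_nearI[of "min e d" _ _ "L + K"])
    fix y z assume yz: "y \<in> ball x (min e d)" "z \<in> ball x (min e d)"
    have "dist (f y + g y) (f z + g z) \<le> dist (f y) (f z) + dist (g y) (g z)"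
      by (rule dist_triangle_add)
    also have "\<dots> \<le> L * dist y z + K * dist y z"
      using yz by (intro add_mono e(3) d(3)) auto
    finally show "dist (f y + g y) (f z + g z) \<le> (L + K) * dist y z" by (simp add: algebra_simps)
  qed (use e d in auto)
qed

lemma (in bounded_linear) lipschitz_near: "lipschitz_near f x"
  using lipschitz_boundE[of UNIV] unfolding lipschitz_near_def
  by (metis lipschitz_boundE zero_less_one)

lemma (in bounded_bilinear) lipschitz_near:
  assumes "lipschitz_near f x" "lipschitz_near g x"
  shows "lipschitz_near (\<lambda>y. prod (f y) (g y)) x"
proof -
  obtain e L where e: "e > 0" "L \<ge> 0"
      "\<And>y z. y \<in> ball x e \<Longrightarrow> z \<in> ball x e \<Longrightarrow> dist (f y) (f z) \<le> L * dist y z"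
    using lipschitz_nearE[OF assms(1)] by blast
  obtain d K where d: "d > 0" "K \<ge> 0"
      "\<And>y z. y \<in> ball x d \<Longrightarrow> z \<in> ball x d \<Longrightarrow> dist (g y) (g z) \<le> K * dist y z"
    using lipschitz_nearE[OF assms(2)] by blast
  obtain C where C: "C \<ge> 0" "\<And>a b. norm (prod a b) \<le> norm a * norm b * C"
    using nonneg_bounded by blast
  \<comment> \<open>Radius at most 1 keeps both factors bounded near \<open>x\<close>, by
    \<open>norm (f x) + L\<close> and \<open>norm (g x) + K\<close>.\<close>
  define r where "r = min e (min d 1)"
  have r: "r > 0" using e d by (auto simp: r_def)
  have bf: "norm (f y) \<le> norm (f x) + L" if "y \<in> ball x r" for y
  proof -
    have "norm (f y) \<le> norm (f x) + dist (f y) (f x)"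
      using norm_triangle_sub[of "f y" "f x"] by (simp add: dist_norm)
    also have "dist (f y) (f x) \<le> L * dist y x" using that e by (intro e(3)) (auto simp: r_def)
    also have "\<dots> \<le> L * 1" using that e by (intro mult_left_mono) (auto simp: r_def dist_commute)
    finally show ?thesis by simp
  qed
  have bg: "norm (g y) \<le> norm (g x) + K" if "y \<in> ball x r" for y
  proof -
    have "norm (g y) \<le> norm (g x) + dist (g y) (g x)"
      using norm_triangle_sub[of "g y" "g x"] by (simp add: dist_norm)
    also have "dist (g y) (g x) \<le> K * dist y x" using that d by (intro d(3)) (auto simp: r_def)
    also have "\<dots> \<le> K * 1" using that d by (intro mult_left_mono) (auto simp: r_def dist_commute)
    finally show ?thesis by simp
  qed
  show ?thesis
  proof (rule lipschitz_nearI[OF r, where L = "(L * (norm (g x) + K) + (norm (f x) + L) * K) * C"])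
    fix y z assume yz: "y \<in> ball x r" "z \<in> ball x r"
    have "prod (f y) (g y) - prod (f z) (g z) = prod (f y - f z) (g y) + prod (f z) (g y - g z)"
      by (simp add: diff_left diff_right)
    then have "dist (prod (f y) (g y)) (prod (f z) (g z))
        \<le> norm (prod (f y - f z) (g y)) + norm (prod (f z) (g y - g z))"
      by (metis dist_norm norm_triangle_ineq)
    also have "\<dots> \<le> norm (f y - f z) * norm (g y) * C + norm (f z) * norm (g y - g z) * C"
      by (intro add_mono C)
    also have "\<dots> \<le> (L * dist y z) * (norm (g x) + K) * C + (norm (f x) + L) * (K * dist y z) * C"
      using yz e(3)[of y z] d(3)[of y z] bf[of z] bg[of y] C e(2) d(2)
      by (intro add_mono mult_right_mono mult_mono) (auto simp: r_def dist_norm)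
    finally show "dist (prod (f y) (g y)) (prod (f z) (g z))
        \<le> ((L * (norm (g x) + K) + (norm (f x) + L) * K) * C) * dist y z"
      by (simp add: algebra_simps)
  qed
qed

lemmas lipschitz_near_scaleR = bounded_bilinear.lipschitz_near[OF bounded_bilinear_scaleR]
lemmas lipschitz_near_mult = bounded_bilinear.lipschitz_near[OF bounded_bilinear_mult]
lemmas lipschitz_near_inner = bounded_bilinear.lipschitz_near[OF bounded_bilinear_inner]

lemma lipschitz_near_sum:
  fixes f :: "'i \<Rightarrow> 'a::metric_space \<Rightarrow> 'b::real_normed_vector"
  assumes "\<And>i. i \<in> I \<Longrightarrow> lipschitz_near (f i) x"
  shows "lipschitz_near (\<lambda>y. \<Sum>i\<in>I. f i y) x"
  using assms by (induction I rule: infinite_finite_induct)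
    (auto intro: lipschitz_near_const lipschitz_near_add)

text \<open>Continuity of the partial derivatives bounds them on a compact ball, their sum bounds
  the operator norm, and the mean value inequality concludes. Continuity is asked for each fixed
  direction, the form in which \<open>C_k_on\<close> provides it.\<close>

lemma lipschitz_near_C1:
  fixes f :: "'a::euclidean_space \<Rightarrow> 'b::real_normed_vector"
  assumes "open W" "x \<in> W"
    and der: "\<And>y. y \<in> W \<Longrightarrow> (f has_derivative f' y) (at y)"
    and cont: "\<And>h. h \<in> Basis \<Longrightarrow> continuous_on W (\<lambda>y. f' y h)"
  shows "lipschitz_near f x"
proof -
  obtain e where e: "e > 0" "cball x e \<subseteq> W" using assms(1,2) open_contains_cball by blast
  have "\<exists>M. \<forall>y\<in>cball x e. norm (f' y h) \<le> M" if "h \<in> Basis" for h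
  proof -
    have "compact ((\<lambda>y. f' y h) ` cball x e)"
      using cont[OF that] e(2) by (intro compact_continuous_image) (auto intro: continuous_on_subset)
    then show ?thesis by (meson bounded_iff compact_imp_bounded imageI)
  qed
  then obtain M where M: "\<And>h y. h \<in> Basis \<Longrightarrow> y \<in> cball x e \<Longrightarrow> norm (f' y h) \<le> M h" by metis
  have on: "onorm (f' y) \<le> (\<Sum>h\<in>Basis. M h)" if y: "y \<in> cball x e" for y
  proof (rule onorm_le)
    fix u :: 'a
    have "y \<in> W" using e(2) y by blast
    then have lin: "linear (f' y)" using der has_derivative_linear by blast
    interpret linear "f' y" by (rule lin)
    have "f' y u = f' y (\<Sum>h\<in>Basis. (u \<bullet> h) *\<^sub>R h)" by (simp add: euclidean_representation)
    also have "\<dots> = (\<Sum>h\<in>Basis. (u \<bullet> h) *\<^sub>R f' y h)" by (simp add: sum scale)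
    also have "norm \<dots> \<le> (\<Sum>h\<in>Basis. norm u * M h)"
      by (intro sum_norm_le) (auto intro!: mult_mono Basis_le_norm M y)
    finally show "norm (f' y u) \<le> (\<Sum>h\<in>Basis. M h) * norm u"
      by (simp add: sum_distrib_left mult.commute)
  qed
  show ?thesis
  proof (rule lipschitz_nearI[OF e(1), where L = "\<Sum>h\<in>Basis. M h"])
    fix y z assume yz: "y \<in> ball x e" "z \<in> ball x e"
    have "norm (f y - f z) \<le> (\<Sum>h\<in>Basis. M h) * norm (y - z)"
    proof (rule differentiable_bound[where S = "ball x e" and f' = f'])
      show "(f has_derivative f' w) (at w within ball x e)" if "w \<in> ball x e" for w
      proof -
        have "w \<in> W" using that e(2) by auto
        then show ?thesis by (rule has_derivative_at_withinI[OF der])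
      qed
      show "onorm (f' w) \<le> (\<Sum>h\<in>Basis. M h)" if "w \<in> ball x e" for w
        by (rule on) (use that in auto)
    qed (use yz in simp_all)
    then show "dist (f y) (f z) \<le> (\<Sum>h\<in>Basis. M h) * dist y z" by (simp add: dist_norm)
  qed
qed

lemma lipschitz_near_DERIV:
  fixes f :: "real \<Rightarrow> real"
  assumes "open W" "x \<in> W" "\<And>y. y \<in> W \<Longrightarrow> (f has_real_derivative f' y) (at y)"
    and "continuous_on W f'"
  shows "lipschitz_near f x"
  by (rule lipschitz_near_C1[OF assms(1,2), of _ "\<lambda>y. (*) (f' y)"])
     (use assms(3,4) in \<open>auto simp: has_field_derivative_def\<close>)

lemma lipschitz_near_inverse:
  assumes "(x::real) \<noteq> 0" shows "lipschitz_near inverse x"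
  by (rule lipschitz_near_DERIV[of "- {0}" _ _ "\<lambda>y. - (inverse y * inverse y)"])
     (use assms in \<open>auto intro!: DERIV_inverse' continuous_intros derivative_eq_intros\<close>)

lemma C_k_on_imp_C1:
  assumes "C_k_on (Suc k) f W" "y \<in> W"
  shows "(f has_derivative frechet_derivative f (at y)) (at y)"
  using assms by (auto simp: frechet_derivative_works)

lemma C_k_on_continuous:
  assumes "open W" "C_k_on k f W" shows "continuous_on W f"
  using assms by (cases k) (auto intro!: continuous_at_imp_continuous_on differentiable_imp_continuous_within)

lemma C_k_on_lipschitz_near:
  assumes "open W" "x \<in> W" "C_k_on (Suc k) f W" shows "lipschitz_near f x"
proof (rule lipschitz_near_C1[OF assms(1,2), of _ "\<lambda>y. frechet_derivative f (at y)"])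
  show "continuous_on W (\<lambda>y. frechet_derivative f (at y) h)" for h
    using assms C_k_on_continuous[of W k] by auto
qed (use assms C_k_on_imp_C1 in blast)

lemma lipschitz_near_sgn:
  fixes x :: "'a::real_normed_vector"
  assumes "x \<noteq> 0" shows "lipschitz_near sgn x"
proof -
  have "lipschitz_near (\<lambda>y. inverse (norm y) *\<^sub>R y) x"
    using assms by (intro lipschitz_near_scaleR lipschitz_near_id
      lipschitz_near_compose[of norm, OF lipschitz_near_norm] lipschitz_near_inverse) auto
  then show ?thesis by (simp add: sgn_div_norm[abs_def])
qed

text \<open>This is the compactness theorem for time-dependent local Lipschitz maps, applied with
  the one-point time set {0}.\<close>

lemma compact_lipschitz_near:
  fixes f :: "'a::heine_borel \<Rightarrow> 'b::heine_borel"
  assumes "compact S" "\<And>x. x \<in> S \<Longrightarrow> lipschitz_near f x"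
  obtains L where "L-lipschitz_on S f"
proof -
  have ll: "local_lipschitz {0::real} S (\<lambda>_. f)"
  proof (rule local_lipschitzI)
    fix t x assume "x \<in> S"
    then obtain e L where e: "e > 0" "L-lipschitz_on (ball x e) f"
      using assms(2) unfolding lipschitz_near_def by blast
    then have "L-lipschitz_on (cball x (e/2) \<inter> S) f"
      by (elim lipschitz_on_subset) auto
    then show "\<exists>u>0. \<exists>L. \<forall>t\<in>cball t u \<inter> {0}. L-lipschitz_on (cball x u \<inter> S) f"
      using e by (intro exI[of _ "e/2"]) auto
  qed
  show ?thesis
    by (rule local_lipschitz_compact_implies_lipschitz[OF ll assms(1), of thesis])
      (use that in auto)
qed

section \<open>Regularity of the drift\<close>

lemma C_k_on_frechet_derivative:
  "C_k_on (Suc k) f W \<Longrightarrow> C_k_on k (\<lambda>x. frechet_derivative f (at x) h) W"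
  by simp

lemma smooth_onE:
  assumes "smooth_on f S" "x \<in> S"
  obtains W g where "open W" "x \<in> W" "\<forall>k. C_k_on k g W" "\<forall>y\<in>S \<inter> W. g y = f y"
proof -
  define P where "P W g \<longleftrightarrow> open W \<and> x \<in> W \<and> (\<forall>k. C_k_on k g W) \<and> (\<forall>y\<in>S \<inter> W. g y = f y)" for W g
  have "\<exists>W g. P W g" unfolding P_def by (rule bspec[OF assms(1)[unfolded smooth_on_def] assms(2)])
  then obtain W g where W: "P W g" by blast
  show ?thesis by (rule that[of W g]) (rule W[unfolded P_def, THEN conjunct1]
    W[unfolded P_def, THEN conjunct2, THEN conjunct1]
    W[unfolded P_def, THEN conjunct2, THEN conjunct2, THEN conjunct1]
    W[unfolded P_def, THEN conjunct2, THEN conjunct2, THEN conjunct2])+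
qed

lemma smooth_on_continuous_on:
  assumes "smooth_on f S" shows "continuous_on S f"
proof (rule continuous_on_eq_continuous_within[THEN iffD2], rule)
  fix x assume x: "x \<in> S"
  obtain W g where W: "open W" "x \<in> W" "\<forall>k. C_k_on k g W" "\<forall>y\<in>S \<inter> W. g y = f y"
    by (rule smooth_onE[OF assms x]) (rule that)
  have "continuous_on W g" using W(3)[THEN spec, of 0] by simp
  then have cg: "continuous (at x within S) g"
    using W(1,2) by (simp add: continuous_on_eq_continuous_at continuous_at_imp_continuous_at_within)
  obtain d where d: "d > 0" "ball x d \<subseteq> W" using W(1,2) openE by blast
  show "continuous (at x within S) f"
    by (rule continuous_transform_within[OF cg, where \<delta> = d]) (use W x d in \<open>auto simp: dist_commute subset_iff\<close>)
qed

lemma smooth_on_DERIV: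
  fixes f :: "real \<Rightarrow> real"
  assumes "smooth_on f S" "x \<in> interior S"
  shows "(f has_real_derivative deriv f x) (at x)"
proof -
  obtain W g where W: "open W" "x \<in> W" "\<forall>k. C_k_on k g W" "\<forall>y\<in>S \<inter> W. g y = f y"
    by (rule smooth_onE[OF assms(1) subsetD[OF interior_subset assms(2)]]) (rule that)
  have "g differentiable (at x)" using W(2) W(3)[THEN spec, of "Suc 0"] by simp
  then obtain D where "(g has_real_derivative D) (at x)" using real_differentiableE by blast
  then have "(f has_real_derivative D) (at x)"
    by (rule has_field_derivative_transform_within_open[of g D x "interior S \<inter> W" f])
      (use W assms(2) subsetD[OF interior_subset] in auto)
  then show ?thesis using DERIV_imp_deriv by force
qed

text \<open>The derivative is the orthogonal projection onto the hyperplane normal to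
  \<open>x\<close>, divided by \<open>norm x\<close>. It comes from the product rule for
  \<open>sgn\<close> written as inverse norm times identity.\<close>

lemma has_derivative_sgn:
  fixes x :: "'a::real_inner"
  assumes "x \<noteq> 0"
  shows "(sgn has_derivative (\<lambda>h. inverse (norm x) *\<^sub>R (h - (h \<bullet> sgn x) *\<^sub>R sgn x))) (at x)"
proof -
  have "(norm has_derivative (\<lambda>h. h \<bullet> sgn x)) (at x)"
    using GDERIV_norm[OF assms] by (simp add: gderiv_def)
  from has_derivative_scaleR[OF Deriv.has_derivative_inverse[OF _ this] has_derivative_ident]
  have "((\<lambda>y. inverse (norm y) *\<^sub>R y) has_derivative
      (\<lambda>h. inverse (norm x) *\<^sub>R h + (- (inverse (norm x) * (h \<bullet> sgn x) * inverse (norm x))) *\<^sub>R x)) (at x)"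
    using assms by simp
  moreover have "(\<lambda>y. inverse (norm y) *\<^sub>R y) = (sgn :: 'a \<Rightarrow> 'a)"
    by (simp add: fun_eq_iff sgn_div_norm)
  moreover have "inverse (norm x) *\<^sub>R h + (- (inverse (norm x) * (h \<bullet> sgn x) * inverse (norm x))) *\<^sub>R x
      = inverse (norm x) *\<^sub>R (h - (h \<bullet> sgn x) *\<^sub>R sgn x)" for h
    by (simp add: sgn_div_norm[of x] scaleR_diff_right)
  ultimately show ?thesis by simp
qed

lemma has_derivative_Basis:
  fixes f :: "'a::euclidean_space \<Rightarrow> real"
  assumes "(f has_derivative D) (at x)"
  shows "D h = h \<bullet> (\<Sum>b\<in>Basis. D b *\<^sub>R b)"
proof -
  interpret linear D using assms by (rule has_derivative_linear)
  have "D h = D (\<Sum>b\<in>Basis. (h \<bullet> b) *\<^sub>R b)" by (simp add: euclidean_representation)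
  also have "\<dots> = h \<bullet> (\<Sum>b\<in>Basis. D b *\<^sub>R b)"
    by (simp add: sum scale inner_sum_right mult.commute)
  finally show ?thesis .
qed

lemma GDERIV_unique:
  fixes a b :: "'a::euclidean_space"
  assumes "GDERIV f x :> a" "GDERIV f x :> b" shows "a = b"
proof -
  have "(\<lambda>h. h \<bullet> a) = (\<lambda>h. h \<bullet> b)"
    using assms unfolding gderiv_def by (rule has_derivative_unique)
  then have "h \<bullet> a = h \<bullet> b" for h by (rule fun_cong)
  from this[of "a - b"] have "(a - b) \<bullet> (a - b) = 0" by (simp add: inner_diff_right)
  then show ?thesis by simp
qed

text \<open>\<open>F\<close> is known only as a gradient, so regularity is read off from an explicit
  formula for it. Near \<open>v\<close>, \<Gamma> and \<gamma> are replaced by their smooth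
  extensions, the chain rule gives a formula in their first derivatives, and uniqueness of gradients
  identifies it with \<open>F\<close>. These first derivatives are again C^1, hence locally
  Lipschitz.\<close>

lemma lipschitz_near_gradient:
  fixes F :: "'a::euclidean_space \<Rightarrow> 'a" and \<gamma> :: "'a \<Rightarrow> real"
  assumes \<gamma>: "smooth_on \<gamma> (sphere 0 1)" "\<And>u. u \<in> sphere 0 1 \<Longrightarrow> \<gamma> u > 0"
    and \<Gamma>: "smooth_on \<Gamma> {0..}" "\<And>r. r \<ge> 0 \<Longrightarrow> \<Gamma> r > 0"
    and F: "\<And>v. v \<noteq> 0 \<Longrightarrow> GDERIV (\<lambda>w. ln (\<Gamma> (norm w) * \<gamma> (w /\<^sub>R norm w))) v :> F v"
    and "v \<noteq> 0"
  shows "lipschitz_near F v"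
proof -
  obtain W1 g1 where W1: "open W1" "norm v \<in> W1" "\<forall>k. C_k_on k g1 W1" "\<forall>y\<in>{0..} \<inter> W1. g1 y = \<Gamma> y"
    by (rule smooth_onE[OF \<Gamma>(1), of "norm v"]) (simp, rule that)
  have "sgn v \<in> sphere 0 1" using \<open>v \<noteq> 0\<close> by (simp add: norm_sgn)
  then obtain W2 g2 where W2: "open W2" "sgn v \<in> W2" "\<forall>k. C_k_on k g2 W2" "\<forall>y\<in>sphere 0 1 \<inter> W2. g2 y = \<gamma> y"
    by (rule smooth_onE[OF \<gamma>(1)]) (rule that)
  \<comment> \<open>The neighbourhood of \<open>v\<close> on which both extensions reproduce
    \<Gamma> and \<gamma>.\<close>
  define S where "S = (- {0::'a}) \<inter> norm -` W1 \<inter> ((- {0}) \<inter> sgn -` W2)"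
  have cs: "continuous_on (- {0::'a}) sgn"
    by (intro continuous_at_imp_continuous_on ballI lipschitz_near_isCont lipschitz_near_sgn) auto
  have "open S" unfolding S_def
    by (intro open_Int continuous_open_preimage cs W1 W2 continuous_on_norm continuous_on_id) auto
  have "v \<in> S" using \<open>v \<noteq> 0\<close> W1 W2 by (simp add: S_def)
  define D1 where "D1 r = frechet_derivative g1 (at r) 1" for r
  define D2 where "D2 u = (\<Sum>b\<in>Basis. frechet_derivative g2 (at u) b *\<^sub>R b)" for u :: 'a
  \<comment> \<open>Radial part plus tangential part: the projection in the derivative of
    \<open>sgn\<close> is symmetric, so it passes to the gradient \<open>D2\<close> of the angular
    factor.\<close>
  define E where "E x = (D1 (norm x) * inverse (g1 (norm x))) *\<^sub>R sgn x +
      (inverse (g2 (sgn x)) * inverse (norm x)) *\<^sub>R (D2 (sgn x) + (- (D2 (sgn x) \<bullet> sgn x)) *\<^sub>R sgn x)" for x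
  have eq: "F x = E x" if x: "x \<in> S" for x
  proof -
    have x0: "x \<noteq> 0" "norm x \<in> W1" "sgn x \<in> W2" using x by (auto simp: S_def)
    have pos: "g1 (norm x) > 0" "g2 (sgn x) > 0"
      using W1(4)[THEN bspec, of "norm x"] W2(4)[THEN bspec, of "sgn x"] \<Gamma>(2)[of "norm x"] \<gamma>(2)[of "sgn x"] x0
      by (auto simp: norm_sgn)
    have d1: "(g1 has_derivative (\<lambda>h. h * D1 (norm x))) (at (norm x))"
    proof -
      have d: "(g1 has_derivative frechet_derivative g1 (at (norm x))) (at (norm x))"
        using C_k_on_imp_C1[of 0 g1 W1] W1(3)[THEN spec, of "Suc 0"] x0 by blast
      have "frechet_derivative g1 (at (norm x)) = (\<lambda>h. h * D1 (norm x))"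
        unfolding D1_def by (rule ext, subst has_derivative_Basis[OF d]) simp
      with d show ?thesis by simp
    qed
    have d2: "(g2 has_derivative (\<lambda>h. h \<bullet> D2 (sgn x))) (at (sgn x))"
    proof -
      have d: "(g2 has_derivative frechet_derivative g2 (at (sgn x))) (at (sgn x))"
        using C_k_on_imp_C1[of 0 g2 W2] W2(3)[THEN spec, of "Suc 0"] x0 by blast
      have "frechet_derivative g2 (at (sgn x)) = (\<lambda>h. h \<bullet> D2 (sgn x))"
        unfolding D2_def by (rule ext) (rule has_derivative_Basis[OF d])
      with d show ?thesis by simp
    qed
    have n: "(norm has_derivative (\<lambda>h. h \<bullet> sgn x)) (at x)"
      using GDERIV_norm[OF x0(1)] by (simp add: gderiv_def)
    have "((\<lambda>w. ln (g1 (norm w) * g2 (sgn w))) has_derivative (\<lambda>h.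
        (g1 (norm x) * ((inverse (norm x) *\<^sub>R (h - (h \<bullet> sgn x) *\<^sub>R sgn x)) \<bullet> D2 (sgn x)) +
          (h \<bullet> sgn x) * D1 (norm x) * g2 (sgn x)) * inverse (g1 (norm x) * g2 (sgn x)))) (at x)"
      using pos
      by (intro has_derivative_ln has_derivative_mult has_derivative_compose[OF n d1]
            has_derivative_compose[OF has_derivative_sgn[OF x0(1)] d2]) auto
    also have "(\<lambda>h. (g1 (norm x) * ((inverse (norm x) *\<^sub>R (h - (h \<bullet> sgn x) *\<^sub>R sgn x)) \<bullet> D2 (sgn x)) +
          (h \<bullet> sgn x) * D1 (norm x) * g2 (sgn x)) * inverse (g1 (norm x) * g2 (sgn x))) = (\<lambda>h. h \<bullet> E x)"
      (is "?l = ?r")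
    proof
      fix h
      have alg: "(a * (n * (p - q * r)) + q * d * b) * inverse (a * b)
          = d * inverse a * q + inverse b * n * (p + - r * q)"
        if "a > 0" "b > 0" for a b n p q r d :: real
        using that by (simp add: field_simps)
      show "?l h = ?r h"
        unfolding E_def inner_add_right inner_scaleR_right inner_scaleR_left inner_diff_left
          inner_commute[of "sgn x" "D2 (sgn x)"]
        by (rule alg[OF pos])
    qed
    finally have g: "GDERIV (\<lambda>w. ln (g1 (norm w) * g2 (sgn w))) x :> E x" by (simp add: gderiv_def)
    have "GDERIV (\<lambda>w. ln (\<Gamma> (norm w) * \<gamma> (w /\<^sub>R norm w))) x :> E x"
      unfolding gderiv_def
    proof (rule has_derivative_transform_within_open[OF g[unfolded gderiv_def] \<open>open S\<close> x])
      fix w assume "w \<in> S"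
      then have "w \<noteq> 0" "norm w \<in> W1" "sgn w \<in> W2" by (auto simp: S_def)
      then show "ln (g1 (norm w) * g2 (sgn w)) = ln (\<Gamma> (norm w) * \<gamma> (w /\<^sub>R norm w))"
        using W1(4)[THEN bspec, of "norm w"] W2(4)[THEN bspec, of "sgn w"] by (simp add: norm_sgn sgn_div_norm)
    qed
    with F[OF x0(1)] show ?thesis by (rule GDERIV_unique)
  qed
  have v: "v \<noteq> 0" "norm v \<in> W1" "sgn v \<in> W2" using \<open>v \<in> S\<close> by (auto simp: S_def)
  have pos: "g1 (norm v) > 0" "g2 (sgn v) > 0"
    using W1(4)[THEN bspec, of "norm v"] W2(4)[THEN bspec, of "sgn v"] \<Gamma>(2)[of "norm v"] \<gamma>(2)[of "sgn v"] v
    by (auto simp: norm_sgn)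
  have C1: "lipschitz_near g1 (norm v)"
    by (rule C_k_on_lipschitz_near[OF W1(1) v(2), where k = 0]) (rule W1(3)[THEN spec])
  have C2: "lipschitz_near g2 (sgn v)"
    by (rule C_k_on_lipschitz_near[OF W2(1) v(3), where k = 0]) (rule W2(3)[THEN spec])
  have C1': "lipschitz_near D1 (norm v)"
    unfolding D1_def
    by (rule C_k_on_lipschitz_near[OF W1(1) v(2), where k = 0])
      (rule C_k_on_frechet_derivative[OF W1(3)[THEN spec]])
  have C2': "lipschitz_near D2 (sgn v)"
    unfolding D2_def
    by (intro lipschitz_near_sum lipschitz_near_scaleR lipschitz_near_const
        C_k_on_lipschitz_near[OF W2(1) v(3), where k = 0]
        C_k_on_frechet_derivative[OF W2(3)[THEN spec]])
  have sgn: "lipschitz_near sgn v" using v(1) by (rule lipschitz_near_sgn)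
  have D: "lipschitz_near (\<lambda>y. D2 (sgn y)) v" by (rule lipschitz_near_compose[OF sgn C2'])
  have inv: "lipschitz_near inverse (g1 (norm v))" "lipschitz_near inverse (g2 (sgn v))"
      "lipschitz_near inverse (norm v)"
    using pos v(1) by (auto intro!: lipschitz_near_inverse)
  have "lipschitz_near (\<lambda>y. - (D2 (sgn y) \<bullet> sgn y)) v"
    by (rule lipschitz_near_compose[OF lipschitz_near_inner[OF D sgn]
          bounded_linear.lipschitz_near[OF bounded_linear_minus[OF bounded_linear_ident]]])
  then have "lipschitz_near E v" unfolding E_def
    by (intro lipschitz_near_add lipschitz_near_scaleR lipschitz_near_mult sgn D
      lipschitz_near_compose[OF lipschitz_near_norm C1'] lipschitz_near_compose[OF lipschitz_near_norm inv(3)]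
      lipschitz_near_compose[OF lipschitz_near_compose[OF lipschitz_near_norm C1] inv(1)]
      lipschitz_near_compose[OF lipschitz_near_compose[OF sgn C2] inv(2)])
  then show ?thesis using \<open>open S\<close> \<open>v \<in> S\<close> eq by (rule lipschitz_near_cong)
qed

text \<open>Differentiate along the ray t -> t v at t = 1. The angular factor is constant there, so
  only the logarithmic derivative of \<Gamma> remains.\<close>

lemma radial_gradient:
  fixes f :: "'a::euclidean_space" and \<Gamma> :: "real \<Rightarrow> real"
  assumes "GDERIV (\<lambda>w. ln (\<Gamma> (norm w) * \<gamma> (w /\<^sub>R norm w))) v :> f" "v \<noteq> 0"
    and "(\<Gamma> has_real_derivative D) (at (norm v))" "\<Gamma> (norm v) > 0" "\<gamma> (v /\<^sub>R norm v) > 0"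
  shows "f \<bullet> v = norm v * D / \<Gamma> (norm v)"
proof -
  have 1: "((\<lambda>w. ln (\<Gamma> (norm w) * \<gamma> (w /\<^sub>R norm w))) has_derivative (\<lambda>h. h \<bullet> f)) (at (1 *\<^sub>R v))"
    using assms(1) by (simp add: gderiv_def)
  have 2: "((\<lambda>t. t *\<^sub>R v) has_derivative (\<lambda>t. t *\<^sub>R v)) (at 1)"
    by (rule bounded_linear_imp_has_derivative[OF bounded_linear_scaleR_left])
  have "((\<lambda>t. ln (\<Gamma> (norm (t *\<^sub>R v)) * \<gamma> (t *\<^sub>R v /\<^sub>R norm (t *\<^sub>R v)))) has_derivative
      (\<lambda>t. (t *\<^sub>R v) \<bullet> f)) (at 1)"
    by (rule has_derivative_compose[where f = "\<lambda>t. t *\<^sub>R v", OF 2 1])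
  then have "((\<lambda>t. ln (\<Gamma> (norm (t *\<^sub>R v)) * \<gamma> (t *\<^sub>R v /\<^sub>R norm (t *\<^sub>R v)))) has_real_derivative (v \<bullet> f)) (at 1)"
    (is ?D)
  proof -
    have "(\<lambda>t. (t *\<^sub>R v) \<bullet> f) = (*) (v \<bullet> f)" by auto
    with \<open>((\<lambda>t. ln (\<Gamma> (norm (t *\<^sub>R v)) * \<gamma> (t *\<^sub>R v /\<^sub>R norm (t *\<^sub>R v)))) has_derivative
      (\<lambda>t. (t *\<^sub>R v) \<bullet> f)) (at 1)\<close> show ?D unfolding has_field_derivative_def by argo
  qed
  then have "((\<lambda>t. ln (\<Gamma> (t * norm v) * \<gamma> (v /\<^sub>R norm v))) has_real_derivative (v \<bullet> f)) (at 1)"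
  proof (rule has_field_derivative_transform_within_open[of _ _ _ "{0<..}"])
    fix t :: real assume "t \<in> {0<..}"
    then have "norm (t *\<^sub>R v) = t * norm v" "t *\<^sub>R v /\<^sub>R norm (t *\<^sub>R v) = v /\<^sub>R norm v"
      by (simp_all add: field_simps)
    then show "ln (\<Gamma> (norm (t *\<^sub>R v)) * \<gamma> (t *\<^sub>R v /\<^sub>R norm (t *\<^sub>R v)))
        = ln (\<Gamma> (t * norm v) * \<gamma> (v /\<^sub>R norm v))" by presburger
  qed auto
  moreover have "((\<lambda>t. ln (\<Gamma> (t * norm v) * \<gamma> (v /\<^sub>R norm v))) has_real_derivative (norm v * D / \<Gamma> (norm v))) (at 1)"
  proof -
    have "(\<Gamma> has_real_derivative D) (at (1 * norm v))" using assms(3) by simp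
    then have "((\<lambda>t. \<Gamma> (t * norm v)) has_real_derivative D * norm v) (at 1)"
      by (rule DERIV_chain2) (auto intro!: derivative_eq_intros)
    then have "((\<lambda>t. \<Gamma> (t * norm v) * \<gamma> (v /\<^sub>R norm v)) has_real_derivative D * norm v * \<gamma> (v /\<^sub>R norm v)) (at 1)"
      by (rule DERIV_cmult_right)
    moreover have "\<Gamma> (1 * norm v) * \<gamma> (v /\<^sub>R norm v) > 0" using assms(4,5) by simp
    ultimately have "((\<lambda>t. ln (\<Gamma> (t * norm v) * \<gamma> (v /\<^sub>R norm v))) has_real_derivative
        1 / (\<Gamma> (1 * norm v) * \<gamma> (v /\<^sub>R norm v)) * (D * norm v * \<gamma> (v /\<^sub>R norm v))) (at 1)"
      by (intro DERIV_chain2[OF DERIV_ln_divide])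
    then show ?thesis using assms(4,5) by (simp add: mult.commute)
  qed
  ultimately have "v \<bullet> f = norm v * D / \<Gamma> (norm v)" by (rule DERIV_unique)
  then show ?thesis by (simp add: inner_commute)
qed

section \<open>Differential equations driven by a continuous path\<close>

text \<open>Lebesgue integrals with explicit integrability, as in \<open>kinetic_solution\<close>,
  because \<open>b\<close> may be discontinuous at the origin. For negative \<open>T\<close> the
  interval is empty and the predicate holds trivially, which permits quantifying over all real
  \<open>T\<close>.\<close>

definition solves :: "('a::euclidean_space \<Rightarrow> 'a) \<Rightarrow> (real \<Rightarrow> 'a) \<Rightarrow> 'a \<Rightarrow> (real \<Rightarrow> 'a) \<Rightarrow> real \<Rightarrow> bool" where
  "solves b w v0 V T \<longleftrightarrow> continuous_on {0..T} V \<and>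
     (\<forall>t\<in>{0..T}. set_integrable lborel {0..t} (\<lambda>s. b (V s)) \<and>
        V t = v0 + w t + (LINT s:{0..t}|lborel. b (V s)))"

lemma solves_cong:
  assumes "solves b w v0 V T" "\<And>t. t \<in> {0..T} \<Longrightarrow> V' t = V t" "\<And>t. t \<in> {0..T} \<Longrightarrow> b' (V t) = b (V t)"
  shows "solves b' w v0 V' T"
  unfolding solves_def
proof (intro conjI ballI)
  have "continuous_on {0..T} V" using assms(1) by (simp add: solves_def)
  then show "continuous_on {0..T} V'" by (rule continuous_on_eq) (use assms(2) in auto)
  fix t assume t: "t \<in> {0..T}"
  have eq: "b' (V' s) = b (V s)" if "s \<in> {0..t}" for s using assms(2,3)[of s] t that by simp
  have "set_integrable lborel {0..t} (\<lambda>s. b' (V' s)) = set_integrable lborel {0..t} (\<lambda>s. b (V s))"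
    using eq by (intro set_integrable_cong) auto
  then show "set_integrable lborel {0..t} (\<lambda>s. b' (V' s))" using assms(1) t by (auto simp: solves_def)
  have "(LINT s:{0..t}|lborel. b' (V' s)) = (LINT s:{0..t}|lborel. b (V s))"
    using eq by (intro set_lebesgue_integral_cong) auto
  then show "V' t = v0 + w t + (LINT s:{0..t}|lborel. b' (V' s))"
    using assms(1) assms(2)[OF t] t by (auto simp: solves_def)
qed

lemma solves_mono: "solves b w v0 V T \<Longrightarrow> S \<le> T \<Longrightarrow> solves b w v0 V S"
  unfolding solves_def by (auto intro: continuous_on_subset)

lemma solves_integral:
  assumes "solves b w v0 V T" "continuous_on UNIV b" "t \<in> {0..T}"
  shows "V t = v0 + w t + integral {0..t} (\<lambda>s. b (V s))"
  using assms set_borel_integral_eq_integral(2)[of "{0..t}" "\<lambda>s. b (V s)"] by (auto simp: solves_def)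

lemma solves_integralI:
  assumes "continuous_on {0..T} V" "continuous_on UNIV b"
    and "\<And>t. t \<in> {0..T} \<Longrightarrow> V t = v0 + w t + integral {0..t} (\<lambda>s. b (V s))"
  shows "solves b w v0 V T"
  unfolding solves_def
proof (intro conjI ballI)
  fix t assume t: "t \<in> {0..T}"
  have "continuous_on {0..t} (\<lambda>s. b (V s))"
    using t by (intro continuous_on_compose2[OF assms(2)] continuous_on_subset[OF assms(1)]) auto
  then show *: "set_integrable lborel {0..t} (\<lambda>s. b (V s))" by (rule borel_integrable_atLeastAtMost')
  show "V t = v0 + w t + (LINT s:{0..t}|lborel. b (V s))"
    using assms(3)[OF t] set_borel_integral_eq_integral(2)[OF *] by simp
qed (rule assms)

text \<open>In the norm weighted by \<open>exp (- (L + 1) t)\<close> the Picard map is a contraction on the whole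
  half-line at once.\<close>

lemma lipschitz_drift_solution:
  fixes b :: "'a::euclidean_space \<Rightarrow> 'a"
  assumes lip: "L-lipschitz_on UNIV b" and bd: "\<And>x. norm (b x) \<le> M"
    and w: "continuous_on {0..} w"
  shows "\<exists>V. continuous_on {0..} V \<and> (\<forall>T. solves b w v0 V T)"
proof -
  define l where "l = L + 1"
  have L: "L \<ge> 0" "l > 0" "l > L" using lipschitz_on_nonneg[OF lip] by (auto simp: l_def)
  have M: "M \<ge> 0" using bd[of 0] norm_ge_zero order_trans by blast
  have cb: "continuous_on UNIV b" using lip by (rule lipschitz_on_continuous_on)
  \<comment> \<open>The unknown is u t = exp (- l t) (V t - w t): subtracting the noise leaves a
    bounded function, since \<open>b\<close> is bounded. Freezing time at 0 for negative t puts
    everything on the whole line, where bounded continuous functions form a complete space.\<close>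
  define f where "f u s = b (exp (l * s) *\<^sub>R u s + w s)" for u s
  define P where "P u t = exp (- l * max 0 t) *\<^sub>R (v0 + integral {0..max 0 t} (f u))" for u t
  have cf: "continuous_on {0..c} (f u)" if "continuous_on UNIV u" for u c
    unfolding f_def
    by (intro continuous_on_compose2[OF cb] continuous_intros continuous_on_subset[OF that]
        continuous_on_subset[OF w]) auto
  have bf: "norm (integral {0..c} (f u)) \<le> M * c" if "continuous_on UNIV u" "c \<ge> 0" for u c
    using integral_bound[of 0 c "f u" M] cf[OF that(1)] that(2) bd by (auto simp: f_def)
  have P: "P u \<in> bcontfun" if u: "continuous_on UNIV u" for u
  proof (rule bcontfun_normI)
    have "isCont (P u) t" for t
    proof -
      define c where "c = \<bar>t\<bar> + 1"
      have "continuous_on {0..c} (\<lambda>t. integral {0..t} (f u))"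
        by (intro indefinite_integral_continuous_1 integrable_continuous_real cf u)
      then have "continuous_on {..<c} (\<lambda>t. integral {0..max 0 t} (f u))"
        by (rule continuous_on_compose2) (auto intro!: continuous_intros simp: c_def)
      then have "continuous_on {..<c} (P u)" unfolding P_def by (intro continuous_intros)
      moreover have "t \<in> {..<c}" by (auto simp: c_def)
      ultimately show ?thesis by (simp add: continuous_on_eq_continuous_at)
    qed
    then show "continuous_on UNIV (P u)" by (simp add: continuous_at_imp_continuous_on)
    show "norm (P u t) \<le> norm v0 + M / l" for t
    proof -
      let ?c = "max 0 t"
      have "norm (P u t) \<le> exp (- l * ?c) * (norm v0 + M * ?c)"
        using norm_triangle_ineq[of v0 "integral {0..?c} (f u)"] bf[OF u, of ?c]
        by (simp add: P_def mult_left_mono)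
      also have "\<dots> = exp (- l * ?c) * norm v0 + M / l * (exp (- l * ?c) * (l * ?c))"
        using L by (simp add: field_simps)
      also have "exp (- l * ?c) * norm v0 \<le> 1 * norm v0"
        using L by (intro mult_right_mono) auto
      also have "M / l * (exp (- l * ?c) * (l * ?c)) \<le> M / l * 1"
      proof (intro mult_left_mono)
        have "l * ?c \<le> exp (l * ?c)" using exp_ge_add_one_self[of "l * ?c"] by linarith
        then have "exp (- l * ?c) * (l * ?c) \<le> exp (- l * ?c) * exp (l * ?c)"
          by (intro mult_left_mono) auto
        then show "exp (- l * ?c) * (l * ?c) \<le> 1" by (simp add: exp_minus)
      qed (use M L in auto)
      finally show ?thesis by simp
    qed
  qed
  have contr: "dist (P u t) (P v t) \<le> L / l * D"
    if u: "continuous_on UNIV u" and v: "continuous_on UNIV v" and D: "\<And>s. dist (u s) (v s) \<le> D" for u v D t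
  proof -
    let ?c = "max 0 t"
    have D0: "D \<ge> 0" using D[of 0] zero_le_dist order_trans by blast
    have int: "((\<lambda>s. L * D * exp (l * s)) has_integral (L * D * exp (l * ?c) / l - L * D * exp (l * 0) / l)) {0..?c}"
      using L by (intro fundamental_theorem_of_calculus)
        (auto intro!: derivative_eq_intros simp flip: has_real_derivative_iff_has_vector_derivative)
    have "norm (integral {0..?c} (\<lambda>s. f u s - f v s)) \<le> integral {0..?c} (\<lambda>s. L * D * exp (l * s))"
    proof (rule integral_norm_bound_integral)
      show "norm (f u s - f v s) \<le> L * D * exp (l * s)" for s
      proof -
        have "norm (f u s - f v s) \<le> L * dist (exp (l * s) *\<^sub>R u s + w s) (exp (l * s) *\<^sub>R v s + w s)"
          using lipschitz_onD[OF lip, of "exp (l * s) *\<^sub>R u s + w s" "exp (l * s) *\<^sub>R v s + w s"]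
          by (simp only: f_def dist_norm UNIV_I simp_thms)
        also have "\<dots> = L * (exp (l * s) * dist (u s) (v s))"
          by (simp add: dist_norm flip: scaleR_diff_right)
        also have "\<dots> \<le> L * (exp (l * s) * D)" using L D by (intro mult_left_mono) auto
        finally show ?thesis by (simp add: mult_ac)
      qed
    qed (use int in \<open>auto intro!: integrable_continuous_real continuous_on_diff cf u v simp: has_integral_integrable\<close>)
    also have "\<dots> = L * D * exp (l * ?c) / l - L * D / l" using integral_unique[OF int] by simp
    also have "\<dots> \<le> L * D * exp (l * ?c) / l" using L D0 by simp
    finally have le: "norm (integral {0..?c} (\<lambda>s. f u s - f v s)) \<le> L * D * exp (l * ?c) / l" .
    have "P u t - P v t = exp (- l * ?c) *\<^sub>R (integral {0..?c} (f u) - integral {0..?c} (f v))"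
      by (simp add: P_def scaleR_add_right scaleR_diff_right)
    also have "integral {0..?c} (f u) - integral {0..?c} (f v) = integral {0..?c} (\<lambda>s. f u s - f v s)"
      by (rule integral_diff[symmetric]) (auto intro!: integrable_continuous_real cf u v)
    finally have "dist (P u t) (P v t) = exp (- l * ?c) * norm (integral {0..?c} (\<lambda>s. f u s - f v s))"
      by (simp add: dist_norm)
    also have "\<dots> \<le> exp (- l * ?c) * (L * D * exp (l * ?c) / l)" using le by (intro mult_left_mono) auto
    also have "\<dots> = L / l * D" by (simp add: exp_minus field_simps)
    finally show ?thesis .
  qed
  have app: "apply_bcontfun (Bcontfun (P (apply_bcontfun u))) = P (apply_bcontfun u)" for u :: "real \<Rightarrow>\<^sub>C 'a"
    by (intro Bcontfun_inverse P) auto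
  have "\<exists>!u :: real \<Rightarrow>\<^sub>C 'a. Bcontfun (P (apply_bcontfun u)) = u"
  proof (rule banach_fix_type)
    show "\<forall>u v. dist (Bcontfun (P (apply_bcontfun u))) (Bcontfun (P (apply_bcontfun v)))
        \<le> L / l * dist (u :: real \<Rightarrow>\<^sub>C 'a) v"
    proof (intro allI dist_bound)
      fix u v :: "real \<Rightarrow>\<^sub>C 'a" and t
      show "dist (apply_bcontfun (Bcontfun (P (apply_bcontfun u))) t)
          (apply_bcontfun (Bcontfun (P (apply_bcontfun v))) t) \<le> L / l * dist u v"
        unfolding app by (rule contr) (auto intro: dist_bounded)
    qed
  qed (use L in auto)
  then obtain u :: "real \<Rightarrow>\<^sub>C 'a" where "Bcontfun (P (apply_bcontfun u)) = u" by blast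
  then have u: "P (apply_bcontfun u) t = apply_bcontfun u t" for t using app by metis
  define V where "V t = exp (l * t) *\<^sub>R apply_bcontfun u t + w t" for t
  have cV: "continuous_on {0..} V" unfolding V_def by (intro continuous_intros w) auto
  have "V t = v0 + w t + integral {0..t} (\<lambda>s. b (V s))" if "t \<ge> 0" for t
  proof -
    have "apply_bcontfun u t = exp (- l * t) *\<^sub>R (v0 + integral {0..t} (\<lambda>s. b (V s)))"
      using u[of t] that by (simp add: P_def f_def[abs_def] V_def)
    then show ?thesis by (simp add: V_def exp_minus)
  qed
  then have "solves b w v0 V T" for T
    by (intro solves_integralI cb continuous_on_subset[OF cV]) auto
  with cV show ?thesis by blast
qed

text \<open>Look at the infimum of the times of disagreement: both paths stay close to V there for a
  short while, \<open>b\<close> is Lipschitz in that ball, and the largest difference on a short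
  interval is at most half of itself. Only \<open>V\<close> is required to run through good points;
  \<open>V'\<close> is drawn into the ball by continuity.\<close>

lemma solves_unique:
  assumes V: "solves b w v0 V T" and V': "solves b w v0 V' T"
    and lip: "\<And>t. t \<in> {0..T} \<Longrightarrow> lipschitz_near b (V t)" and t: "t \<in> {0..T}"
  shows "V' t = V t"
proof (rule ccontr)
  assume ne: "V' t \<noteq> V t"
  define A where "A = {t\<in>{0..T}. V' t \<noteq> V t}"
  define t0 where "t0 = Inf A"
  have A: "A \<noteq> {}" "bdd_below A" using ne t by (auto simp: A_def intro!: bdd_belowI[of _ 0])
  have t0: "t0 \<in> {0..T}"
  proof -
    have "0 \<le> t0" unfolding t0_def by (rule cInf_greatest) (use A in \<open>auto simp: A_def\<close>)
    moreover have "t0 \<le> t" unfolding t0_def by (rule cInf_lower) (use A ne t in \<open>auto simp: A_def\<close>)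
    ultimately show ?thesis using t by auto
  qed
  have before: "V' s = V s" if "s \<in> {0..<t0}" for s
  proof (rule ccontr)
    assume "V' s \<noteq> V s"
    then have "s \<in> A" using that t0 by (auto simp: A_def)
    then have "t0 \<le> s" unfolding t0_def using A(2) by (rule cInf_lower)
    with that show False by simp
  qed
  have diff: "V' s - V s = (LINT r:{0..s}|lborel. b (V' r) - b (V r))"
    and int: "set_integrable lborel {0..s} (\<lambda>r. b (V' r) - b (V r))" if "s \<in> {0..T}" for s
  proof -
    have i: "set_integrable lborel {0..s} (\<lambda>r. b (V' r))" "set_integrable lborel {0..s} (\<lambda>r. b (V r))"
      using V V' that by (auto simp: solves_def)
    show "set_integrable lborel {0..s} (\<lambda>r. b (V' r) - b (V r))" using i by (rule set_integral_diff)
    have "V' s = v0 + w s + (LINT r:{0..s}|lborel. b (V' r))" "V s = v0 + w s + (LINT r:{0..s}|lborel. b (V r))"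
      using V V' that by (auto simp: solves_def)
    then show "V' s - V s = (LINT r:{0..s}|lborel. b (V' r) - b (V r))"
      using set_integral_diff(2)[OF i] by simp
  qed
  \<comment> \<open>The integrand vanishes on [0, t0), and the single point t0 is a null set. This
    also covers t0 = 0.\<close>
  have at: "V' t0 = V t0"
  proof -
    have "(LINT r:{0..t0}|lborel. b (V' r) - b (V r)) = (LINT r:{0..t0}|lborel. (0::'a))"
      unfolding set_lebesgue_integral_def
      by (rule integral_discrete_difference[where X = "{t0}"]) (use before in \<open>auto simp: indicator_def\<close>)
    then show ?thesis using diff[OF t0] by (simp add: set_lebesgue_integral_def)
  qed
  obtain e L where e: "e > 0" "L \<ge> 0"
      "\<And>y z. y \<in> ball (V t0) e \<Longrightarrow> z \<in> ball (V t0) e \<Longrightarrow> dist (b y) (b z) \<le> L * dist y z"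
    using lipschitz_nearE[OF lip[OF t0]] by blast
  have c: "continuous_on {0..T} V" "continuous_on {0..T} V'" using V V' by (auto simp: solves_def)
  obtain d1 where d1: "d1 > 0" "\<And>s. s \<in> {0..T} \<Longrightarrow> dist s t0 < d1 \<Longrightarrow> dist (V s) (V t0) < e"
    using c(1)[unfolded continuous_on_iff, rule_format, OF t0 e(1)] by blast
  obtain d2 where d2: "d2 > 0" "\<And>s. s \<in> {0..T} \<Longrightarrow> dist s t0 < d2 \<Longrightarrow> dist (V' s) (V' t0) < e"
    using c(2)[unfolded continuous_on_iff, rule_format, OF t0 e(1)] by blast
  \<comment> \<open>The last bound gives L h < 1/2, which makes the contraction work; the other two
    keep both paths in the ball.\<close>
  define h where "h = min (min (d1 / 2) (d2 / 2)) (1 / (2 * (L + 1)))"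
  have h: "h > 0" using d1 d2 e by (auto simp: h_def)
  define J where "J = {t0..min T (t0 + h)}"
  have J: "s \<in> {0..T}" "dist s t0 < d1" "dist s t0 < d2" "s - t0 \<le> 1 / (2 * (L + 1))" "t0 \<le> s" if "s \<in> J" for s
    using that h t0 d1(1) d2(1) by (auto simp: J_def h_def dist_real_def)
  have "compact J" "J \<noteq> {}" using t0 h by (auto simp: J_def)
  moreover have "J \<subseteq> {0..T}" using J(1) by (rule subsetI)
  then have "continuous_on J (\<lambda>s. dist (V' s) (V s))"
    by (intro continuous_on_dist) (rule continuous_on_subset[OF c(2)] continuous_on_subset[OF c(1)], assumption)+
  ultimately obtain m where m: "m \<in> J" "\<And>s. s \<in> J \<Longrightarrow> dist (V' s) (V s) \<le> dist (V' m) (V m)"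
    using continuous_attains_sup[of J "\<lambda>s. dist (V' s) (V s)"] by blast
  define D where "D = dist (V' m) (V m)"
  have bound: "norm (indicator {0..m} r *\<^sub>R (b (V' r) - b (V r))) \<le> L * D * indicator {t0..m} r" for r
  proof -
    have "r \<notin> {0..m} \<or> r \<in> {0..<t0} \<or> r \<in> {t0..m}" by (simp add: not_le) linarith
    moreover have "0 \<le> L * D * indicator {t0..m} r"
      using e(2) unfolding D_def by (intro mult_nonneg_nonneg) simp_all
    ultimately show ?thesis
    proof (elim disjE)
      assume "r \<notin> {0..m}"
      then show ?thesis using \<open>0 \<le> L * D * indicator {t0..m} r\<close> by simp
    next
      assume 2: "r \<in> {0..<t0}"
      then show ?thesis using before[OF 2] \<open>0 \<le> L * D * indicator {t0..m} r\<close> by simp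
    next
      assume 3: "r \<in> {t0..m}"
      then have r: "r \<in> J" using m(1) by (auto simp: J_def)
      have "dist (b (V' r)) (b (V r)) \<le> L * dist (V' r) (V r)"
        using d1(2)[of r] d2(2)[of r] J[OF r] at by (intro e(3)) (auto simp: dist_commute)
      also have "\<dots> \<le> L * D" using m(2)[OF r] e(2) by (auto simp: D_def intro: mult_left_mono)
      finally show ?thesis using 3 t0 by (auto simp: dist_norm)
    qed
  qed
  have "D = norm (LINT r:{0..m}|lborel. b (V' r) - b (V r))"
    using diff[OF J(1)[OF m(1)]] by (simp add: D_def dist_norm)
  also have "\<dots> \<le> (LINT r|lborel. norm (indicator {0..m} r *\<^sub>R (b (V' r) - b (V r))))"
    unfolding set_lebesgue_integral_def by (rule integral_norm_bound)
  also have "\<dots> \<le> (LINT r|lborel. L * D * indicator {t0..m} r)"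
  proof (rule integral_mono[OF _ _ bound])
    show "integrable lborel (\<lambda>r. norm (indicator {0..m} r *\<^sub>R (b (V' r) - b (V r))))"
      using int[OF J(1)[OF m(1)]] unfolding set_integrable_def by (rule integrable_norm)
    show "integrable lborel (\<lambda>r. L * D * indicator {t0..m} r)"
      by (intro integrable_mult_right integrable_real_indicator)
        (simp_all add: emeasure_lborel_Icc_eq)
  qed
  also have "\<dots> = L * D * (m - t0)" using J(5)[OF m(1)] by simp
  also have "\<dots> \<le> L * D * (1 / (2 * (L + 1)))"
    using J(4)[OF m(1)] e(2) by (intro mult_left_mono) (auto simp: D_def)
  also have "\<dots> = D * (L / (L + 1)) / 2" by (simp add: field_simps)
  also have "\<dots> \<le> D * 1 / 2"
    using e(2) by (intro divide_right_mono mult_left_mono) (auto simp: D_def divide_simps)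
  finally have "D = 0" by (simp add: D_def)
  then have eqJ: "V' s = V s" if "s \<in> J" for s using m(2)[OF that] by (simp add: D_def)
  \<comment> \<open>Agreement on \<open>J\<close> pushes every time of disagreement beyond t0 + h,
    against the choice of t0 as infimum.\<close>
  have gap: "t0 + h \<le> s" if "s \<in> A" for s
  proof -
    have "t0 \<le> s" unfolding t0_def using that A(2) by (rule cInf_lower)
    moreover have "s \<notin> J" using eqJ that by (auto simp: A_def)
    ultimately show ?thesis using that by (auto simp: J_def A_def)
  qed
  have "t0 + h \<le> Inf A" by (rule cInf_greatest[OF A(1) gap])
  then show False using h unfolding t0_def by linarith
qed

text \<open>The Euler-Maruyama recursion along one fixed path \<open>w\<close>. With
  \<open>w\<close> deterministic it is subject to convergence; with \<open>w\<close> a Brownian path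
  it is a random variable.\<close>

primrec euler :: "('a::real_vector \<Rightarrow> 'a) \<Rightarrow> (real \<Rightarrow> 'a) \<Rightarrow> 'a \<Rightarrow> real \<Rightarrow> nat \<Rightarrow> 'a" where
  "euler b w v0 h 0 = v0"
| "euler b w v0 h (Suc k) = euler b w v0 h k + h *\<^sub>R b (euler b w v0 h k)
     + (w (real (Suc k) * h) - w (real k * h))"

text \<open>Left-endpoint quadrature on one mesh cell, with \<omega> a bound for the oscillation of
  the integrand.\<close>

lemma integral_step_bound:
  fixes f :: "real \<Rightarrow> 'a::euclidean_space"
  assumes "continuous_on {0..T} f" "0 \<le> a" "a \<le> b" "b \<le> T" "\<And>s. s \<in> {a..b} \<Longrightarrow> norm (f s - f a) \<le> \<omega>"
  shows "norm (integral {0..b} f - integral {0..a} f - (b - a) *\<^sub>R f a) \<le> \<omega> * (b - a)"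
proof -
  have c: "continuous_on {a..b} f" "continuous_on {0..b} f"
    using assms by (auto intro: continuous_on_subset)
  have "integral {0..a} f + integral {a..b} f = integral {0..b} f"
    using assms c by (intro Henstock_Kurzweil_Integration.integral_combine integrable_continuous_real) auto
  then have "integral {0..b} f - integral {0..a} f = integral {a..b} f" by (metis add_diff_cancel_left')
  moreover have "integral {a..b} (\<lambda>s. f s - f a) = integral {a..b} f - (b - a) *\<^sub>R f a"
    using assms(3) c by (subst integral_diff) (auto intro!: integrable_continuous_real)
  ultimately have "integral {0..b} f - integral {0..a} f - (b - a) *\<^sub>R f a = integral {a..b} (\<lambda>s. f s - f a)"
    by simp
  also have "norm \<dots> \<le> \<omega> * (b - a)"
    using assms c by (intro integral_bound continuous_intros) auto
  finally show ?thesis .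
qed

lemma uniform_mesh:
  fixes f :: "real \<Rightarrow> 'a::euclidean_space"
  assumes "continuous_on {0..T} f" "T \<ge> 0" "\<omega> > 0"
  obtains N0 where "N0 > 0" "\<And>N s r. N \<ge> N0 \<Longrightarrow> s \<in> {0..T} \<Longrightarrow> r \<in> {0..T} \<Longrightarrow> \<bar>s - r\<bar> \<le> T / real N
      \<Longrightarrow> norm (f s - f r) \<le> \<omega>"
proof -
  have "uniformly_continuous_on {0..T} f" using assms(1) by (intro compact_uniformly_continuous) auto
  then obtain d where d: "d > 0" "\<And>s r. s \<in> {0..T} \<Longrightarrow> r \<in> {0..T} \<Longrightarrow> dist r s < d \<Longrightarrow> dist (f r) (f s) < \<omega>"
    unfolding uniformly_continuous_on_def using assms(3) by metis
  obtain N0 :: nat where N0: "real N0 > T / d" using reals_Archimedean2 by blast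
  show ?thesis
  proof (rule that[of "Suc N0"])
    fix N s r assume *: "N \<ge> Suc N0" "s \<in> {0..T}" "r \<in> {0..T}" "\<bar>s - r\<bar> \<le> T / real N"
    have "T < d * real N0" using N0 d(1) by (simp add: field_simps)
    also have "\<dots> \<le> d * real N" using *(1) d(1) by (intro mult_left_mono) auto
    finally have "T / real N < d" using *(1) by (simp add: field_simps)
    then have "dist s r < d" using *(4) by (simp add: dist_real_def)
    then show "norm (f s - f r) \<le> \<omega>" using d(2)[OF *(3,2)] by (simp add: dist_norm)
  qed simp
qed

text \<open>A discrete Gronwall argument. Scheme and solution receive the same increments of
  \<open>w\<close>, so the noise cancels and only the error of freezing the drift over a cell is
  left. It is controlled by the modulus of continuity of \<open>V\<close>, hence no rate is obtained
  and none is needed.\<close>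

lemma euler_converges:
  fixes b :: "'a::euclidean_space \<Rightarrow> 'a"
  assumes V: "solves b w v0 V T" and w0: "w 0 = 0" and lip: "L-lipschitz_on UNIV b"
    and "T \<ge> 0" "\<epsilon> > 0"
  obtains N0 where "N0 > 0"
    "\<And>N k. N \<ge> N0 \<Longrightarrow> k \<le> N \<Longrightarrow> dist (euler b w v0 (T / real N) k) (V (real k * (T / real N))) < \<epsilon>"
proof -
  have L: "L \<ge> 0" using lip by (rule lipschitz_on_nonneg)
  have cb: "continuous_on UNIV b" using lip by (rule lipschitz_on_continuous_on)
  have cV: "continuous_on {0..T} V" using V by (simp add: solves_def)
  have cbV: "continuous_on {0..T} (\<lambda>s. b (V s))" by (rule continuous_on_compose2[OF cb cV]) simp
  \<comment> \<open>Chosen so that the accumulated error \<omega> exp (L T) equals \<epsilon> /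
    2.\<close>
  define \<omega> where "\<omega> = \<epsilon> / (2 * exp (L * T))"
  have \<omega>: "\<omega> > 0" using \<open>\<epsilon> > 0\<close> by (simp add: \<omega>_def)
  obtain N0 where N0: "N0 > 0" "\<And>N s r. N \<ge> N0 \<Longrightarrow> s \<in> {0..T} \<Longrightarrow> r \<in> {0..T} \<Longrightarrow> \<bar>s - r\<bar> \<le> T / real N
      \<Longrightarrow> norm (V s - V r) \<le> \<omega>"
    using uniform_mesh[OF cV \<open>T \<ge> 0\<close> \<omega>] by blast
  show ?thesis
  proof (rule that[OF N0(1)])
    fix N k :: nat assume N: "N \<ge> N0" and kN: "k \<le> N"
    define h where "h = T / real N"
    have h: "h \<ge> 0" "real N * h = T" using N N0(1) \<open>T \<ge> 0\<close> by (auto simp: h_def)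
    have kh: "real k * h \<le> T" if "k \<le> N" for k
      using that h by (metis mult_right_mono of_nat_le_iff)
    \<comment> \<open>The -1 absorbs the new error L \<omega> h of each step exactly: the recursion
      turns it into (1 + L h) exp (L k h) - 1.\<close>
    have "norm (euler b w v0 h k - V (real k * h)) \<le> \<omega> * (exp (L * (real k * h)) - 1)"
      using kN
    proof (induction k)
      case 0
      have "V 0 = v0" using solves_integral[OF V cb, of 0] \<open>T \<ge> 0\<close> w0 by simp
      then show ?case by simp
    next
      case (Suc k)
      let ?a = "real k * h" and ?b = "real (Suc k) * h"
      let ?E = "euler b w v0 h k"
      have ab: "0 \<le> ?a" "?a \<le> ?b" "?b \<le> T" "?b - ?a = h"
        using h kh[OF Suc.prems] by (auto simp: algebra_simps)
      have IH: "norm (?E - V ?a) \<le> \<omega> * (exp (L * ?a) - 1)" using Suc by simp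
      have step: "norm (integral {0..?b} (\<lambda>s. b (V s)) - integral {0..?a} (\<lambda>s. b (V s)) - (?b - ?a) *\<^sub>R b (V ?a))
          \<le> L * \<omega> * (?b - ?a)"
      proof (rule integral_step_bound[OF cbV ab(1,2,3)])
        fix s assume s: "s \<in> {?a..?b}"
        have "norm (b (V s) - b (V ?a)) \<le> L * norm (V s - V ?a)"
          using lipschitz_onD[OF lip] by (simp add: dist_norm)
        also have "\<dots> \<le> L * \<omega>" using N0(2)[OF N, of s ?a] s ab L h_def by (intro mult_left_mono) auto
        finally show "norm (b (V s) - b (V ?a)) \<le> L * \<omega>" .
      qed
      have "V ?b - V ?a = (w ?b - w ?a) + (integral {0..?b} (\<lambda>s. b (V s)) - integral {0..?a} (\<lambda>s. b (V s)))"
        using solves_integral[OF V cb, of ?b] solves_integral[OF V cb, of ?a] ab by simp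
      then have "euler b w v0 h (Suc k) - V ?b = (?E - V ?a) + h *\<^sub>R (b ?E - b (V ?a))
          - (integral {0..?b} (\<lambda>s. b (V s)) - integral {0..?a} (\<lambda>s. b (V s)) - (?b - ?a) *\<^sub>R b (V ?a))"
        unfolding ab(4) by (simp add: algebra_simps)
      then have "norm (euler b w v0 h (Suc k) - V ?b) \<le> norm (?E - V ?a) + h * norm (b ?E - b (V ?a)) + L * \<omega> * h"
        using step h norm_triangle_ineq[of "?E - V ?a" "h *\<^sub>R (b ?E - b (V ?a))"] ab(4)
        by (smt (verit) norm_scaleR norm_triangle_ineq4)
      also have "\<dots> \<le> norm (?E - V ?a) + h * (L * norm (?E - V ?a)) + L * \<omega> * h"
        using h lipschitz_onD[OF lip, of ?E "V ?a"]
        by (intro add_mono[OF add_mono[OF order_refl mult_left_mono] order_refl]) (auto simp: dist_norm)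
      also have "\<dots> = (1 + L * h) * norm (?E - V ?a) + L * \<omega> * h" by (simp add: algebra_simps)
      also have "\<dots> \<le> (1 + L * h) * (\<omega> * (exp (L * ?a) - 1)) + L * \<omega> * h"
        using L h by (intro add_mono mult_left_mono[OF IH]) auto
      also have "\<dots> = \<omega> * ((1 + L * h) * exp (L * ?a) - 1)" by (simp add: algebra_simps)
      also have "\<dots> \<le> \<omega> * (exp (L * h) * exp (L * ?a) - 1)"
        using \<omega> exp_ge_add_one_self[of "L * h"] by (intro mult_left_mono diff_right_mono mult_right_mono) auto
      also have "exp (L * h) * exp (L * ?a) = exp (L * ?b)"
        by (simp add: algebra_simps flip: exp_add)
      finally show ?case .
    qed
    also have "\<dots> \<le> \<omega> * exp (L * (real k * h))" using \<omega> by simp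
    also have "\<dots> \<le> \<omega> * exp (L * T)" using \<omega> L kh[OF kN] by (simp add: mult_left_mono)
    also have "\<dots> < \<epsilon>" using \<open>\<epsilon> > 0\<close> by (simp add: \<omega>_def)
    finally show "dist (euler b w v0 (T / real N) k) (V (real k * (T / real N))) < \<epsilon>"
      by (simp add: dist_norm h_def)
  qed
qed

text \<open>Exhibits the solution at time \<open>T\<close> as a limit of explicit functionals of the
  path, which is what makes it adapted. The next lemma does the same for the position.\<close>

lemma euler_LIMSEQ:
  fixes b :: "'a::euclidean_space \<Rightarrow> 'a"
  assumes "solves b w v0 V T" "w 0 = 0" "L-lipschitz_on UNIV b" "T \<ge> 0"
  shows "(\<lambda>N. euler b w v0 (T / real N) N) \<longlonglongrightarrow> V T"
proof (rule metric_LIMSEQ_I)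
  fix \<epsilon> :: real assume "\<epsilon> > 0"
  obtain N0 where N0: "N0 > 0" "\<And>N k. N \<ge> N0 \<Longrightarrow> k \<le> N \<Longrightarrow>
      dist (euler b w v0 (T / real N) k) (V (real k * (T / real N))) < \<epsilon>"
    using euler_converges[OF assms \<open>\<epsilon> > 0\<close>] by blast
  show "\<exists>no. \<forall>n\<ge>no. dist (euler b w v0 (T / real n) n) (V T) < \<epsilon>"
  proof (intro exI[of _ N0] allI impI)
    fix n assume "n \<ge> N0"
    then show "dist (euler b w v0 (T / real n) n) (V T) < \<epsilon>" using N0(2)[of n n] N0(1) by simp
  qed
qed

lemma riemann_LIMSEQ:
  fixes f :: "real \<Rightarrow> 'a::euclidean_space"
  assumes cf: "continuous_on {0..T} f" and "T \<ge> 0"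
  shows "(\<lambda>N. \<Sum>k<N. (T / real N) *\<^sub>R f (real k * (T / real N))) \<longlonglongrightarrow> integral {0..T} f"
proof (rule metric_LIMSEQ_I)
  fix \<epsilon> :: real assume "\<epsilon> > 0"
  define \<omega> where "\<omega> = \<epsilon> / (2 * (T + 1))"
  have \<omega>: "\<omega> > 0" using \<open>\<epsilon> > 0\<close> \<open>T \<ge> 0\<close> by (simp add: \<omega>_def)
  obtain N0 where N0: "N0 > 0" "\<And>N s r. N \<ge> N0 \<Longrightarrow> s \<in> {0..T} \<Longrightarrow> r \<in> {0..T} \<Longrightarrow> \<bar>s - r\<bar> \<le> T / real N
      \<Longrightarrow> norm (f s - f r) \<le> \<omega>"
    using uniform_mesh[OF cf \<open>T \<ge> 0\<close> \<omega>] by blast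
  show "\<exists>no. \<forall>N\<ge>no. dist (\<Sum>k<N. (T / real N) *\<^sub>R f (real k * (T / real N))) (integral {0..T} f) < \<epsilon>"
  proof (intro exI[of _ N0] allI impI)
    fix N assume N: "N \<ge> N0"
    define h where "h = T / real N"
    have h: "h \<ge> 0" "real N * h = T" using N N0(1) \<open>T \<ge> 0\<close> by (auto simp: h_def)
    have kh: "real k * h \<le> T" if "k \<le> N" for k
      using that h by (metis mult_right_mono of_nat_le_iff)
    have "norm (integral {0..real k * h} f - (\<Sum>j<k. h *\<^sub>R f (real j * h))) \<le> \<omega> * (real k * h)" if "k \<le> N" for k
      using that
    proof (induction k)
      case (Suc k)
      let ?a = "real k * h" and ?b = "real (Suc k) * h"
      have ab: "0 \<le> ?a" "?a \<le> ?b" "?b \<le> T" "?b - ?a = h"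
        using h kh[OF Suc.prems] by (auto simp: algebra_simps)
      have step: "norm (integral {0..?b} f - integral {0..?a} f - (?b - ?a) *\<^sub>R f ?a) \<le> \<omega> * (?b - ?a)"
      proof (rule integral_step_bound[OF cf ab(1,2,3)])
        fix s assume s: "s \<in> {?a..?b}"
        show "norm (f s - f ?a) \<le> \<omega>" using s ab h_def by (intro N0(2)[OF N]) auto
      qed
      have "integral {0..?b} f - (\<Sum>j<Suc k. h *\<^sub>R f (real j * h))
          = (integral {0..?a} f - (\<Sum>j<k. h *\<^sub>R f (real j * h))) + (integral {0..?b} f - integral {0..?a} f - h *\<^sub>R f ?a)"
        by simp
      also have "norm \<dots> \<le> \<omega> * ?a + \<omega> * h"
        using Suc step ab(4) by (intro order_trans[OF norm_triangle_ineq] add_mono) auto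
      also have "\<dots> = \<omega> * ?b" by (simp add: algebra_simps)
      finally show ?case .
    qed simp
    from this[of N] have "norm (integral {0..T} f - (\<Sum>k<N. h *\<^sub>R f (real k * h))) \<le> \<omega> * T"
      using h by simp
    also have "\<dots> < \<epsilon>"
    proof -
      have "\<omega> * T \<le> \<epsilon> / 2" using \<open>T \<ge> 0\<close> \<open>\<epsilon> > 0\<close> by (simp add: \<omega>_def field_simps)
      then show ?thesis using \<open>\<epsilon> > 0\<close> by simp
    qed
    finally show "dist (\<Sum>k<N. (T / real N) *\<^sub>R f (real k * (T / real N))) (integral {0..T} f) < \<epsilon>"
      by (simp add: dist_norm norm_minus_commute h_def)
  qed
qed

section \<open>Gaussian moments\<close>

text \<open>Fubini over the coordinates. Lebesgue measure on vectors is the image of a product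
  measure indexed by basis vectors, so \<open>ix\<close> translates a basis vector back into its
  coordinate index.\<close>

lemma integral_vec_prod:
  fixes f :: "'n::finite \<Rightarrow> real \<Rightarrow> real"
  assumes int: "\<And>i. integrable lborel (f i)"
  shows "integrable lborel (\<lambda>x::real^'n. \<Prod>i\<in>UNIV. f i (x $ i))"
    and "integral\<^sup>L lborel (\<lambda>x::real^'n. \<Prod>i\<in>UNIV. f i (x $ i)) = (\<Prod>i\<in>UNIV. \<integral>t. f i t \<partial>lborel)"
proof -
  have m[measurable]: "f i \<in> borel_measurable borel" for i
    using borel_measurable_integrable[OF int[of i]] by simp
  interpret product_sigma_finite "\<lambda>_::real^'n. lborel :: real measure" by standard
  define ix where "ix b = (SOME i. b = axis i (1::real))" for b :: "real^'n"
  have ix: "ix (axis i 1) = i" for i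
    unfolding ix_def by (rule some_equality) (auto simp: axis_eq_axis)
  have B: "(Basis :: (real^'n) set) = (\<lambda>i. axis i 1) ` UNIV" by (auto simp: Basis_vec_def)
  have inj: "inj (\<lambda>i::'n. axis i (1::real))" by (auto simp: inj_def axis_eq_axis)
  define g where "g = (\<lambda>x::real^'n. \<Prod>i\<in>UNIV. f i (x $ i))"
  have gm: "g \<in> borel_measurable borel" unfolding g_def by measurable
  let ?S = "\<lambda>y. \<Sum>b\<in>Basis. y b *\<^sub>R (b::real^'n)"
  have Sm: "?S \<in> measurable (\<Pi>\<^sub>M b\<in>Basis. lborel) borel" by measurable
  have gS: "g (?S y) = (\<Prod>b\<in>Basis. f (ix b) (y b))" for y
  proof -
    have "?S y $ i = y (axis i 1)" for i
    proof -
      have "?S y $ i = ?S y \<bullet> axis i 1" by (simp add: inner_axis)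
      also have "\<dots> = y (axis i 1)" by (rule inner_sum_left_Basis) (simp add: B)
      finally show ?thesis .
    qed
    then show ?thesis unfolding g_def B by (subst prod.reindex[OF inj]) (simp add: ix)
  qed
  have l: "(lborel :: (real^'n) measure) = distr (\<Pi>\<^sub>M b\<in>Basis. lborel) borel ?S" by (rule lborel_eq)
  have "integrable (\<Pi>\<^sub>M b\<in>Basis. lborel) (\<lambda>y. \<Prod>b\<in>(Basis::(real^'n) set). f (ix b) (y b))"
    by (intro product_integrable_prod int finite_Basis)
  then have "integrable lborel g"
    by (subst l, subst integrable_distr_eq[OF Sm gm]) (simp add: gS)
  then show "integrable lborel (\<lambda>x::real^'n. \<Prod>i\<in>UNIV. f i (x $ i))" by (simp add: g_def)
  have "integral\<^sup>L lborel g = (\<integral>y. (\<Prod>b\<in>(Basis::(real^'n) set). f (ix b) (y b)) \<partial>(\<Pi>\<^sub>M b\<in>Basis. lborel))"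
    by (subst l, subst integral_distr[OF Sm gm]) (simp add: gS)
  also have "\<dots> = (\<Prod>b\<in>(Basis::(real^'n) set). \<integral>t. f (ix b) t \<partial>lborel)"
    by (intro product_integral_prod int finite_Basis)
  also have "\<dots> = (\<Prod>i\<in>UNIV. \<integral>t. f i t \<partial>lborel)"
    unfolding B by (subst prod.reindex[OF inj]) (simp add: ix)
  finally show "integral\<^sup>L lborel (\<lambda>x::real^'n. \<Prod>i\<in>UNIV. f i (x $ i)) = (\<Prod>i\<in>UNIV. \<integral>t. f i t \<partial>lborel)"
    by (simp add: g_def)
qed

definition gauss_density :: "real \<Rightarrow> real ^ 'n \<Rightarrow> real" where
  "gauss_density \<sigma> x = (\<Prod>i\<in>UNIV. normal_density 0 \<sigma> (x $ i))"

lemma gauss_density_nonneg: "gauss_density \<sigma> x \<ge> 0"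
  unfolding gauss_density_def by (intro prod_nonneg) auto

lemma gauss_density_measurable[measurable]: "gauss_density \<sigma> \<in> borel_measurable borel"
  unfolding gauss_density_def[abs_def] by measurable

lemma gauss_product_moment:
  fixes h :: "'n::finite \<Rightarrow> real \<Rightarrow> real"
  assumes "\<And>i. has_bochner_integral lborel (\<lambda>t. normal_density 0 \<sigma> t * h i t) (c i)"
  shows "has_bochner_integral lborel (\<lambda>x::real^'n. gauss_density \<sigma> x * (\<Prod>i\<in>UNIV. h i (x $ i))) (\<Prod>i\<in>UNIV. c i)"
proof -
  have i: "integrable lborel (\<lambda>t. normal_density 0 \<sigma> t * h i t)" "(\<integral>t. normal_density 0 \<sigma> t * h i t \<partial>lborel) = c i" for i
    using assms[of i] by (auto simp: has_bochner_integral_iff)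
  from integral_vec_prod[where f = "\<lambda>i t. normal_density 0 \<sigma> t * h i t", OF i(1)] i(2)
  show ?thesis by (simp add: has_bochner_integral_iff gauss_density_def prod.distrib)
qed

text \<open>Cauchy-Schwarz against the constant 1. It reduces the fourth moment of the norm to
  fourth moments of single coordinates.\<close>

lemma norm_power4_le: "norm (x::real^'n::finite) ^ 4 \<le> real CARD('n) * (\<Sum>i\<in>UNIV. (x $ i) ^ 4)"
proof -
  have "norm x ^ 4 = (\<Sum>i\<in>UNIV. (x $ i)\<^sup>2)\<^sup>2"
    by (simp add: norm_vec_def L2_set_def sum_nonneg power4_eq_xxxx power2_eq_square flip: real_sqrt_mult mult.assoc)
  also have "\<dots> \<le> (\<Sum>i\<in>(UNIV::'n set). 1\<^sup>2) * (\<Sum>i\<in>UNIV. ((x $ i)\<^sup>2)\<^sup>2)"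
    using Cauchy_Schwarz_ineq_sum[of "\<lambda>_. 1" "\<lambda>i. (x $ i)\<^sup>2" "UNIV::'n set"] by simp
  finally show ?thesis by simp
qed

lemma norm_add_power4: "norm (x + y :: 'b::real_normed_vector) ^ 4 \<le> 8 * norm x ^ 4 + 8 * norm y ^ 4"
proof -
  have sq: "(a + b)\<^sup>2 \<le> 2 * a\<^sup>2 + 2 * b\<^sup>2" for a b :: real
    using zero_le_power2[of "a - b"] by (simp add: power2_eq_square algebra_simps)
  have "norm (x + y) ^ 4 \<le> (norm x + norm y) ^ 4" by (intro power_mono norm_triangle_ineq) simp
  also have "\<dots> = ((norm x + norm y)\<^sup>2)\<^sup>2" by simp
  also have "\<dots> \<le> (2 * (norm x)\<^sup>2 + 2 * (norm y)\<^sup>2)\<^sup>2" by (intro power_mono sq) simp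
  also have "\<dots> \<le> 2 * (2 * (norm x)\<^sup>2)\<^sup>2 + 2 * (2 * (norm y)\<^sup>2)\<^sup>2" by (rule sq)
  also have "\<dots> = 8 * norm x ^ 4 + 8 * norm y ^ 4" by (simp add: power_mult_distrib)
  finally show ?thesis .
qed

context
  fixes \<sigma> :: real assumes \<sigma>: "\<sigma> > 0"
begin

lemma normal_moments:
  shows "has_bochner_integral lborel (\<lambda>t. normal_density 0 \<sigma> t * 1) 1"
    and "has_bochner_integral lborel (\<lambda>t. normal_density 0 \<sigma> t * t) 0"
    and "has_bochner_integral lborel (\<lambda>t. normal_density 0 \<sigma> t * t ^ 2) (\<sigma>\<^sup>2)"
    and "has_bochner_integral lborel (\<lambda>t. normal_density 0 \<sigma> t * t ^ 4) (3 * \<sigma> ^ 4)"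
proof -
  show "has_bochner_integral lborel (\<lambda>t. normal_density 0 \<sigma> t * t ^ 2) (\<sigma>\<^sup>2)"
    using normal_moment_even[OF \<sigma>, of 0 1] \<sigma> by (simp add: power2_eq_square)
qed (use normal_moment_even[OF \<sigma>, of 0 0] normal_moment_nz_1[OF \<sigma>, of 0]
    normal_moment_even[OF \<sigma>, of 0 2] \<sigma> in \<open>auto simp: fact_numeral power_divide field_simps\<close>)

lemma gauss_total: "has_bochner_integral lborel (gauss_density \<sigma> :: real^'n::finite \<Rightarrow> real) 1"
  using gauss_product_moment[where h = "\<lambda>_ _. 1" and c = "\<lambda>_. 1" and 'n = 'n] normal_moments(1) by simp

lemma gauss_moment1:
  assumes "has_bochner_integral lborel (\<lambda>t. normal_density 0 \<sigma> t * h t) c"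
  shows "has_bochner_integral lborel (\<lambda>x::real^'n::finite. gauss_density \<sigma> x * h (x $ i)) c"
proof -
  have "has_bochner_integral lborel (\<lambda>x::real^'n. gauss_density \<sigma> x * (\<Prod>k\<in>UNIV. (if k = i then h else (\<lambda>_. 1)) (x $ k)))
      (\<Prod>k\<in>UNIV. if k = i then c else 1)"
    by (rule gauss_product_moment) (use assms normal_moments(1) in auto)
  moreover have "(\<Prod>k\<in>UNIV. (if k = i then h else (\<lambda>_. 1)) (x $ k)) = h (x $ i)" for x :: "real^'n"
  proof -
    have "(\<Prod>k\<in>UNIV. (if k = i then h else (\<lambda>_. 1)) (x $ k)) = (\<Prod>k\<in>UNIV. if k = i then h (x $ i) else 1)"
      by (rule prod.cong) auto
    then show ?thesis by simp
  qed
  ultimately show ?thesis by simp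
qed

text \<open>Off the diagonal the product formula contains the factor E t = 0; all remaining
  coordinates contribute total mass 1.\<close>

lemma gauss_moment_pair:
  shows "has_bochner_integral lborel (\<lambda>x::real^'n::finite. gauss_density \<sigma> x * (x $ i * x $ j)) (if i = j then \<sigma>\<^sup>2 else 0)"
proof (cases "i = j")
  case True
  then show ?thesis using gauss_moment1[OF normal_moments(3), of i] by (simp add: power2_eq_square)
next
  case False
  have "has_bochner_integral lborel (\<lambda>x::real^'n. gauss_density \<sigma> x *
      (\<Prod>k\<in>UNIV. (if k = i \<or> k = j then (\<lambda>t. t) else (\<lambda>_. 1)) (x $ k))) (\<Prod>k\<in>UNIV. if k = i \<or> k = j then 0 else 1)"
    by (rule gauss_product_moment) (use normal_moments(1,2) in auto)
  moreover have "(\<Prod>k\<in>UNIV. (if k = i \<or> k = j then (\<lambda>t. t) else (\<lambda>_. 1)) (x $ k)) = x $ i * x $ j" for x :: "real^'n"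
  proof -
    have "(\<Prod>k\<in>UNIV. (if k = i \<or> k = j then (\<lambda>t. t) else (\<lambda>_. 1)) (x $ k)) = (\<Prod>k\<in>{i, j}. x $ k)"
      by (rule prod.mono_neutral_cong_right) auto
    then show ?thesis using False by simp
  qed
  moreover have "(\<Prod>k\<in>UNIV. if k = i \<or> k = j then 0 else 1) = (0::real)"
    by (rule prod_zero) (auto intro: exI[of _ i])
  ultimately show ?thesis using False by simp
qed

lemma gauss_inner: "has_bochner_integral lborel (\<lambda>x::real^'n::finite. gauss_density \<sigma> x * (c \<bullet> x)) 0"
proof -
  have "has_bochner_integral lborel (\<lambda>x::real^'n. \<Sum>i\<in>UNIV. c $ i * (gauss_density \<sigma> x * x $ i)) (\<Sum>i\<in>UNIV. c $ i * 0)"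
    by (intro has_bochner_integral_sum has_bochner_integral_mult_right gauss_moment1 normal_moments)
  then show ?thesis by (simp add: inner_vec_def sum_distrib_left mult_ac)
qed

lemma gauss_inner_square:
  "has_bochner_integral lborel (\<lambda>x::real^'n::finite. gauss_density \<sigma> x * (c \<bullet> x)\<^sup>2) (\<sigma>\<^sup>2 * (norm c)\<^sup>2)"
proof -
  have "has_bochner_integral lborel (\<lambda>x::real^'n. \<Sum>i\<in>UNIV. \<Sum>j\<in>UNIV. (c $ i * c $ j) * (gauss_density \<sigma> x * (x $ i * x $ j)))
      (\<Sum>i\<in>UNIV. \<Sum>j\<in>UNIV. (c $ i * c $ j) * (if i = j then \<sigma>\<^sup>2 else 0))"
    by (intro has_bochner_integral_sum has_bochner_integral_mult_right gauss_moment_pair)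
  moreover have "(\<Sum>i\<in>UNIV. \<Sum>j\<in>UNIV. (c $ i * c $ j) * (if i = j then \<sigma>\<^sup>2 else 0)) = \<sigma>\<^sup>2 * (norm c)\<^sup>2"
    by (simp add: if_distrib[of "\<lambda>t. _ * t"] dot_square_norm[symmetric] inner_vec_def sum_distrib_left mult_ac cong: if_cong)
  moreover have "(\<Sum>i\<in>UNIV. \<Sum>j\<in>UNIV. (c $ i * c $ j) * (gauss_density \<sigma> x * (x $ i * x $ j))) = gauss_density \<sigma> x * (c \<bullet> x)\<^sup>2" for x :: "real^'n"
    by (simp add: power2_eq_square inner_vec_def sum_product sum_distrib_left mult_ac)
  ultimately show ?thesis by simp
qed

lemma gauss_norm_square:
  "has_bochner_integral lborel (\<lambda>x::real^'n::finite. gauss_density \<sigma> x * (norm x)\<^sup>2) (real CARD('n) * \<sigma>\<^sup>2)"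
proof -
  have "has_bochner_integral lborel (\<lambda>x::real^'n. \<Sum>i\<in>UNIV. gauss_density \<sigma> x * (x $ i * x $ i)) (\<Sum>i\<in>(UNIV::'n set). if i = i then \<sigma>\<^sup>2 else 0)"
    by (intro has_bochner_integral_sum gauss_moment_pair)
  then show ?thesis by (simp add: dot_square_norm[symmetric] inner_vec_def sum_distrib_left)
qed

lemma gauss_fourth:
  "has_bochner_integral lborel (\<lambda>x::real^'n::finite. gauss_density \<sigma> x * (\<Sum>i\<in>UNIV. (x $ i) ^ 4)) (real CARD('n) * (3 * \<sigma> ^ 4))"
proof -
  have "has_bochner_integral lborel (\<lambda>x::real^'n. \<Sum>i\<in>UNIV. gauss_density \<sigma> x * (x $ i) ^ 4) (\<Sum>i\<in>(UNIV::'n set). 3 * \<sigma> ^ 4)"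
    by (intro has_bochner_integral_sum gauss_moment1 normal_moments)
  then show ?thesis by (simp add: sum_distrib_left)
qed

text \<open>Integrates a quartic majorant of \<open>\<phi>\<close> against the law of w + u, with w
  centred Gaussian. Terms linear in w vanish and quadratic ones are explicit. The constant 24 is 8
  (fourth power of a sum) times 3 (normal fourth moment). Boundedness of \<open>\<phi>\<close>
  serves only its integrability.\<close>

lemma gauss_expectation_le:
  fixes \<phi> :: "real^'n::finite \<Rightarrow> real"
  assumes m: "\<phi> \<in> borel_measurable borel" and bd: "\<And>y. \<bar>\<phi> y\<bar> \<le> M" and "C \<ge> 0"
    and le: "\<And>y. \<phi> y \<le> A + c \<bullet> y + \<alpha> * (norm y)\<^sup>2 + \<kappa> * (x \<bullet> y)\<^sup>2 + C * norm y ^ 4"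
  shows "(\<integral>w. gauss_density \<sigma> w * \<phi> (w + u) \<partial>lborel)
    \<le> A + c \<bullet> u + \<alpha> * (norm u)\<^sup>2 + \<kappa> * (x \<bullet> u)\<^sup>2 + 8 * C * norm u ^ 4
      + \<alpha> * (real CARD('n) * \<sigma>\<^sup>2) + \<kappa> * (\<sigma>\<^sup>2 * (norm x)\<^sup>2) + 24 * C * (real CARD('n))\<^sup>2 * \<sigma> ^ 4"
proof -
  define K where "K = A + c \<bullet> u + \<alpha> * (norm u)\<^sup>2 + \<kappa> * (x \<bullet> u)\<^sup>2 + 8 * C * norm u ^ 4"
  \<comment> \<open>Collects everything linear in w: the given linear term and the cross terms of
    the two squares.\<close>
  define v where "v = c + (2 * \<alpha>) *\<^sub>R u + (2 * \<kappa> * (x \<bullet> u)) *\<^sub>R x"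
  define D where "D = 8 * C * real CARD('n)"
  define Q where "Q w = K * gauss_density \<sigma> w + gauss_density \<sigma> w * (v \<bullet> w) + \<alpha> * (gauss_density \<sigma> w * (norm w)\<^sup>2)
     + \<kappa> * (gauss_density \<sigma> w * (x \<bullet> w)\<^sup>2) + D * (gauss_density \<sigma> w * (\<Sum>i\<in>UNIV. (w $ i) ^ 4))" for w
  have pt: "\<phi> (w + u) \<le> K + v \<bullet> w + \<alpha> * (norm w)\<^sup>2 + \<kappa> * (x \<bullet> w)\<^sup>2 + D * (\<Sum>i\<in>UNIV. (w $ i) ^ 4)" for w
  proof -
    have "C * norm (w + u) ^ 4 \<le> C * (8 * norm w ^ 4 + 8 * norm u ^ 4)"
      using \<open>C \<ge> 0\<close> by (intro mult_left_mono norm_add_power4)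
    also have "\<dots> \<le> C * (8 * (real CARD('n) * (\<Sum>i\<in>UNIV. (w $ i) ^ 4)) + 8 * norm u ^ 4)"
      using \<open>C \<ge> 0\<close> norm_power4_le[of w] by (intro mult_left_mono) auto
    finally have 4: "C * norm (w + u) ^ 4 \<le> D * (\<Sum>i\<in>UNIV. (w $ i) ^ 4) + 8 * C * norm u ^ 4"
      by (simp add: D_def algebra_simps)
    have 2: "(norm (w + u))\<^sup>2 = (norm w)\<^sup>2 + 2 * (u \<bullet> w) + (norm u)\<^sup>2"
      by (simp add: dot_square_norm[symmetric] inner_add_left inner_add_right inner_commute)
    have 3: "(x \<bullet> (w + u))\<^sup>2 = (x \<bullet> w)\<^sup>2 + 2 * (x \<bullet> u) * (x \<bullet> w) + (x \<bullet> u)\<^sup>2"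
      by (simp add: inner_add_right power2_eq_square algebra_simps)
    have v: "v \<bullet> w = c \<bullet> w + 2 * \<alpha> * (u \<bullet> w) + 2 * \<kappa> * (x \<bullet> u) * (x \<bullet> w)"
      by (simp add: v_def inner_add_left)
    show ?thesis
      using le[of "w + u"] 4 unfolding 2 3 v K_def inner_add_right[of c] by (simp add: algebra_simps)
  qed
  have Q: "has_bochner_integral lborel Q (K * 1 + 0 + \<alpha> * (real CARD('n) * \<sigma>\<^sup>2) + \<kappa> * (\<sigma>\<^sup>2 * (norm x)\<^sup>2) + D * (real CARD('n) * (3 * \<sigma> ^ 4)))"
    unfolding Q_def
    by (intro has_bochner_integral_add has_bochner_integral_mult_right gauss_total gauss_inner gauss_norm_square
        gauss_inner_square gauss_fourth)
  have "(\<integral>w. gauss_density \<sigma> w * \<phi> (w + u) \<partial>lborel) \<le> integral\<^sup>L lborel Q"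
  proof (rule integral_mono)
    show "integrable lborel Q" using Q by (simp add: has_bochner_integral_iff)
    have "integrable lborel (\<lambda>w::real^'n. M * gauss_density \<sigma> w)"
      using gauss_total[where 'n = 'n] by (simp add: has_bochner_integral_iff)
    then show "integrable lborel (\<lambda>w. gauss_density \<sigma> w * \<phi> (w + u))"
    proof (rule Bochner_Integration.integrable_bound)
      show "(\<lambda>w. gauss_density \<sigma> w * \<phi> (w + u)) \<in> borel_measurable lborel" using m by measurable
      have "norm (gauss_density \<sigma> w * \<phi> (w + u)) \<le> norm (M * gauss_density \<sigma> w)" for w
        using bd[of "w + u"] gauss_density_nonneg[of \<sigma> w]
        by (simp add: abs_mult mult.commute[of M]) (intro mult_left_mono, auto)
      then show "AE w in lborel. norm (gauss_density \<sigma> w * \<phi> (w + u)) \<le> norm (M * gauss_density \<sigma> w)" by simp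
    qed
    show "gauss_density \<sigma> w * \<phi> (w + u) \<le> Q w" for w
    proof -
      have "gauss_density \<sigma> w * \<phi> (w + u) \<le> gauss_density \<sigma> w * (K + v \<bullet> w + \<alpha> * (norm w)\<^sup>2 + \<kappa> * (x \<bullet> w)\<^sup>2 + D * (\<Sum>i\<in>UNIV. (w $ i) ^ 4))"
        using pt gauss_density_nonneg by (intro mult_left_mono) auto
      then show ?thesis by (simp add: Q_def algebra_simps)
    qed
  qed
  also have "integral\<^sup>L lborel Q = K + \<alpha> * (real CARD('n) * \<sigma>\<^sup>2) + \<kappa> * (\<sigma>\<^sup>2 * (norm x)\<^sup>2) + D * (real CARD('n) * (3 * \<sigma> ^ 4))"
    using Q by (simp add: has_bochner_integral_iff)
  also have "D * (real CARD('n) * (3 * \<sigma> ^ 4)) = 24 * C * (real CARD('n))\<^sup>2 * \<sigma> ^ 4"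
    by (simp add: D_def power2_eq_square)
  finally show ?thesis by (simp add: K_def)
qed

end

section \<open>One step of the Euler scheme\<close>

text \<open>Lagrange remainder with the intermediate second derivative compared to its value at
  \<open>q\<close>. No third derivative is available, so the error stays as a parameter
  \<open>e\<close>.\<close>

lemma taylor_second_order_le:
  fixes g g1 g2 :: "real \<Rightarrow> real"
  assumes g: "\<And>t. t \<in> {a..b} \<Longrightarrow> (g has_real_derivative g1 t) (at t)"
    and g1: "\<And>t. t \<in> {a..b} \<Longrightarrow> (g1 has_real_derivative g2 t) (at t)"
    and q: "q \<in> {a..b}" "q + z \<in> {a..b}"
    and e: "\<And>t. t \<in> {a..b} \<Longrightarrow> \<bar>t - q\<bar> \<le> \<bar>z\<bar> \<Longrightarrow> g2 t \<le> g2 q + e"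
  shows "g (q + z) \<le> g q + g1 q * z + (g2 q + e) / 2 * z\<^sup>2"
proof (cases "z = 0")
  case False
  define diff where "diff m = (if m = 0 then g else if m = Suc 0 then g1 else g2)" for m :: nat
  have "\<exists>t. (if q + z < q then q + z < t \<and> t < q else q < t \<and> t < q + z) \<and>
      g (q + z) = (\<Sum>m<2. diff m q / fact m * (q + z - q) ^ m) + diff 2 t / fact 2 * (q + z - q) ^ 2"
  proof (rule Taylor[where a = a and b = b])
    show "\<forall>m t. m < 2 \<and> a \<le> t \<and> t \<le> b \<longrightarrow> (diff m has_real_derivative diff (Suc m) t) (at t)"
      using g g1 by (auto simp: diff_def less_2_cases_iff)
  qed (use q False in \<open>auto simp: diff_def\<close>)
  then obtain t where t: "if q + z < q then q + z < t \<and> t < q else q < t \<and> t < q + z"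
      "g (q + z) = g q + g1 q * z + g2 t / 2 * z\<^sup>2"
    by (auto simp: diff_def numeral_2_eq_2)
  have "g2 t \<le> g2 q + e" using t(1) q by (intro e) (auto split: if_splits)
  then have "g2 t / 2 * z\<^sup>2 \<le> (g2 q + e) / 2 * z\<^sup>2" by (intro mult_right_mono divide_right_mono) auto
  then show ?thesis using t(2) by simp
qed simp

lemma continuous_on_Icc_pos:
  fixes g :: "real \<Rightarrow> real"
  assumes "\<And>t. t > 0 \<Longrightarrow> (g has_real_derivative g' t) (at t)" "0 < a"
  shows "continuous_on {a..b} g"
proof (intro continuous_at_imp_continuous_on ballI)
  fix t assume "t \<in> {a..b}"
  then have "t > 0" using assms(2) by simp
  then show "isCont g t" by (intro DERIV_isCont[OF assms(1)])
qed

lemma bounded_on_Icc: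
  fixes f :: "real \<Rightarrow> real"
  assumes "continuous_on {a..b} f"
  obtains B where "B \<ge> 0" "\<And>t. t \<in> {a..b} \<Longrightarrow> \<bar>f t\<bar> \<le> B"
proof -
  have "bounded (f ` {a..b})"
    by (intro compact_imp_bounded compact_continuous_image assms compact_Icc)
  then obtain B where "\<And>t. t \<in> {a..b} \<Longrightarrow> \<bar>f t\<bar> \<le> B" unfolding bounded_iff by fastforce
  then show ?thesis using that[of "max 0 B"] by fastforce
qed

text \<open>The Lyapunov function is only used through one-sided bounds, so it can be cut off by a constant
  far from the annulus under consideration, without any smoothing.\<close>

definition cutoff :: "(real \<Rightarrow> real) \<Rightarrow> real \<Rightarrow> real \<Rightarrow> real \<Rightarrow> 'a::real_inner \<Rightarrow> real" where
  "cutoff g m a A x = (if (norm x)\<^sup>2 \<in> {a/2..2*A} then g ((norm x)\<^sup>2) else m)"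

text \<open>For small y this is Taylor's formula for g at |x|^2 with increment z = 2 (x . y) +
  |y|^2. For |y| > \<rho> all terms are dominated by a multiple of |y|^4, so the jump of the cutoff
  is harmless. Continuity of \<open>g2\<close> alone costs the extra \<epsilon> |y|^2.\<close>

lemma cutoff_taylor_le:
  fixes g g1 g2 :: "real \<Rightarrow> real"
  assumes aA: "0 < a" "a \<le> A"
    and g: "\<And>t. t > 0 \<Longrightarrow> (g has_real_derivative g1 t) (at t)"
    and g1: "\<And>t. t > 0 \<Longrightarrow> (g1 has_real_derivative g2 t) (at t)"
    and g2: "continuous_on {0<..} g2" and "\<epsilon> > 0"
  obtains C where "C \<ge> 0"
    "\<And>(x::'a::real_inner) y. (norm x)\<^sup>2 \<in> {a..A} \<Longrightarrow>
       cutoff g m a A (x + y) \<le> g ((norm x)\<^sup>2) + (2 * g1 ((norm x)\<^sup>2)) *\<^sub>R x \<bullet> y + (g1 ((norm x)\<^sup>2) + \<epsilon>) * (norm y)\<^sup>2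
         + 2 * g2 ((norm x)\<^sup>2) * (x \<bullet> y)\<^sup>2 + C * norm y ^ 4"
proof -
  have sub: "{a/2..2*A} \<subseteq> {0<..}" using aA by auto
  have cg: "continuous_on {a/2..2*A} g" "continuous_on {a/2..2*A} g1" "continuous_on {a/2..2*A} g2"
    using aA continuous_on_Icc_pos[of g g1 "a/2" "2*A", OF g] continuous_on_Icc_pos[of g1 g2 "a/2" "2*A", OF g1]
      continuous_on_subset[OF g2 sub] by simp_all
  obtain B0 where B0: "\<And>t. t \<in> {a/2..2*A} \<Longrightarrow> \<bar>g t\<bar> \<le> B0" "B0 \<ge> 0"
    using bounded_on_Icc[OF cg(1)] by blast
  obtain G1 where G1: "\<And>t. t \<in> {a/2..2*A} \<Longrightarrow> \<bar>g1 t\<bar> \<le> G1" "G1 \<ge> 0"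
    using bounded_on_Icc[OF cg(2)] by blast
  obtain G2 where G2: "\<And>t. t \<in> {a/2..2*A} \<Longrightarrow> \<bar>g2 t\<bar> \<le> G2" "G2 \<ge> 0"
    using bounded_on_Icc[OF cg(3)] by blast
  define B where "B = max B0 m"
  \<comment> \<open>The remainder e z^2 / 2 contributes 4 e A |y|^2 at second order; this choice
    makes it \<epsilon> / 2 |y|^2, leaving the other half for the cubic term.\<close>
  define e where "e = \<epsilon> / (8 * A)"
  define N where "N = sqrt A"
  have e: "e > 0" "4 * e * A = \<epsilon> / 2" using aA \<open>\<epsilon> > 0\<close> by (auto simp: e_def)
  have N: "N > 0" "N\<^sup>2 = A" using aA by (auto simp: N_def)
  have B: "B \<ge> 0" "B0 \<le> B" "m \<le> B" using B0 by (auto simp: B_def)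
  have "uniformly_continuous_on {a/2..2*A} g2" using cg(3) by (intro compact_uniformly_continuous) auto
  then obtain \<eta> where \<eta>: "\<eta> > 0" "\<And>s t. s \<in> {a/2..2*A} \<Longrightarrow> t \<in> {a/2..2*A} \<Longrightarrow> dist t s < \<eta> \<Longrightarrow> dist (g2 t) (g2 s) < e"
    unfolding uniformly_continuous_on_def using e(1) by meson
  \<comment> \<open>For |y| at most \<rho> the increment satisfies |z| \<le> min \<eta> a / 2, so
    |x|^2 + z stays in [a/2, 2A] and \<open>g2\<close> moves by less than \<open>e\<close>.\<close>
  define \<rho> where "\<rho> = min 1 (min (\<eta> / 2) (a / 2) / (2 * N + 1))"
  have \<rho>: "\<rho> > 0" "\<rho> \<le> 1" "(2 * N + 1) * \<rho> \<le> \<eta> / 2" "(2 * N + 1) * \<rho> \<le> a / 2"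
  proof -
    show "\<rho> > 0" "\<rho> \<le> 1" using \<eta>(1) aA N by (auto simp: \<rho>_def)
    have "(2 * N + 1) * \<rho> \<le> (2 * N + 1) * (min (\<eta> / 2) (a / 2) / (2 * N + 1))"
      using N by (intro mult_left_mono) (auto simp: \<rho>_def)
    also have "\<dots> = min (\<eta> / 2) (a / 2)" using N by simp
    finally show "(2 * N + 1) * \<rho> \<le> \<eta> / 2" "(2 * N + 1) * \<rho> \<le> a / 2" by auto
  qed
  \<comment> \<open>\<open>C1\<close> gathers the quartic terms of the small case; \<open>C2\<close>
    dominates all the terms of the large case, using n^k \<le> n^4 / \<rho>^(4-k) for n >
    \<rho>.\<close>
  define C1 where "C1 = G2 / 2 + e + 2 * G2\<^sup>2 * A / \<epsilon>"
  define C2 where "C2 = 2 * B / \<rho> ^ 4 + 2 * G1 * N / \<rho> ^ 3 + (G1 + 2 * G2 * A) / \<rho> ^ 2"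
  have C: "C1 \<ge> 0" "C2 \<ge> 0"
    using G1 G2 B N \<rho> aA e \<open>\<epsilon> > 0\<close> by (auto simp: C1_def C2_def intro!: add_nonneg_nonneg divide_nonneg_nonneg mult_nonneg_nonneg)
  show ?thesis
  proof (rule that[of "C1 + C2"])
    show "C1 + C2 \<ge> 0" using C by simp
    fix x y :: 'a assume x: "(norm x)\<^sup>2 \<in> {a..A}"
    define q where "q = (norm x)\<^sup>2"
    define p where "p = x \<bullet> y"
    define n where "n = norm y"
    define z where "z = 2 * p + n\<^sup>2"
    have q: "a \<le> q" "q \<le> A" "q \<in> {a/2..2*A}" using x aA by (auto simp: q_def)
    have n: "n \<ge> 0" by (simp add: n_def)
    have qz: "(norm (x + y))\<^sup>2 = q + z"
      by (simp add: dot_square_norm[symmetric] inner_add_left inner_add_right inner_commute q_def z_def p_def n_def)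
    have "norm x \<le> N" using q N by (simp add: q_def N_def real_le_rsqrt)
    then have p: "\<bar>p\<bar> \<le> N * n"
      using Cauchy_Schwarz_ineq2[of x y] mult_right_mono[of "norm x" N "norm y"] by (simp add: p_def n_def)
    then have pp: "p\<^sup>2 \<le> A * n\<^sup>2" using N power_mono[of "\<bar>p\<bar>" "N * n" 2] by (simp add: power_mult_distrib)
    note bds = G1(1)[OF q(3)] G2(1)[OF q(3)] B0(1)[OF q(3)]
    have n4: "n ^ 4 = n\<^sup>2 * n\<^sup>2" by (simp flip: power_add)
    have "cutoff g m a A (x + y) \<le> g q + 2 * g1 q * p + (g1 q + \<epsilon>) * n\<^sup>2 + 2 * g2 q * p\<^sup>2 + (C1 + C2) * n ^ 4"
    proof (cases "n \<le> \<rho>")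
      case True
      have "\<bar>z\<bar> \<le> 2 * N * n + n * n"
        using p mult_nonneg_nonneg[OF n n] unfolding z_def power2_eq_square mult.assoc by linarith
      also have "n * n \<le> 1 * n" using True \<rho> n by (intro mult_right_mono) auto
      finally have "\<bar>z\<bar> \<le> (2 * N + 1) * n" by (simp add: algebra_simps)
      also have "\<dots> \<le> (2 * N + 1) * \<rho>" using N True by (intro mult_left_mono) auto
      finally have z: "\<bar>z\<bar> \<le> \<eta> / 2" "\<bar>z\<bar> \<le> a / 2" using \<rho> by linarith+
      have qzI: "q + z \<in> {a/2..2*A}" using z(2) q aA by auto
      have "g (q + z) \<le> g q + g1 q * z + (g2 q + e) / 2 * z\<^sup>2"
      proof (rule taylor_second_order_le[OF _ _ q(3) qzI])
        fix t assume t: "t \<in> {a/2..2*A}"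
        have "t > 0" using t sub by auto
        then show "(g has_real_derivative g1 t) (at t)" "(g1 has_real_derivative g2 t) (at t)" using g g1 by auto
        assume "\<bar>t - q\<bar> \<le> \<bar>z\<bar>"
        then have "dist (g2 t) (g2 q) < e" using z \<eta>(1) by (intro \<eta>(2)[OF q(3) t]) (auto simp: dist_real_def)
        then show "g2 t \<le> g2 q + e" by (auto simp: dist_real_def)
      qed
      also have "\<dots> = g q + 2 * g1 q * p + g1 q * n\<^sup>2 + 2 * g2 q * p\<^sup>2 + 2 * g2 q * p * n\<^sup>2 + g2 q / 2 * n ^ 4 + e / 2 * z\<^sup>2"
        unfolding n4 by (simp add: z_def power2_eq_square field_simps)
      also have "e / 2 * z\<^sup>2 \<le> e / 2 * (8 * A * n\<^sup>2 + 2 * n ^ 4)"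
      proof (intro mult_left_mono)
        have "z\<^sup>2 \<le> 2 * (2 * p)\<^sup>2 + 2 * (n\<^sup>2)\<^sup>2"
          using zero_le_power2[of "2 * p - n\<^sup>2"] by (simp add: z_def power2_eq_square algebra_simps)
        also have "\<dots> = 8 * p\<^sup>2 + 2 * n ^ 4" by (simp add: power_mult_distrib)
        finally show "z\<^sup>2 \<le> 8 * A * n\<^sup>2 + 2 * n ^ 4" using pp by simp
      qed (use e in auto)
      also have "e / 2 * (8 * A * n\<^sup>2 + 2 * n ^ 4) = \<epsilon> / 2 * n\<^sup>2 + e * n ^ 4"
        using e(2) by (simp add: algebra_simps)
      \<comment> \<open>The term of third order in y has no useful sign, so Young's inequality
        splits it into a small quadratic and a quartic part.\<close>
      also have "2 * g2 q * p * n\<^sup>2 \<le> (\<epsilon> / 2 + 2 * G2\<^sup>2 * A / \<epsilon> * n\<^sup>2) * n\<^sup>2"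
      proof (intro mult_right_mono)
        have "2 * g2 q * p \<le> \<bar>2 * g2 q * p\<bar>" by simp
        also have "\<dots> = 2 * (\<bar>g2 q\<bar> * \<bar>p\<bar>)" by (simp add: abs_mult)
        also have "\<dots> \<le> 2 * (G2 * (N * n))" using bds p G2 by (intro mult_left_mono mult_mono) auto
        also have "\<dots> \<le> \<epsilon> / 2 + (2 * (G2 * (N * n)))\<^sup>2 / (2 * \<epsilon>)"
        proof -
          define s where "s = 2 * (G2 * (N * n))"
          have "0 \<le> (s - \<epsilon>)\<^sup>2 / (2 * \<epsilon>)" using \<open>\<epsilon> > 0\<close> by simp
          also have "\<dots> = s\<^sup>2 / (2 * \<epsilon>) - s + \<epsilon> / 2" using \<open>\<epsilon> > 0\<close> by (simp add: power2_eq_square field_simps)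
          finally show ?thesis unfolding s_def by simp
        qed
        also have "(2 * (G2 * (N * n)))\<^sup>2 / (2 * \<epsilon>) = 2 * G2\<^sup>2 * A / \<epsilon> * n\<^sup>2"
          by (simp add: power_mult_distrib N(2))
        finally show "2 * g2 q * p \<le> \<epsilon> / 2 + 2 * G2\<^sup>2 * A / \<epsilon> * n\<^sup>2" .
      qed simp
      also have "(\<epsilon> / 2 + 2 * G2\<^sup>2 * A / \<epsilon> * n\<^sup>2) * n\<^sup>2 = \<epsilon> / 2 * n\<^sup>2 + 2 * G2\<^sup>2 * A / \<epsilon> * n ^ 4"
        unfolding n4 by (simp add: algebra_simps)
      also have "g2 q / 2 * n ^ 4 \<le> G2 / 2 * n ^ 4" using bds by (intro mult_right_mono) auto
      finally have "g (q + z) \<le> g q + 2 * g1 q * p + (g1 q + \<epsilon>) * n\<^sup>2 + 2 * g2 q * p\<^sup>2 + C1 * n ^ 4"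
        by (simp add: C1_def algebra_simps)
      moreover have "C1 * n ^ 4 \<le> (C1 + C2) * n ^ 4" using C by (intro mult_right_mono) auto
      ultimately show ?thesis using qzI by (simp add: cutoff_def qz)
    next
      case False
      then have n': "n > \<rho>" by simp
      have "cutoff g m a A (x + y) \<le> B"
        using B0(1)[of "q + z"] B by (auto simp: cutoff_def qz)
      moreover have "- (2 * g1 q * p) \<le> 2 * G1 * N * n"
      proof -
        have "- (2 * g1 q * p) = 2 * (- (g1 q * p))" by simp
        also have "\<dots> \<le> 2 * \<bar>g1 q * p\<bar>" by (intro mult_left_mono abs_ge_minus_self) simp
        also have "\<dots> = 2 * (\<bar>g1 q\<bar> * \<bar>p\<bar>)" by (simp only: abs_mult)
        also have "\<dots> \<le> 2 * (G1 * (N * n))" using bds p G1 by (intro mult_left_mono mult_mono) auto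
        finally show ?thesis by simp
      qed
      moreover have "- ((g1 q + \<epsilon>) * n\<^sup>2) \<le> G1 * n\<^sup>2"
      proof -
        have "(- g1 q - \<epsilon>) * n\<^sup>2 \<le> G1 * n\<^sup>2" using bds \<open>\<epsilon> > 0\<close> by (intro mult_right_mono) auto
        then show ?thesis by (simp add: algebra_simps)
      qed
      moreover have "- (2 * g2 q * p\<^sup>2) \<le> 2 * G2 * A * n\<^sup>2"
      proof -
        have "(- g2 q) * p\<^sup>2 \<le> G2 * (A * n\<^sup>2)" using bds pp G2 by (intro mult_mono) auto
        then have "2 * ((- g2 q) * p\<^sup>2) \<le> 2 * (G2 * (A * n\<^sup>2))" by (intro mult_left_mono) simp_all
        then show ?thesis unfolding mult.assoc mult_minus_left mult_minus_right .
      qed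
      moreover have "2 * B + 2 * G1 * N * n + (G1 * n\<^sup>2 + 2 * G2 * A * n\<^sup>2) \<le> C2 * n ^ 4"
      proof -
        have "n * n ^ 3 = n ^ 4" by (simp flip: power_Suc)
        then have "n ^ 4 / \<rho> ^ 4 = (n / \<rho>) ^ 4" "n ^ 4 / \<rho> ^ 3 = n * (n / \<rho>) ^ 3" "n ^ 4 / \<rho> ^ 2 = n\<^sup>2 * (n / \<rho>) ^ 2"
          unfolding power_divide n4 by simp_all
        moreover have "1 \<le> (n / \<rho>) ^ k" for k using n' \<rho> by (intro one_le_power) auto
        ultimately have h: "1 \<le> n ^ 4 / \<rho> ^ 4" "n \<le> n ^ 4 / \<rho> ^ 3" "n\<^sup>2 \<le> n ^ 4 / \<rho> ^ 2"
          using n mult_left_mono[of 1 "(n / \<rho>) ^ 3" n] mult_left_mono[of 1 "(n / \<rho>) ^ 2" "n\<^sup>2"]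
          by (simp_all only: mult_1_right zero_le_power2)
        have "2 * B * 1 + 2 * G1 * N * n + (G1 + 2 * G2 * A) * n\<^sup>2
            \<le> 2 * B * (n ^ 4 / \<rho> ^ 4) + 2 * G1 * N * (n ^ 4 / \<rho> ^ 3) + (G1 + 2 * G2 * A) * (n ^ 4 / \<rho> ^ 2)"
          by (rule add_mono[OF add_mono[OF mult_left_mono[OF h(1)] mult_left_mono[OF h(2)]] mult_left_mono[OF h(3)]])
            (use B(1) G1(2) G2(2) N(1) aA in simp_all)
        also have "\<dots> = C2 * n ^ 4"
          by (simp only: C2_def distrib_right times_divide_eq_right times_divide_eq_left add_divide_distrib)
        finally show ?thesis by (simp only: mult_1_right distrib_right)
      qed
      moreover have "C2 * n ^ 4 \<le> (C1 + C2) * n ^ 4" using C by (intro mult_right_mono) auto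
      moreover have "- B \<le> g q" using bds B by auto
      ultimately show ?thesis by linarith
    qed
    then show "cutoff g m a A (x + y) \<le> g ((norm x)\<^sup>2) + (2 * g1 ((norm x)\<^sup>2)) *\<^sub>R x \<bullet> y + (g1 ((norm x)\<^sup>2) + \<epsilon>) * (norm y)\<^sup>2
         + 2 * g2 ((norm x)\<^sup>2) * (x \<bullet> y)\<^sup>2 + (C1 + C2) * norm y ^ 4"
      by (simp add: q_def p_def n_def)
  qed
qed

lemma cutoff_measurable:
  assumes "\<And>t. t > 0 \<Longrightarrow> (g has_real_derivative g1 t) (at t)" "0 < a"
  shows "cutoff g m a A \<in> borel_measurable (borel :: 'a::euclidean_space measure)"
proof -
  have "continuous_on {a/2..2*A} g" by (rule continuous_on_Icc_pos[OF assms(1)]) (use assms(2) in simp_all)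
  then have [measurable]: "(\<lambda>t. if t \<in> {a/2..2*A} then g t else m) \<in> borel_measurable borel"
    by (intro borel_measurable_continuous_on_if) auto
  have "(\<lambda>x::'a. (\<lambda>t. if t \<in> {a/2..2*A} then g t else m) ((norm x)\<^sup>2)) \<in> borel_measurable borel" by measurable
  then show ?thesis by (simp add: cutoff_def[abs_def])
qed

lemma cutoff_bounded:
  assumes "\<And>t. t > 0 \<Longrightarrow> (g has_real_derivative g1 t) (at t)" "0 < a"
  obtains M where "\<And>x::'a::real_inner. \<bar>cutoff g m a A x\<bar> \<le> M"
proof -
  have "continuous_on {a/2..2*A} g" by (rule continuous_on_Icc_pos[OF assms(1)]) (use assms(2) in simp_all)
  then obtain B where "\<And>t. t \<in> {a/2..2*A} \<Longrightarrow> \<bar>g t\<bar> \<le> B" using bounded_on_Icc by blast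
  then show ?thesis by (intro that[of "max B \<bar>m\<bar>"]) (fastforce simp: cutoff_def max_def)
qed

text \<open>The left side of \<open>gen\<close> is L = b . grad + Laplacian / 2 applied to g(|x|^2).
  The Gaussian average of the Taylor majorant therefore grows by at most \<delta> L g, plus \<delta>
  / 2 from the \<epsilon>-term, plus a remainder of order \<delta>^2; the total is at most 2
  \<delta> for small \<delta>.\<close>

lemma cutoff_one_step:
  fixes b :: "real^'n::finite \<Rightarrow> real^'n" and g g1 g2 :: "real \<Rightarrow> real"
  assumes aA: "0 < a" "a \<le> A"
    and g: "\<And>t. t > 0 \<Longrightarrow> (g has_real_derivative g1 t) (at t)"
    and g1: "\<And>t. t > 0 \<Longrightarrow> (g1 has_real_derivative g2 t) (at t)"
    and g2: "continuous_on {0<..} g2"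
    and b: "\<And>x. norm (b x) \<le> M"
    and gen: "\<And>x. (norm x)\<^sup>2 \<in> {a..A} \<Longrightarrow>
      2 * g1 ((norm x)\<^sup>2) * (x \<bullet> b x) + real CARD('n) * g1 ((norm x)\<^sup>2) + 2 * (norm x)\<^sup>2 * g2 ((norm x)\<^sup>2) \<le> 1"
  shows "\<exists>\<delta>0>0. \<forall>\<delta> x. 0 < \<delta> \<longrightarrow> \<delta> < \<delta>0 \<longrightarrow> (norm x)\<^sup>2 \<in> {a..A} \<longrightarrow>
       (\<integral>w. gauss_density (sqrt \<delta>) w * cutoff g m a A (x + (w + \<delta> *\<^sub>R b x)) \<partial>lborel) \<le> g ((norm x)\<^sup>2) + 2 * \<delta>"
proof -
  define d where "d = real CARD('n)"
  have d: "d \<ge> 1" by (simp add: d_def Suc_leI)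
  \<comment> \<open>Multiplied by E |w|^2 = d \<delta> this costs exactly \<delta> / 2.\<close>
  define \<epsilon> where "\<epsilon> = 1 / (2 * d)"
  have \<epsilon>: "\<epsilon> > 0" "\<epsilon> * d = 1 / 2" using d by (auto simp: \<epsilon>_def)
  obtain C where C: "C \<ge> 0" "\<And>(x::real^'n) y. (norm x)\<^sup>2 \<in> {a..A} \<Longrightarrow>
       cutoff g m a A (x + y) \<le> g ((norm x)\<^sup>2) + (2 * g1 ((norm x)\<^sup>2)) *\<^sub>R x \<bullet> y + (g1 ((norm x)\<^sup>2) + \<epsilon>) * (norm y)\<^sup>2
         + 2 * g2 ((norm x)\<^sup>2) * (x \<bullet> y)\<^sup>2 + C * norm y ^ 4"
    using cutoff_taylor_le[OF aA g g1 g2 \<epsilon>(1)] by blast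
  have M: "M \<ge> 0" using b[of 0] norm_ge_zero order_trans by blast
  have cg: "continuous_on {a..A} g1" "continuous_on {a..A} g2"
    using aA continuous_on_Icc_pos[of g1 g2 a A, OF g1] continuous_on_subset[OF g2, of "{a..A}"]
    by (simp_all add: subset_iff)
  obtain G1 where G1: "\<And>t. t \<in> {a..A} \<Longrightarrow> \<bar>g1 t\<bar> \<le> G1" "G1 \<ge> 0"
    using bounded_on_Icc[OF cg(1)] by blast
  obtain G2 where G2: "\<And>t. t \<in> {a..A} \<Longrightarrow> \<bar>g2 t\<bar> \<le> G2" "G2 \<ge> 0"
    using bounded_on_Icc[OF cg(2)] by blast
  define E where "E = (G1 + \<epsilon>) * M\<^sup>2 + 2 * G2 * A * M\<^sup>2 + 8 * C * M ^ 4 + 24 * C * d\<^sup>2"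
  have E: "E \<ge> 0" using G1 G2 \<epsilon> C M aA by (auto simp: E_def intro!: add_nonneg_nonneg mult_nonneg_nonneg)
  obtain Mc where Mc: "\<And>x::real^'n. \<bar>cutoff g m a A x\<bar> \<le> Mc" using cutoff_bounded[OF g aA(1)] by blast
  \<comment> \<open>The bound 1 gives \<delta>^4 \<le> \<delta>^2; the other one gives \<delta>^2 E
    \<le> \<delta> / 2.\<close>
  define \<delta>0 where "\<delta>0 = min 1 (1 / (2 * (E + 1)))"
  show ?thesis
  proof (intro exI[of _ \<delta>0] conjI allI impI)
    show "\<delta>0 > 0" using E by (simp add: \<delta>0_def)
    fix \<delta> :: real and x :: "real^'n" assume \<delta>: "0 < \<delta>" "\<delta> < \<delta>0" and x: "(norm x)\<^sup>2 \<in> {a..A}"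
    define q where "q = (norm x)\<^sup>2"
    define u where "u = \<delta> *\<^sub>R b x"
    have q: "q \<in> {a..A}" using x by (simp add: q_def)
    have s: "sqrt \<delta> > 0" "(sqrt \<delta>)\<^sup>2 = \<delta>" "sqrt \<delta> ^ 4 = \<delta>\<^sup>2"
      using \<delta> by (auto simp: power4_eq_xxxx power2_eq_square)
    have u: "norm u \<le> \<delta> * M" using \<delta> b[of x] by (simp add: u_def)
    have u2: "(norm u)\<^sup>2 \<le> \<delta>\<^sup>2 * M\<^sup>2" using power_mono[OF u, of 2] by (simp add: power_mult_distrib)
    have u4: "norm u ^ 4 \<le> \<delta>\<^sup>2 * M ^ 4"
    proof -
      have "norm u ^ 4 \<le> \<delta> ^ 4 * M ^ 4" using power_mono[OF u, of 4] by (simp add: power_mult_distrib)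
      also have "\<delta> ^ 4 \<le> \<delta>\<^sup>2" using \<delta> by (intro power_decreasing) (auto simp: \<delta>0_def)
      finally show ?thesis by (simp add: mult_right_mono)
    qed
    have xu: "(x \<bullet> u)\<^sup>2 \<le> A * (\<delta>\<^sup>2 * M\<^sup>2)"
    proof -
      have "(x \<bullet> u)\<^sup>2 \<le> q * (norm u)\<^sup>2"
        using Cauchy_Schwarz_ineq[of x u] by (simp add: q_def dot_square_norm)
      also have "\<dots> \<le> A * (\<delta>\<^sup>2 * M\<^sup>2)" using q u2 aA by (intro mult_mono) auto
      finally show ?thesis .
    qed
    have m: "(\<lambda>y. cutoff g m a A (x + y)) \<in> borel_measurable borel"
      by (intro measurable_compose[OF _ cutoff_measurable[OF g aA(1)]]) auto
    have "(\<integral>w. gauss_density (sqrt \<delta>) w * cutoff g m a A (x + (w + u)) \<partial>lborel)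
      \<le> g q + (2 * g1 q) *\<^sub>R x \<bullet> u + (g1 q + \<epsilon>) * (norm u)\<^sup>2 + 2 * g2 q * (x \<bullet> u)\<^sup>2 + 8 * C * norm u ^ 4
      + (g1 q + \<epsilon>) * (d * \<delta>) + 2 * g2 q * (\<delta> * q) + 24 * C * d\<^sup>2 * \<delta>\<^sup>2"
      using gauss_expectation_le[OF s(1) m Mc C(1) C(2)[OF x], of u]
      unfolding s(2,3) q_def d_def by simp
    also have "\<dots> = g q + \<delta> * (2 * g1 q * (x \<bullet> b x) + d * g1 q + 2 * q * g2 q) + \<delta> * (\<epsilon> * d)
        + ((g1 q + \<epsilon>) * (norm u)\<^sup>2 + 2 * (g2 q * (x \<bullet> u)\<^sup>2) + 8 * C * norm u ^ 4 + 24 * C * d\<^sup>2 * \<delta>\<^sup>2)"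
      by (simp add: u_def algebra_simps)
    also have "\<dots> \<le> g q + \<delta> * 1 + \<delta> * (1 / 2) + \<delta>\<^sup>2 * E"
    proof (intro add_mono order_refl)
      show "\<delta> * (2 * g1 q * (x \<bullet> b x) + d * g1 q + 2 * q * g2 q) \<le> \<delta> * 1"
        using gen[OF x] \<delta> by (intro mult_left_mono) (auto simp: q_def d_def)
      show "\<delta> * (\<epsilon> * d) \<le> \<delta> * (1 / 2)" unfolding \<epsilon>(2) by simp
      have "(g1 q + \<epsilon>) * (norm u)\<^sup>2 \<le> (G1 + \<epsilon>) * (\<delta>\<^sup>2 * M\<^sup>2)"
        using G1(1)[OF q] G1(2) u2 \<epsilon>(1) by (intro mult_mono) auto
      moreover have "g2 q * (x \<bullet> u)\<^sup>2 \<le> G2 * (A * (\<delta>\<^sup>2 * M\<^sup>2))"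
        using G2(1)[OF q] G2(2) xu by (intro mult_mono) auto
      moreover have "8 * C * norm u ^ 4 \<le> 8 * C * (\<delta>\<^sup>2 * M ^ 4)" using C u4 by (intro mult_left_mono) auto
      ultimately show "(g1 q + \<epsilon>) * (norm u)\<^sup>2 + 2 * (g2 q * (x \<bullet> u)\<^sup>2) + 8 * C * norm u ^ 4 + 24 * C * d\<^sup>2 * \<delta>\<^sup>2 \<le> \<delta>\<^sup>2 * E"
        by (simp add: E_def algebra_simps)
    qed
    also have "\<delta>\<^sup>2 * E \<le> \<delta> * (1 / 2)"
    proof -
      have "\<delta> \<le> 1 / (2 * (E + 1))" using \<delta> by (simp add: \<delta>0_def)
      then have "\<delta> * E \<le> 1 / (2 * (E + 1)) * E" using E by (intro mult_right_mono) auto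
      also have "\<dots> \<le> 1 / 2" using E by (simp add: field_simps)
      finally have "\<delta> * (\<delta> * E) \<le> \<delta> * (1 / 2)" using \<delta> by (intro mult_left_mono) auto
      then show ?thesis by (simp add: power2_eq_square)
    qed
    finally show "(\<integral>w. gauss_density (sqrt \<delta>) w * cutoff g m a A (x + (w + \<delta> *\<^sub>R b x)) \<partial>lborel) \<le> g ((norm x)\<^sup>2) + 2 * \<delta>"
      by (simp add: u_def q_def)
  qed
qed

section \<open>The Lyapunov function\<close>

lemma antiderivative_pos:
  fixes f :: "real \<Rightarrow> real"
  assumes "continuous_on {0<..} f"
  obtains F where "\<And>x. x > 0 \<Longrightarrow> (F has_real_derivative f x) (at x)" "F 1 = 0"
proof -
  have "\<exists>F. \<forall>x::real. (0::ereal) < x \<longrightarrow> x < (\<infinity>::ereal) \<longrightarrow> (F has_vector_derivative f x) (at x)"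
    using assms by (intro einterval_antiderivative) (auto simp: continuous_on_eq_continuous_at)
  then obtain F where F: "\<And>x. x > 0 \<Longrightarrow> (F has_real_derivative f x) (at x)"
    by (auto simp: has_real_derivative_iff_has_vector_derivative)
  show ?thesis
    by (rule that[of "\<lambda>x. F x - F 1"]) (auto intro!: derivative_eq_intros F)
qed

text \<open>With \<open>G q = (\<Gamma> (sqrt q)) powr \<beta>\<close> the function \<open>g\<close> below solves the radial Poisson equation
  \<open>L (g (|v|\<^sup>2)) = 1\<close> for the generator \<open>L\<close> of the velocity process: multiplying the equation by the
  integrating factor \<open>q powr (d / 2) / G q\<close> leaves two quadratures. It explodes at \<open>0\<close>
  because \<open>d \<ge> 2\<close> and grows linearly in \<open>q\<close> at infinity.\<close>

lemma lyapunov_function: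
  fixes G \<kappa> :: "real \<Rightarrow> real" and \<beta> d :: real
  assumes d: "d \<ge> 2"
    and Gpos: "\<And>q. q > 0 \<Longrightarrow> G q > 0"
    and G: "\<And>q. q > 0 \<Longrightarrow> (G has_real_derivative \<beta> * \<kappa> q / (2 * q) * G q) (at q)"
    and \<kappa>: "continuous_on {0<..} \<kappa>"
    and G0: "c0 > 0" "\<And>q. 0 < q \<Longrightarrow> q \<le> 1 \<Longrightarrow> c0 \<le> G q"
    and Ginf: "\<And>q. q \<ge> Q0 \<Longrightarrow> (sqrt q / 2) powr \<beta> \<le> G q" "\<And>q. q \<ge> Q0 \<Longrightarrow> G q \<le> (2 * sqrt q) powr \<beta>"
    and "\<beta> > 0"
  shows "\<exists>g g1 g2. (\<forall>q>0. (g has_real_derivative g1 q) (at q)) \<and> (\<forall>q>0. (g1 has_real_derivative g2 q) (at q)) \<and>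
    continuous_on {0<..} g2 \<and> (\<forall>q>0. g q \<ge> 0) \<and>
    (\<forall>q>0. (d - \<beta> * \<kappa> q) * g1 q + 2 * q * g2 q = 1) \<and>
    (\<forall>m. \<exists>n0::nat. \<forall>n\<ge>n0. \<forall>q>0. q < 1 / (real n + 1) \<or> q > real n + 1 \<longrightarrow> g q \<ge> m)"
proof -
  have cG: "continuous_on {0<..} G"
    by (intro continuous_at_imp_continuous_on ballI) (auto intro: DERIV_isCont G)
  \<comment> \<open>Since G' / G = \<beta> \<kappa> / (2 q), the integrating factor turns the
    equation into (q^(d/2) g' / G)' = f. The antiderivative \<open>p\<close> is normalised to vanish
    at 1, which puts the minimum of \<open>g\<close> there.\<close>
  define f where "f s = s powr (d / 2 - 1) / G s / 2" for s
  have fpos: "f s > 0" if "s > 0" for s using that Gpos[OF that] by (simp add: f_def)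
  have "continuous_on {0<..} f" unfolding f_def
    by (intro continuous_intros cG) (use Gpos in \<open>auto simp: less_imp_neq[symmetric]\<close>)
  then obtain p where p: "\<And>q. q > 0 \<Longrightarrow> (p has_real_derivative f q) (at q)" "p 1 = 0"
    using antiderivative_pos by blast
  have pmono: "p x \<le> p y" if "0 < x" "x \<le> y" for x y
    by (rule DERIV_nonneg_imp_nondecreasing[OF that(2)]) (use p(1) fpos that(1) in \<open>meson less_eq_real_def less_le_trans\<close>)
  define g1 where "g1 q = q powr (- (d / 2)) * G q * p q" for q
  \<comment> \<open>Defined by solving the equation for the second derivative, so that the equation
    is immediate and the content moves to the claim g1' = g2.\<close>
  define g2 where "g2 q = (1 - (d - \<beta> * \<kappa> q) * g1 q) / (2 * q)" for q
  have g1: "(g1 has_real_derivative g2 q) (at q)" if q: "q > 0" for q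
  proof -
    have pw: "((\<lambda>q. q powr (- (d / 2))) has_real_derivative (- (d / 2)) * q powr (- (d / 2) - 1)) (at q)"
      by (rule has_real_derivative_powr[OF q])
    have "(g1 has_real_derivative
        ((- (d / 2)) * q powr (- (d / 2) - 1) * G q + \<beta> * \<kappa> q / (2 * q) * G q * q powr (- (d / 2))) * p q
         + f q * (q powr (- (d / 2)) * G q)) (at q)"
      unfolding g1_def[abs_def] by (rule DERIV_mult[OF DERIV_mult[OF pw G[OF q]] p(1)[OF q]])
    also have "q powr (- (d / 2) - 1) = q powr (- (d / 2)) / q" using q by (simp add: powr_diff)
    also have "f q * (q powr (- (d / 2)) * G q) = 1 / (2 * q)"
    proof -
      have "q powr (d / 2 - 1) * q powr (- (d / 2)) = q powr (- 1)" by (simp flip: powr_add)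
      then show ?thesis using q Gpos[OF q] by (simp add: f_def powr_minus field_simps)
    qed
    also have "(- (d / 2) * (q powr (- (d / 2)) / q) * G q + \<beta> * \<kappa> q / (2 * q) * G q * q powr (- (d / 2))) * p q + 1 / (2 * q) = g2 q"
      using q by (simp add: g2_def g1_def field_simps)
    finally show ?thesis .
  qed
  have cg1: "continuous_on {0<..} g1"
    by (intro continuous_at_imp_continuous_on ballI) (auto intro: DERIV_isCont g1)
  obtain g where g: "\<And>q. q > 0 \<Longrightarrow> (g has_real_derivative g1 q) (at q)" "g 1 = 0"
    using antiderivative_pos[OF cg1] by blast
  have cg2: "continuous_on {0<..} g2" unfolding g2_def by (intro continuous_intros cg1 \<kappa>) auto
  have eq: "(d - \<beta> * \<kappa> q) * g1 q + 2 * q * g2 q = 1" if "q > 0" for q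
    using that by (simp add: g2_def)
  have pos: "g q \<ge> 0" if q: "q > 0" for q
  proof (cases "q \<ge> 1")
    case True
    have "g 1 \<le> g q"
    proof (rule DERIV_nonneg_imp_nondecreasing[of 1 q g, OF True])
      fix x assume "1 \<le> x" "x \<le> q"
      then show "\<exists>y. (g has_real_derivative y) (at x) \<and> 0 \<le> y"
        using g(1)[of x] pmono[of 1 x] p(2) Gpos[of x] by (intro exI[of _ "g1 x"]) (auto simp: g1_def)
    qed
    with g(2) show ?thesis by simp
  next
    case False
    have "g q \<ge> g 1"
    proof (rule DERIV_nonpos_imp_nonincreasing[of q 1 g])
      fix x assume "q \<le> x" "x \<le> 1"
      then show "\<exists>y. (g has_real_derivative y) (at x) \<and> y \<le> 0"
        using g(1)[of x] pmono[of x 1] p(2) Gpos[of x] q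
        by (intro exI[of _ "g1 x"]) (auto simp: g1_def mult_nonneg_nonpos)
    qed (use False in simp)
    with g(2) show ?thesis by simp
  qed
  \<comment> \<open>On (0, 1/2] \<open>p\<close> is bounded above by a negative constant, and d
    \<ge> 2 gives q^(-d/2) \<ge> 1/q. Hence g1 \<le> - c / q, and \<open>g\<close> grows at least
    like - c ln q as q tends to 0.\<close>
  have zero: "\<exists>\<eta>>0. \<forall>q. 0 < q \<longrightarrow> q < \<eta> \<longrightarrow> g q \<ge> m" for m
  proof -
    define c where "c = c0 * (p 1 - p (1/2))"
    have "p (1/2) < p 1"
    proof (rule DERIV_pos_imp_increasing[of "1/2" 1 p])
      fix x :: real assume "1/2 \<le> x" "x \<le> 1"
      then show "\<exists>y. (p has_real_derivative y) (at x) \<and> 0 < y" using p(1)[of x] fpos[of x] by auto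
    qed simp
    then have c: "c > 0" using G0(1) by (simp add: c_def)
    have le: "g (1/2) + c * ln (1/2) \<le> g q + c * ln q" if q: "0 < q" "q \<le> 1/2" for q
    proof (rule DERIV_nonpos_imp_nonincreasing[of q "1/2" "\<lambda>q. g q + c * ln q"])
      fix x assume x: "q \<le> x" "x \<le> 1/2"
      have x0: "x > 0" using x q by simp
      have "x powr (- 1) \<le> x powr (- (d / 2))" using x x0 d by (intro powr_mono') auto
      then have "1 / x * c0 \<le> x powr (- (d / 2)) * G x"
        using G0 x x0 by (intro mult_mono) (auto simp: powr_minus field_simps)
      moreover have "p 1 - p (1/2) \<le> - p x" using pmono[OF x0 x(2)] p(2) by simp
      moreover have "0 \<le> x powr (- (d / 2)) * G x" using Gpos[OF x0] by simp
      ultimately have "1 / x * c0 * (p 1 - p (1/2)) \<le> x powr (- (d / 2)) * G x * (- p x)"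
        by (rule mult_mono) (use \<open>p (1/2) < p 1\<close> in auto)
      then have "g1 x + c / x \<le> 0" by (simp add: g1_def c_def)
      moreover have "((\<lambda>q. g q + c * ln q) has_real_derivative (g1 x + c * (1 / x))) (at x)"
        by (intro DERIV_add DERIV_cmult DERIV_ln_divide g(1) x0)
      ultimately show "\<exists>y. ((\<lambda>q. g q + c * ln q) has_real_derivative y) (at x) \<and> y \<le> 0"
        by (intro exI[of _ "g1 x + c * (1 / x)"]) simp
    qed (use q in simp)
    define \<eta> where "\<eta> = min (1/2) (exp ((g (1/2) + c * ln (1/2) - m) / c))"
    show ?thesis
    proof (intro exI[of _ \<eta>] conjI allI impI)
      fix q assume q: "0 < q" "q < \<eta>"
      have "ln q < ln (exp ((g (1/2) + c * ln (1/2) - m) / c))"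
        using q by (subst ln_less_cancel_iff) (auto simp: \<eta>_def)
      then have "c * ln q \<le> g (1/2) + c * ln (1/2) - m" using c by (simp add: field_simps)
      then show "m \<le> g q" using le[of q] q by (simp add: \<eta>_def)
    qed (simp add: \<eta>_def)
  qed
  have infinity: "\<exists>R. \<forall>q>R. g q \<ge> m" for m
  proof -
    \<comment> \<open>A lower bound for \<open>g1\<close> at infinity. Bounding f from below on
      [q/2, q] makes all powers of q cancel; the base 1/4 is the ratio of the two bounds sqrt q / 2
      and 2 sqrt q.\<close>
    define c where "c = (1/2) powr (d / 2) * (1/4) powr \<beta> / 2"
    have c: "c > 0" by (simp add: c_def)
    \<comment> \<open>Ensures q/2 \<ge> 1, so that p(q/2) \<ge> 0, and q/2 \<ge> \<open>Q0\<close>,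
      so that the growth bounds hold on all of [q/2, q].\<close>
    define R where "R = max 2 (2 * Q0)"
    have g1c: "g1 q \<ge> c" if "q \<ge> R" for q
    proof -
      have q: "q \<ge> 2" "q / 2 \<ge> Q0" "q \<ge> Q0" "q > 0" using that by (auto simp: R_def)
      define L where "L = (q / 2) powr (d / 2 - 1) / (2 * sqrt q) powr \<beta> / 2"
      have fL: "f s \<ge> L" if s: "q / 2 \<le> s" "s \<le> q" for s
      proof -
        have "G s \<le> (2 * sqrt s) powr \<beta>" using s q by (intro Ginf) auto
        also have "\<dots> \<le> (2 * sqrt q) powr \<beta>" using s q \<open>\<beta> > 0\<close> by (intro powr_mono2) auto
        finally have "G s \<le> (2 * sqrt q) powr \<beta>" .
        moreover have "(q / 2) powr (d / 2 - 1) \<le> s powr (d / 2 - 1)" using s q d by (intro powr_mono2) auto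
        ultimately show ?thesis unfolding L_def f_def
          using Gpos[of s] s q by (intro divide_right_mono frac_le) auto
      qed
      have "p (q / 2) + L * (q / 2) \<le> p q"
      proof -
        have "p (q / 2) - L * (q / 2) \<le> p q - L * q"
        proof (rule DERIV_nonneg_imp_nondecreasing[of "q / 2" q "\<lambda>s. p s - L * s"])
          fix s assume s: "q / 2 \<le> s" "s \<le> q"
          have "((\<lambda>s. p s - L * s) has_real_derivative (f s - L)) (at s)"
            using s q by (auto intro!: derivative_eq_intros p(1))
          then show "\<exists>y. ((\<lambda>s. p s - L * s) has_real_derivative y) (at s) \<and> 0 \<le> y"
            using fL[OF s] by (intro exI[of _ "f s - L"]) simp
        qed (use q in simp)
        then show ?thesis by (simp add: field_simps)
      qed
      moreover have "p (q / 2) \<ge> 0" using pmono[of 1 "q / 2"] p(2) q by simp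
      ultimately have pq: "p q \<ge> L * (q / 2)" by simp
      have L0: "L \<ge> 0" by (simp add: L_def)
      have "c = q powr (- (d / 2)) * (sqrt q / 2) powr \<beta> * (L * (q / 2))"
      proof -
        have 1: "(q / 2) powr (d / 2 - 1) * (q / 2) = (q / 2) powr (d / 2)"
          using q by (simp add: powr_diff)
        have 2: "(q / 2) powr (d / 2) * q powr (- (d / 2)) = (1/2) powr (d / 2)"
          using q by (simp add: powr_divide powr_minus field_simps)
        have 3: "(sqrt q / 2) powr \<beta> / (2 * sqrt q) powr \<beta> = (1/4) powr \<beta>"
        proof -
          have "(sqrt q / 2) / (2 * sqrt q) = 1/4" using q by (simp add: field_simps)
          then show ?thesis using q by (simp flip: powr_divide)
        qed
        have "q powr (- (d / 2)) * (sqrt q / 2) powr \<beta> * (L * (q / 2))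
            = ((q / 2) powr (d / 2 - 1) * (q / 2)) * q powr (- (d / 2)) * ((sqrt q / 2) powr \<beta> / (2 * sqrt q) powr \<beta>) / 2"
          by (simp add: L_def)
        then show ?thesis unfolding 1 2 3 c_def by simp
      qed
      also have "\<dots> \<le> q powr (- (d / 2)) * G q * p q"
        using Ginf(1)[OF q(3)] pq L0 q Gpos[OF q(4)] by (intro mult_mono) auto
      finally show ?thesis by (simp add: g1_def)
    qed
    show ?thesis
    proof (intro exI[of _ "max R (R + m / c)"] allI impI)
      fix q assume q: "q > max R (R + m / c)"
      have "g R - c * R \<le> g q - c * q"
      proof (rule DERIV_nonneg_imp_nondecreasing[of R q "\<lambda>s. g s - c * s"])
        fix s assume s: "R \<le> s" "s \<le> q"
        have "s > 0" using s by (simp add: R_def)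
        then have "((\<lambda>s. g s - c * s) has_real_derivative (g1 s - c)) (at s)"
          by (auto intro!: derivative_eq_intros g(1))
        then show "\<exists>y. ((\<lambda>s. g s - c * s) has_real_derivative y) (at s) \<and> 0 \<le> y"
          using g1c[OF s(1)] by (intro exI[of _ "g1 s - c"]) simp
      qed (use q in simp)
      moreover have "g R \<ge> 0" by (rule pos) (simp add: R_def)
      moreover have "m \<le> c * (q - R)"
      proof -
        have "m / c < q - R" using q by simp
        then show ?thesis using c by (simp add: field_simps)
      qed
      ultimately show "m \<le> g q" by (simp add: algebra_simps)
    qed
  qed
  have inf: "\<exists>n0::nat. \<forall>n\<ge>n0. \<forall>q>0. q < 1 / (real n + 1) \<or> q > real n + 1 \<longrightarrow> g q \<ge> m" for m
  proof -
    obtain \<eta> where \<eta>: "\<eta> > 0" "\<And>q. 0 < q \<Longrightarrow> q < \<eta> \<Longrightarrow> g q \<ge> m" using zero by blast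
    obtain R where R: "\<And>q. q > R \<Longrightarrow> g q \<ge> m" using infinity by blast
    obtain n0 :: nat where n0: "real n0 > max R (1 / \<eta>)" using reals_Archimedean2 by blast
    show ?thesis
    proof (intro exI[of _ n0] allI impI)
      fix n q assume *: "n0 \<le> n" "0 < q" "q < 1 / (real n + 1) \<or> q > real n + 1"
      have "1 / \<eta> \<le> real n + 1" "R \<le> real n + 1" using n0 *(1) by auto
      moreover from this(1) have "1 / (real n + 1) \<le> \<eta>" using \<eta>(1) by (simp add: field_simps)
      ultimately show "m \<le> g q" using *(2,3) \<eta>(2) R by fastforce
    qed
  qed
  show ?thesis
    by (rule exI[of _ g], rule exI[of _ g1], rule exI[of _ g2], intro conjI allI impI)
      (rule g(1) g1 cg2 pos eq inf; assumption?)+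
qed

section \<open>Exit probabilities\<close>

lemma brownian_motion_wrtD:
  assumes "brownian_motion_wrt M G B"
  shows "prob_space M"
    and "t \<ge> 0 \<Longrightarrow> subalgebra M (G t)"
    and "0 \<le> s \<Longrightarrow> s \<le> t \<Longrightarrow> subalgebra (G t) (G s)"
    and "t \<ge> 0 \<Longrightarrow> B t \<in> borel_measurable (G t)"
    and "0 \<le> s \<Longrightarrow> s < t \<Longrightarrow> prob_space.indep_set M (sets (G s))
          {(\<lambda>\<omega>. B t \<omega> - B s \<omega>) -` A \<inter> space M | A. A \<in> sets borel}"
    and "0 \<le> s \<Longrightarrow> s < t \<Longrightarrow> distributed M lborel (\<lambda>\<omega>. B t \<omega> - B s \<omega>) (\<lambda>x. ennreal (gauss_density (sqrt (t - s)) x))"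
    and "AE \<omega> in M. B 0 \<omega> = 0" "AE \<omega> in M. continuous_on {0..} (\<lambda>t. B t \<omega>)"
  using assms unfolding brownian_motion_wrt_def gauss_density_def by auto

lemma brownian_adapted:
  assumes "brownian_motion_wrt M G B" "0 \<le> s" "s \<le> t"
  shows "B s \<in> borel_measurable (G t)"
  using measurable_from_subalg[OF brownian_motion_wrtD(3)[OF assms] brownian_motion_wrtD(4)[OF assms(1,2)]] .

lemma euler_adapted:
  assumes B: "brownian_motion_wrt M G B" and b[measurable]: "b \<in> borel_measurable borel"
    and h: "h \<ge> 0" "real k * h \<le> t"
  shows "(\<lambda>\<omega>. euler b (\<lambda>s. B s \<omega>) v0 h k) \<in> borel_measurable (G t)"
  using h(2)
proof (induction k)
  case (Suc k)
  have le: "real k * h \<le> t" "0 \<le> real k * h" "0 \<le> real (Suc k) * h" using Suc.prems h(1) by (auto simp: algebra_simps)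
  have [measurable]: "(\<lambda>\<omega>. euler b (\<lambda>s. B s \<omega>) v0 h k) \<in> borel_measurable (G t)" using Suc.IH le by simp
  have [measurable]: "B (real k * h) \<in> borel_measurable (G t)" "B (real (Suc k) * h) \<in> borel_measurable (G t)"
    by (rule brownian_adapted[OF B le(2,1)], rule brownian_adapted[OF B le(3) Suc.prems])
  show ?case unfolding euler.simps by measurable
qed simp

text \<open>The increment after time \<open>s\<close> is independent of \<open>(X, 1\<^sub>A)\<close>, so the expectation factors through the
  Gaussian average in the hypothesis.\<close>

lemma brownian_one_step:
  fixes B :: "real \<Rightarrow> 'w \<Rightarrow> real^'n::finite" and \<phi> :: "real^'n \<Rightarrow> real"
  assumes B: "brownian_motion_wrt M G B" and s: "0 \<le> s" "s < t"
    and X: "X \<in> borel_measurable (G s)" and A: "A \<in> sets (G s)" "\<And>\<omega>. \<omega> \<in> A \<Longrightarrow> X \<omega> \<in> K"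
    and b[measurable]: "b \<in> borel_measurable borel"
    and \<phi>[measurable]: "\<phi> \<in> borel_measurable borel" and bd: "\<And>x. \<bar>\<phi> x\<bar> \<le> C"
    and step: "\<And>x. x \<in> K \<Longrightarrow>
      (\<integral>w. gauss_density (sqrt (t - s)) w * \<phi> (x + (w + b x)) \<partial>lborel) \<le> \<phi> x + c"
    and "c \<ge> 0"
  shows "(\<integral>\<omega>. indicator A \<omega> * \<phi> (X \<omega> + b (X \<omega>) + (B t \<omega> - B s \<omega>)) \<partial>M) \<le> (\<integral>\<omega>. indicator A \<omega> * \<phi> (X \<omega>) \<partial>M) + c"
proof -
  interpret prob_space M by (rule brownian_motion_wrtD(1)[OF B])
  define W where "W = (\<lambda>\<omega>. B t \<omega> - B s \<omega>)"
  \<comment> \<open>The increment is padded with a constant because \<open>indep_var\<close>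
    requires both variables to have the same type, and \<open>Y\<close> is a pair.\<close>
  define W0 where "W0 = (\<lambda>\<omega>. (W \<omega>, 0::real))"
  define Y where "Y = (\<lambda>\<omega>. (X \<omega>, indicator A \<omega> :: real))"
  have C: "C \<ge> 0" using bd[of 0] by linarith
  have sub: "subalgebra M (G s)" using B s by (intro brownian_motion_wrtD(2))
  have spG: "space (G s) = space M" and setG: "sets (G s) \<subseteq> sets M" using sub by (auto simp: subalgebra_def)
  have YG: "Y \<in> measurable (G s) (borel \<Otimes>\<^sub>M borel)" unfolding Y_def using X A(1) by measurable
  have Y[measurable]: "Y \<in> measurable M (borel \<Otimes>\<^sub>M borel)" by (rule measurable_from_subalg[OF sub YG])
  have X'[measurable]: "X \<in> borel_measurable M" by (rule measurable_from_subalg[OF sub X])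
  have A'[measurable]: "A \<in> sets M" using A(1) setG by blast
  have D: "distributed M lborel W (\<lambda>x. ennreal (gauss_density (sqrt (t - s)) x))"
    unfolding W_def using brownian_motion_wrtD(6)[OF B s] .
  have W[measurable]: "W \<in> borel_measurable M" using distributed_measurable[OF D] by simp
  have ind0: "indep_set (sets (G s)) {W -` A \<inter> space M | A. A \<in> sets borel}"
    unfolding W_def using brownian_motion_wrtD(5)[OF B s] .
  have st: "Int_stable {W -` A \<inter> space M | A. A \<in> sets borel}"
  proof (rule Int_stableI)
    fix a b assume "a \<in> {W -` A \<inter> space M | A. A \<in> sets borel}" "b \<in> {W -` A \<inter> space M | A. A \<in> sets borel}"
    then obtain A1 A2 where "a = W -` A1 \<inter> space M" "b = W -` A2 \<inter> space M" "A1 \<in> sets borel" "A2 \<in> sets borel" by auto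
    then show "a \<inter> b \<in> {W -` A \<inter> space M | A. A \<in> sets borel}" by (intro CollectI exI[of _ "A1 \<inter> A2"]) auto
  qed
  have ind1: "indep_set (sigma_sets (space M) (sets (G s))) (sigma_sets (space M) {W -` A \<inter> space M | A. A \<in> sets borel})"
    by (rule indep_set_sigma_sets[OF ind0 sets.Int_stable st])
  have "sigma_sets (space M) {Y -` A \<inter> space M | A. A \<in> sets (borel \<Otimes>\<^sub>M borel)} \<subseteq> sigma_sets (space M) (sets (G s))"
    using measurable_sets[OF YG] spG by (intro sigma_sets_mono') auto
  moreover have "sigma_sets (space M) {W0 -` A \<inter> space M | A. A \<in> sets (borel \<Otimes>\<^sub>M borel)}
      \<subseteq> sigma_sets (space M) {W -` A \<inter> space M | A. A \<in> sets borel}"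
  proof (intro sigma_sets_mono' subsetI)
    fix a assume "a \<in> {W0 -` A \<inter> space M | A. A \<in> sets (borel \<Otimes>\<^sub>M borel)}"
    then obtain A1 where A1: "a = W0 -` A1 \<inter> space M" "A1 \<in> sets (borel \<Otimes>\<^sub>M borel)" by auto
    have "(\<lambda>w::real^'n. (w, 0::real)) \<in> measurable borel (borel \<Otimes>\<^sub>M borel)" by measurable
    from measurable_sets[OF this A1(2)] have "(\<lambda>w. (w, 0::real)) -` A1 \<in> sets (borel :: (real^'n) measure)" by simp
    moreover have "a = W -` ((\<lambda>w. (w, 0)) -` A1) \<inter> space M" by (auto simp: A1 W0_def)
    ultimately show "a \<in> {W -` A \<inter> space M | A. A \<in> sets borel}" by blast
  qed
  ultimately have "indep_set (sigma_sets (space M) {Y -` A \<inter> space M | A. A \<in> sets (borel \<Otimes>\<^sub>M borel)})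
      (sigma_sets (space M) {W0 -` A \<inter> space M | A. A \<in> sets (borel \<Otimes>\<^sub>M borel)})"
    using ind1 unfolding indep_set_def by (elim indep_sets_mono_sets) (auto split: bool.split)
  moreover have W0[measurable]: "W0 \<in> measurable M (borel \<Otimes>\<^sub>M borel)" unfolding W0_def by measurable
  ultimately have "indep_var (borel \<Otimes>\<^sub>M borel) Y (borel \<Otimes>\<^sub>M borel) W0" unfolding indep_var_eq by simp
  then have joint: "distr M (borel \<Otimes>\<^sub>M borel) Y \<Otimes>\<^sub>M distr M (borel \<Otimes>\<^sub>M borel) W0
      = distr M ((borel \<Otimes>\<^sub>M borel) \<Otimes>\<^sub>M (borel \<Otimes>\<^sub>M borel)) (\<lambda>\<omega>. (Y \<omega>, W0 \<omega>))"
    using indep_var_distribution_eq by blast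
  \<comment> \<open>The second component of \<open>Y\<close> only takes the values 0 and 1;
    restricting it to [0, 1] keeps \<open>f\<close> bounded on the whole product space, as Fubini
    requires.\<close>
  define f :: "((real^'n) \<times> real) \<times> ((real^'n) \<times> real) \<Rightarrow> real"
    where "f = (\<lambda>z. indicator {0..1} (snd (fst z)) * snd (fst z) * \<phi> (fst (fst z) + (fst (snd z) + b (fst (fst z)))))"
  have f[measurable]: "f \<in> borel_measurable ((borel \<Otimes>\<^sub>M borel) \<Otimes>\<^sub>M (borel \<Otimes>\<^sub>M borel))" unfolding f_def by measurable
  have fbd: "\<bar>f z\<bar> \<le> C" for z
  proof -
    obtain x i w u where z: "z = ((x, i), (w, u))" by (metis surj_pair)
    have "\<bar>indicator {0..1} i * i\<bar> * \<bar>\<phi> (x + (w + b x))\<bar> \<le> 1 * C"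
      using bd C by (intro mult_mono) (auto simp: indicator_def)
    then show ?thesis by (simp add: z f_def abs_mult)
  qed
  have fy[measurable]: "(\<lambda>w. f (y, w)) \<in> borel_measurable (borel \<Otimes>\<^sub>M borel)" for y
    unfolding f_def fst_conv snd_conv by measurable
  interpret PY: prob_space "distr M (borel \<Otimes>\<^sub>M borel) Y" by (rule prob_space_distr) simp
  interpret PW: prob_space "distr M (borel \<Otimes>\<^sub>M borel) W0" by (rule prob_space_distr) simp
  interpret PP: pair_prob_space "distr M (borel \<Otimes>\<^sub>M borel) Y" "distr M (borel \<Otimes>\<^sub>M borel) W0" ..
  define h where "h x = (\<integral>w. gauss_density (sqrt (t - s)) w * \<phi> (x + (w + b x)) \<partial>lborel)" for x
  have inner: "(\<integral>w. f ((x, i), w) \<partial>distr M (borel \<Otimes>\<^sub>M borel) W0) = indicator {0..1} i * i * h x" for x i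
  proof -
    have "(\<integral>w. f ((x, i), w) \<partial>distr M (borel \<Otimes>\<^sub>M borel) W0) = (\<integral>\<omega>. f ((x, i), W0 \<omega>) \<partial>M)"
      by (rule integral_distr) measurable
    also have "\<dots> = (\<integral>\<omega>. indicator {0..1} i * i * \<phi> (x + (W \<omega> + b x)) \<partial>M)" by (simp add: f_def W0_def)
    also have "\<dots> = indicator {0..1} i * i * (\<integral>\<omega>. \<phi> (x + (W \<omega> + b x)) \<partial>M)" by simp
    also have "(\<integral>\<omega>. \<phi> (x + (W \<omega> + b x)) \<partial>M) = h x"
      unfolding h_def by (rule distributed_integral[OF D, symmetric]) (auto simp: gauss_density_nonneg)
    finally show ?thesis .
  qed
  have "(\<integral>\<omega>. indicator A \<omega> * \<phi> (X \<omega> + b (X \<omega>) + (B t \<omega> - B s \<omega>)) \<partial>M) = (\<integral>\<omega>. f (Y \<omega>, W0 \<omega>) \<partial>M)"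
    by (intro Bochner_Integration.integral_cong) (auto simp: f_def Y_def W0_def W_def indicator_def ac_simps)
  also have "\<dots> = integral\<^sup>L (distr M (borel \<Otimes>\<^sub>M borel) Y \<Otimes>\<^sub>M distr M (borel \<Otimes>\<^sub>M borel) W0) f"
    unfolding joint by (rule integral_distr[symmetric]) measurable
  also have "\<dots> = (\<integral>y. (\<integral>w. f (y, w) \<partial>distr M (borel \<Otimes>\<^sub>M borel) W0) \<partial>distr M (borel \<Otimes>\<^sub>M borel) Y)"
    using fbd by (intro PP.integral_fst'[symmetric] PP.P.integrable_const_bound[of _ C]) auto
  also have "\<dots> = (\<integral>\<omega>. (\<integral>w. f (Y \<omega>, w) \<partial>distr M (borel \<Otimes>\<^sub>M borel) W0) \<partial>M)"
    by (rule integral_distr) measurable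
  also have "\<dots> = (\<integral>\<omega>. indicator A \<omega> * h (X \<omega>) \<partial>M)"
    by (intro Bochner_Integration.integral_cong) (auto simp: Y_def inner indicator_def)
  also have "\<dots> \<le> (\<integral>\<omega>. indicator A \<omega> * \<phi> (X \<omega>) + c \<partial>M)"
  proof (rule integral_mono)
    have m: "(\<lambda>\<omega>. \<integral>w. f (Y \<omega>, w) \<partial>distr M (borel \<Otimes>\<^sub>M borel) W0) \<in> borel_measurable M" by measurable
    have eq: "(\<integral>w. f (Y \<omega>, w) \<partial>distr M (borel \<Otimes>\<^sub>M borel) W0) = indicator A \<omega> * h (X \<omega>)" for \<omega>
      by (auto simp: Y_def inner indicator_def)
    have hb: "\<bar>indicator A \<omega> * h (X \<omega>)\<bar> \<le> C" for \<omega>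
    proof -
      have "norm (\<integral>w. f (Y \<omega>, w) \<partial>distr M (borel \<Otimes>\<^sub>M borel) W0) \<le> (\<integral>w. norm (f (Y \<omega>, w)) \<partial>distr M (borel \<Otimes>\<^sub>M borel) W0)"
        by (rule integral_norm_bound)
      also have "\<dots> \<le> (\<integral>w. C \<partial>distr M (borel \<Otimes>\<^sub>M borel) W0)"
      proof (rule integral_mono)
        show "integrable (distr M (borel \<Otimes>\<^sub>M borel) W0) (\<lambda>w. norm (f (Y \<omega>, w)))"
          by (rule PW.integrable_const_bound[of _ C]) (use fbd in simp, measurable)
      qed (use fbd in simp_all)
      also have "\<dots> = C" using PW.prob_space by simp
      finally show ?thesis unfolding eq by simp
    qed
    show "integrable M (\<lambda>\<omega>. indicator A \<omega> * h (X \<omega>))"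
      using m hb unfolding eq by (intro integrable_const_bound[of _ C]) auto
    have "\<bar>indicator A \<omega> * \<phi> (X \<omega>)\<bar> \<le> C" for \<omega>
      using bd[of "X \<omega>"] C by (auto simp: indicator_def)
    then have "integrable M (\<lambda>\<omega>. indicator A \<omega> * \<phi> (X \<omega>))"
      by (intro integrable_const_bound[of _ C]) auto
    then show "integrable M (\<lambda>\<omega>. indicator A \<omega> * \<phi> (X \<omega>) + c)" by simp
    show "indicator A \<omega> * h (X \<omega>) \<le> indicator A \<omega> * \<phi> (X \<omega>) + c" for \<omega>
      using step[OF A(2)] \<open>c \<ge> 0\<close> by (auto simp: indicator_def h_def)
  qed
  also have "\<dots> = (\<integral>\<omega>. indicator A \<omega> * \<phi> (X \<omega>) \<partial>M) + c"
  proof -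
    have "\<bar>indicator A \<omega> * \<phi> (X \<omega>)\<bar> \<le> C" for \<omega>
      using bd[of "X \<omega>"] C by (auto simp: indicator_def)
    then have "integrable M (\<lambda>\<omega>. indicator A \<omega> * \<phi> (X \<omega>))"
      by (intro integrable_const_bound[of _ C]) auto
    then show ?thesis by (simp add: prob_space)
  qed
  finally show ?thesis .
qed

text \<open>Markov's inequality for a stopped process whose mean grows by at most \<open>c\<close>
  per step. No martingale theory is involved: the stopped process is written down explicitly and its
  expectation is followed by induction.\<close>

lemma euler_exit_probability:
  fixes B :: "real \<Rightarrow> 'w \<Rightarrow> real^'n::finite" and \<phi> :: "real^'n \<Rightarrow> real"
  assumes B: "brownian_motion_wrt M G B" and "\<delta> > 0"
    and b[measurable]: "b \<in> borel_measurable borel"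
    and \<phi>[measurable]: "\<phi> \<in> borel_measurable borel" and bd: "\<And>x. \<bar>\<phi> x\<bar> \<le> C" and nn: "\<And>x. x \<in> K \<Longrightarrow> 0 \<le> \<phi> x"
    and K[measurable]: "K \<in> sets borel" and v0: "v0 \<in> K"
    and out: "\<And>x. x \<notin> K \<Longrightarrow> m \<le> \<phi> x"
    and step: "\<And>x. x \<in> K \<Longrightarrow>
      (\<integral>w. gauss_density (sqrt \<delta>) w * \<phi> (x + (w + \<delta> *\<^sub>R b x)) \<partial>lborel) \<le> \<phi> x + c"
    and "c \<ge> 0"
  shows "{\<omega>\<in>space M. \<exists>k\<le>N. euler b (\<lambda>s. B s \<omega>) v0 \<delta> k \<notin> K} \<in> sets M"
    and "m * measure M {\<omega>\<in>space M. \<exists>k\<le>N. euler b (\<lambda>s. B s \<omega>) v0 \<delta> k \<notin> K} \<le> \<phi> v0 + real N * c"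
proof -
  interpret prob_space M by (rule brownian_motion_wrtD(1)[OF B])
  define E where "E k \<omega> = euler b (\<lambda>s. B s \<omega>) v0 \<delta> k" for k \<omega>
  have EG: "E k \<in> borel_measurable (G (real j * \<delta>))" if "k \<le> j" for k j
    unfolding E_def[abs_def] using that \<open>\<delta> > 0\<close> by (intro euler_adapted[OF B b]) (auto intro!: mult_right_mono)
  have sub: "subalgebra M (G (real j * \<delta>))" for j using B \<open>\<delta> > 0\<close> by (intro brownian_motion_wrtD(2)) auto
  then have sp: "space (G (real j * \<delta>)) = space M" and st: "sets (G (real j * \<delta>)) \<subseteq> sets M" for j
    by (auto simp: subalgebra_def)
  have E[measurable]: "E k \<in> borel_measurable M" for k by (rule measurable_from_subalg[OF sub EG[OF order_refl]])
  define A where "A k = {\<omega>\<in>space M. \<forall>j\<le>k. E j \<omega> \<in> K}" for k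
  have AG: "A k \<in> sets (G (real k * \<delta>))" for k
  proof -
    have "A k = (\<Inter>j\<in>{..k}. E j -` K \<inter> space (G (real k * \<delta>)))" by (auto simp: A_def sp)
    also have "\<dots> \<in> sets (G (real k * \<delta>))"
      by (intro sets.finite_INT measurable_sets[OF EG] K) auto
    finally show ?thesis .
  qed
  have A[measurable]: "A k \<in> sets M" for k using AG st by blast
  have AK: "\<omega> \<in> A k \<Longrightarrow> E k \<omega> \<in> K" for k \<omega> by (simp add: A_def)
  have ASuc: "A (Suc k) = {\<omega>\<in>A k. E (Suc k) \<omega> \<in> K}" for k by (auto simp: A_def le_Suc_eq)
  \<comment> \<open>After the exit the value is frozen at the lower bound \<open>m\<close> instead
    of the value of \<open>\<phi>\<close> at exit. Since \<open>\<phi>\<close> is at least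
    \<open>m\<close> outside \<open>K\<close>, this only lowers the expectation.\<close>
  define Z where "Z k \<omega> = indicator (A k) \<omega> * \<phi> (E k \<omega>) + m * indicator (space M - A k) \<omega>" for k \<omega>
  have ii: "integrable M (\<lambda>\<omega>. indicator (A k) \<omega> * \<phi> (E j \<omega>))" for k j
  proof (rule integrable_const_bound[of _ C])
    have "C \<ge> 0" using bd[of 0] by linarith
    then show "AE \<omega> in M. norm (indicator (A k) \<omega> * \<phi> (E j \<omega>)) \<le> C" using bd by (auto simp: indicator_def)
  qed measurable
  have im: "integrable M (\<lambda>\<omega>. m * indicator (space M - A k) \<omega>)" for k
    by (intro integrable_mult_right integrable_real_indicator) (auto simp: emeasure_eq_measure)
  have Z: "expectation (Z k) \<le> \<phi> v0 + real k * c" for k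
  proof (induction k)
    case 0
    have "expectation (Z 0) = (\<integral>\<omega>. \<phi> v0 \<partial>M)"
      by (intro Bochner_Integration.integral_cong) (auto simp: Z_def A_def E_def v0)
    then show ?case by (simp add: prob_space)
  next
    case (Suc k)
    have "expectation (Z (Suc k)) \<le> (\<integral>\<omega>. indicator (A k) \<omega> * \<phi> (E (Suc k) \<omega>) + m * indicator (space M - A k) \<omega> \<partial>M)"
    proof (rule integral_mono)
      show "integrable M (Z (Suc k))" unfolding Z_def by (intro Bochner_Integration.integrable_add ii im)
      show "integrable M (\<lambda>\<omega>. indicator (A k) \<omega> * \<phi> (E (Suc k) \<omega>) + m * indicator (space M - A k) \<omega>)"
        by (intro Bochner_Integration.integrable_add ii im)
      show "Z (Suc k) \<omega> \<le> indicator (A k) \<omega> * \<phi> (E (Suc k) \<omega>) + m * indicator (space M - A k) \<omega>"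
        if "\<omega> \<in> space M" for \<omega>
        using that out[of "E (Suc k) \<omega>"] by (auto simp: Z_def ASuc indicator_def)
    qed
    also have "\<dots> = (\<integral>\<omega>. indicator (A k) \<omega> * \<phi> (E (Suc k) \<omega>) \<partial>M) + (\<integral>\<omega>. m * indicator (space M - A k) \<omega> \<partial>M)"
      by (rule Bochner_Integration.integral_add[OF ii im])
    also have "(\<integral>\<omega>. indicator (A k) \<omega> * \<phi> (E (Suc k) \<omega>) \<partial>M) \<le> (\<integral>\<omega>. indicator (A k) \<omega> * \<phi> (E k \<omega>) \<partial>M) + c"
    proof -
      have t: "0 \<le> real k * \<delta>" "real k * \<delta> < real (Suc k) * \<delta>" "real (Suc k) * \<delta> - real k * \<delta> = \<delta>"
        using \<open>\<delta> > 0\<close> by (auto simp: algebra_simps)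
      have bm: "(\<lambda>x. \<delta> *\<^sub>R b x) \<in> borel_measurable borel" by measurable
      have step': "(\<integral>w. gauss_density (sqrt (real (Suc k) * \<delta> - real k * \<delta>)) w * \<phi> (x + (w + \<delta> *\<^sub>R b x)) \<partial>lborel) \<le> \<phi> x + c"
        if "x \<in> K" for x unfolding t(3) by (rule step[OF that])
      have "(\<integral>\<omega>. indicator (A k) \<omega> * \<phi> (E k \<omega> + \<delta> *\<^sub>R b (E k \<omega>) + (B (real (Suc k) * \<delta>) \<omega> - B (real k * \<delta>) \<omega>)) \<partial>M)
        \<le> (\<integral>\<omega>. indicator (A k) \<omega> * \<phi> (E k \<omega>) \<partial>M) + c"
        by (rule brownian_one_step[OF B t(1,2) EG[OF order_refl] AG AK bm \<phi> bd step' \<open>c \<ge> 0\<close>])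
      then show ?thesis by (simp add: E_def)
    qed
    also have "(\<integral>\<omega>. indicator (A k) \<omega> * \<phi> (E k \<omega>) \<partial>M) + c + (\<integral>\<omega>. m * indicator (space M - A k) \<omega> \<partial>M) = expectation (Z k) + c"
      unfolding Z_def by (subst Bochner_Integration.integral_add[OF ii im]) simp
    finally show ?case using Suc.IH by (simp add: algebra_simps)
  qed
  have S: "{\<omega>\<in>space M. \<exists>k\<le>N. euler b (\<lambda>s. B s \<omega>) v0 \<delta> k \<notin> K} = space M - A N"
    by (auto simp: A_def E_def)
  show "{\<omega>\<in>space M. \<exists>k\<le>N. euler b (\<lambda>s. B s \<omega>) v0 \<delta> k \<notin> K} \<in> sets M" unfolding S by measurable
  have "m * measure M (space M - A N) = (\<integral>\<omega>. m * indicator (space M - A N) \<omega> \<partial>M)"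
    by simp
  also have "\<dots> \<le> expectation (Z N)"
  proof (rule integral_mono)
    show "integrable M (Z N)" unfolding Z_def by (intro Bochner_Integration.integrable_add ii im)
    show "m * indicator (space M - A N) \<omega> \<le> Z N \<omega>" for \<omega>
      using nn[OF AK[of \<omega> N]] by (auto simp: Z_def indicator_def)
  qed (rule im)
  also have "\<dots> \<le> \<phi> v0 + real N * c" by (rule Z)
  finally show "m * measure M {\<omega>\<in>space M. \<exists>k\<le>N. euler b (\<lambda>s. B s \<omega>) v0 \<delta> k \<notin> K} \<le> \<phi> v0 + real N * c"
    unfolding S .
qed

text \<open>A path of the limiting equation that leaves the closed set \<open>K\<close> forces the Euler chains of all
  sufficiently fine meshes to leave \<open>K\<close>, whence the limes inferior of events.\<close>

lemma exit_probability:
  fixes B :: "real \<Rightarrow> 'w \<Rightarrow> real^'n::finite" and \<phi> :: "real^'n \<Rightarrow> real"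
  assumes B: "brownian_motion_wrt M G B" and "T > 0"
    and b: "b \<in> borel_measurable borel"
    and \<phi>: "\<phi> \<in> borel_measurable borel" and bd: "\<And>x. \<bar>\<phi> x\<bar> \<le> C" and nn: "\<And>x. x \<in> K \<Longrightarrow> 0 \<le> \<phi> x"
    and K: "K \<in> sets borel" and v0: "v0 \<in> K"
    and out: "\<And>x. x \<notin> K \<Longrightarrow> m \<le> \<phi> x" and m: "m > 0"
    and "\<delta>0 > 0" and step: "\<And>\<delta> x. 0 < \<delta> \<Longrightarrow> \<delta> < \<delta>0 \<Longrightarrow> x \<in> K \<Longrightarrow>
      (\<integral>w. gauss_density (sqrt \<delta>) w * \<phi> (x + (w + \<delta> *\<^sub>R b x)) \<partial>lborel) \<le> \<phi> x + 2 * \<delta>"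
  shows "\<exists>D\<in>sets M. measure M D \<le> (\<phi> v0 + 2 * T) / m \<and>
    (\<forall>\<omega> N0. \<omega> \<in> space M \<longrightarrow> (\<forall>N\<ge>N0. \<exists>k\<le>N. euler b (\<lambda>s. B s \<omega>) v0 (T / real N) k \<notin> K) \<longrightarrow> \<omega> \<in> D)"
proof -
  interpret prob_space M by (rule brownian_motion_wrtD(1)[OF B])
  \<comment> \<open>Beyond \<open>N1\<close> the mesh T / N is below \<delta>0. The N steps then add
    up to N * 2 (T / N) = 2 T, independent of N.\<close>
  obtain N1 :: nat where N1: "real N1 > T / \<delta>0" using reals_Archimedean2 by blast
  have N1': "N1 > 0"
  proof -
    have "0 < T / \<delta>0" using \<open>T > 0\<close> \<open>\<delta>0 > 0\<close> by simp
    then have "0 < real N1" using N1 by linarith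
    then show ?thesis by simp
  qed
  define Q where "Q N = {\<omega>\<in>space M. \<exists>k\<le>N. euler b (\<lambda>s. B s \<omega>) v0 (T / real N) k \<notin> K}" for N
  have Q: "Q N \<in> sets M" "measure M (Q N) \<le> (\<phi> v0 + 2 * T) / m" if N: "N \<ge> N1" for N
  proof -
    have N0: "real N > 0" using N N1' by simp
    have "T < \<delta>0 * real N1" using N1 \<open>\<delta>0 > 0\<close> by (simp add: field_simps)
    also have "\<dots> \<le> \<delta>0 * real N" using N \<open>\<delta>0 > 0\<close> by simp
    finally have d: "0 < T / real N" "T / real N < \<delta>0" using N0 \<open>T > 0\<close> by (simp_all add: field_simps)
    have s: "Q N \<in> sets M" and p: "m * measure M (Q N) \<le> \<phi> v0 + real N * (2 * (T / real N))"
      unfolding Q_def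
      by (rule euler_exit_probability[OF B d(1) b \<phi> bd nn K v0 out step[OF d]], assumption+, use d in simp)+
    show "Q N \<in> sets M" by (rule s)
    show "measure M (Q N) \<le> (\<phi> v0 + 2 * T) / m" using p m N0 by (simp add: field_simps)
  qed
  define R where "R j = (\<Inter>N\<in>{N1 + j..}. Q N)" for j
  have R: "R j \<in> sets M" for j unfolding R_def
    by (rule sets.countable_INT') (use Q(1) in auto)
  have Rm: "measure M (R j) \<le> (\<phi> v0 + 2 * T) / m" for j
  proof -
    have "R j \<subseteq> Q (N1 + j)" by (auto simp: R_def)
    then have "measure M (R j) \<le> measure M (Q (N1 + j))"
      by (rule finite_measure_mono) (rule Q(1), simp)
    also have "\<dots> \<le> (\<phi> v0 + 2 * T) / m" by (rule Q(2)) simp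
    finally show ?thesis .
  qed
  have "incseq R"
  proof (rule incseq_SucI, rule subsetI)
    fix j \<omega> assume "\<omega> \<in> R j"
    then show "\<omega> \<in> R (Suc j)" by (simp add: R_def)
  qed
  then have "(\<lambda>j. measure M (R j)) \<longlonglongrightarrow> measure M (\<Union>j. R j)" using R by (intro finite_Lim_measure_incseq) auto
  then have Um: "measure M (\<Union>j. R j) \<le> (\<phi> v0 + 2 * T) / m" by (rule LIMSEQ_le_const2) (use Rm in blast)
  have Us: "(\<Union>j. R j) \<in> sets M" using R by auto
  have UR: "\<omega> \<in> (\<Union>j. R j)" if w: "\<omega> \<in> space M"
      "\<And>N. N \<ge> N0 \<Longrightarrow> \<exists>k\<le>N. euler b (\<lambda>s. B s \<omega>) v0 (T / real N) k \<notin> K" for \<omega> N0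
  proof (rule UN_I[of N0])
    show "\<omega> \<in> R N0" unfolding R_def
    proof (rule INT_I)
      fix N assume "N \<in> {N1 + N0..}"
      then have "N \<ge> N0" by simp
      from w(2)[OF this] show "\<omega> \<in> Q N" unfolding Q_def using w(1) by simp
    qed
  qed simp
  show ?thesis
  proof (intro bexI[of _ "\<Union>j. R j"] conjI allI impI)
    fix \<omega> N0 assume "\<omega> \<in> space M" and N: "\<forall>N\<ge>N0. \<exists>k\<le>N. euler b (\<lambda>s. B s \<omega>) v0 (T / real N) k \<notin> K"
    then show "\<omega> \<in> (\<Union>j. R j)" by (intro UR[OF _ N[rule_format]])
  qed (rule Um Us)+
qed

text \<open>The point V t lies at positive distance from the closed set \<open>K\<close>. The last
  grid time before t and the Euler error cost at most half of that distance each.\<close>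

lemma solution_exit_euler_exit:
  fixes b :: "'a::euclidean_space \<Rightarrow> 'a"
  assumes V: "solves b w v0 V T" and "w 0 = 0" "L-lipschitz_on UNIV b" and T: "T > 0"
    and K: "closed K" and t: "t \<in> {0..T}" "V t \<notin> K"
  shows "\<exists>N0. \<forall>N\<ge>N0. \<exists>k\<le>N. euler b w v0 (T / real N) k \<notin> K"
proof -
  obtain e where e: "e > 0" "ball (V t) e \<subseteq> - K"
    using K t(2) by (metis ComplI open_Compl open_contains_ball)
  have cV: "continuous_on {0..T} V" using V by (simp add: solves_def)
  obtain N1 where N1: "N1 > 0" "\<And>N s r. N \<ge> N1 \<Longrightarrow> s \<in> {0..T} \<Longrightarrow> r \<in> {0..T} \<Longrightarrow> \<bar>s - r\<bar> \<le> T / real N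
      \<Longrightarrow> norm (V s - V r) \<le> e / 2"
    using uniform_mesh[OF cV, of "e / 2"] T e by (metis half_gt_zero less_imp_le)
  obtain N2 where N2: "N2 > 0" "\<And>N k. N \<ge> N2 \<Longrightarrow> k \<le> N \<Longrightarrow>
      dist (euler b w v0 (T / real N) k) (V (real k * (T / real N))) < e / 2"
    using euler_converges[OF assms(1-3), of "e / 2"] T e by (metis half_gt_zero less_imp_le)
  show ?thesis
  proof (rule exI[of _ "max N1 N2"], intro allI impI)
    fix N assume N: "N \<ge> max N1 N2"
    then have N0: "real N > 0" using N1(1) by simp
    define h where "h = T / real N"
    have h: "h > 0" "real N * h = T" using N0 T by (auto simp: h_def)
    define k where "k = nat \<lfloor>t / h\<rfloor>"
    have k: "real k \<le> t / h" "t / h < real k + 1"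
      using t(1) h(1) by (auto simp: k_def)
    have kh: "real k * h \<le> t" "t < real k * h + h" using k h(1) by (simp_all add: field_simps)
    have "real k * h \<le> real N * h" using kh t(1) h(2) by simp
    then have kN: "k \<le> N" using h(1) by simp
    have "norm (V (real k * h) - V t) \<le> e / 2"
      using N kh t(1) h(1) by (intro N1(2)[of N]) (auto simp: h_def[symmetric])
    moreover have "dist (euler b w v0 h k) (V (real k * h)) < e / 2"
      using N2(2)[of N k] N kN by (simp add: h_def)
    ultimately have "dist (V t) (euler b w v0 h k) < e"
      using dist_triangle[of "V t" "euler b w v0 h k" "V (real k * h)"] by (simp add: dist_norm norm_minus_commute)
    then have "euler b w v0 h k \<notin> K" using e(2) by auto
    then show "\<exists>k\<le>N. euler b w v0 (T / real N) k \<notin> K" using kN by (auto simp: h_def)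
  qed
qed

section \<open>Well-posedness\<close>

text \<open>A radial factor removes the singularity at 0, and precomposition with the projection
  onto the closed ball, which is 1-Lipschitz, makes the result bounded and globally
  Lipschitz.\<close>

lemma lipschitz_extension_annulus:
  fixes F :: "'a::euclidean_space \<Rightarrow> 'a"
  assumes F: "\<And>x. x \<noteq> 0 \<Longrightarrow> lipschitz_near F x" and r: "0 < r" "r \<le> R"
  shows "\<exists>b L M. L-lipschitz_on UNIV b \<and> (\<forall>x. norm (b x) \<le> M) \<and>
    (\<forall>x. r \<le> norm x \<longrightarrow> norm x \<le> R \<longrightarrow> b x = F x)"
proof -
  \<comment> \<open>Equal to 0 for |x| \<le> r/2 and to 1 for |x| \<ge> r, linear in |x|
    between.\<close>
  define \<eta> where "\<eta> x = max 0 (min 1 (2 / r * norm x + - 1))" for x :: 'a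
  define H where "H x = \<eta> x *\<^sub>R F x" for x
  have clamp: "lipschitz_near (\<lambda>t. max 0 (min 1 t)) (t::real)" for t
    by (rule lipschitz_nearI[of 1 _ _ 1]) (auto simp: dist_real_def max_def min_def)
  have \<eta>: "lipschitz_near \<eta> x" for x
    unfolding \<eta>_def[abs_def]
    by (rule lipschitz_near_compose[OF lipschitz_near_add[OF lipschitz_near_mult[OF lipschitz_near_const lipschitz_near_norm]
          lipschitz_near_const] clamp])
  have H: "lipschitz_near H x" for x
  proof (cases "x = 0")
    case True
    have "H y = 0" if "y \<in> ball 0 (r / 2)" for y
      using that r by (simp add: H_def \<eta>_def field_simps)
    then show ?thesis unfolding True
      by (intro lipschitz_near_cong[OF lipschitz_near_const[of 0], of "ball 0 (r / 2)"]) (use r in auto)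
  next
    case False
    then show ?thesis unfolding H_def[abs_def] by (intro lipschitz_near_scaleR \<eta> F)
  qed
  obtain L where L: "L-lipschitz_on (cball 0 R) H"
    by (rule compact_lipschitz_near[OF compact_cball[of 0 R] H])
  have R: "R \<ge> 0" using r by simp
  have cp: "convex (cball (0::'a) R)" "closed (cball (0::'a) R)" "cball (0::'a) R \<noteq> {}" using R by auto
  define b where "b x = H (closest_point (cball 0 R) x)" for x
  have mem: "closest_point (cball 0 R) x \<in> cball 0 R" for x :: 'a
    by (rule closest_point_in_set[OF cp(2,3)])
  have "bounded (H ` cball 0 R)"
    by (intro compact_imp_bounded compact_continuous_image lipschitz_on_continuous_on[OF L] compact_cball)
  then obtain M where M: "\<And>x. x \<in> cball 0 R \<Longrightarrow> norm (H x) \<le> M" unfolding bounded_iff by blast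
  show ?thesis
  proof (rule exI[of _ b], rule exI[of _ L], rule exI[of _ M], intro conjI allI impI)
    show "L-lipschitz_on UNIV b"
    proof (rule lipschitz_onI)
      fix x y :: 'a
      have "dist (b x) (b y) \<le> L * dist (closest_point (cball 0 R) x) (closest_point (cball 0 R) y)"
        unfolding b_def by (rule lipschitz_onD[OF L mem mem])
      also have "\<dots> \<le> L * dist x y"
        by (intro mult_left_mono closest_point_lipschitz[OF cp] lipschitz_on_nonneg[OF L])
      finally show "dist (b x) (b y) \<le> L * dist x y" .
    qed (rule lipschitz_on_nonneg[OF L])
    show "norm (b x) \<le> M" for x unfolding b_def by (rule M[OF mem])
    fix x :: 'a assume x: "r \<le> norm x" "norm x \<le> R"
    have "\<eta> x = 1" using x r by (simp add: \<eta>_def field_simps min_def)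
    moreover have "closest_point (cball 0 R) x = x" using x by (intro closest_point_self) simp
    ultimately show "b x = F x" by (simp add: b_def H_def)
  qed
qed

text \<open>Translates the assumption on the drift into the data of
  \<open>lyapunov_function\<close>: \<kappa>(|v|^2) is the inner product of F(v) with v, and
  \<open>G\<close> is \<Gamma>(sqrt q) to the power \<beta>.\<close>

lemma drift_lyapunov:
  fixes F :: "real ^ 'n \<Rightarrow> real ^ 'n"
  assumes "CARD('n) \<ge> 2" "\<beta> > 0" "drift_assumption F"
  shows "x \<noteq> 0 \<Longrightarrow> lipschitz_near F x"
    and "\<exists>g g1 g2. (\<forall>q>0. (g has_real_derivative g1 q) (at q)) \<and> (\<forall>q>0. (g1 has_real_derivative g2 q) (at q)) \<and>
      continuous_on {0<..} g2 \<and> (\<forall>q>0. g q \<ge> 0) \<and>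
      (\<forall>x. x \<noteq> 0 \<longrightarrow> 2 * g1 ((norm x)\<^sup>2) * (x \<bullet> (- (\<beta> / 2)) *\<^sub>R F x) + real CARD('n) * g1 ((norm x)\<^sup>2)
         + 2 * (norm x)\<^sup>2 * g2 ((norm x)\<^sup>2) = 1) \<and>
      (\<forall>m. \<exists>n0::nat. \<forall>n\<ge>n0. \<forall>q>0. q < 1 / (real n + 1) \<or> q > real n + 1 \<longrightarrow> g q \<ge> m)"
proof -
  obtain \<gamma> :: "real ^ 'n \<Rightarrow> real" and \<Gamma> where \<gamma>: "smooth_on \<gamma> (sphere 0 1)" "\<forall>u\<in>sphere 0 1. \<gamma> u > 0"
    and \<Gamma>: "smooth_on \<Gamma> {0..}" "\<forall>r\<ge>0. \<Gamma> r > 0" and asym: "\<Gamma> \<sim>[at_top] (\<lambda>r. r)"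
    and F: "\<forall>v. v \<noteq> 0 \<longrightarrow> GDERIV (\<lambda>w. ln (\<Gamma> (norm w) * \<gamma> (w /\<^sub>R norm w))) v :> F v"
    using assms(3) unfolding drift_assumption_def by blast
  show lip: "x \<noteq> 0 \<Longrightarrow> lipschitz_near F x" for x
    by (rule lipschitz_near_gradient[OF \<gamma>(1) _ \<Gamma>(1)]) (use \<gamma>(2) \<Gamma>(2) F in auto)
  have d\<Gamma>: "(\<Gamma> has_real_derivative deriv \<Gamma> r) (at r)" if "r > 0" for r
    by (rule smooth_on_DERIV[OF \<Gamma>(1)]) (use that in simp)
  define \<kappa> where "\<kappa> q = sqrt q * deriv \<Gamma> (sqrt q) / \<Gamma> (sqrt q)" for q
  have rad: "F v \<bullet> v = \<kappa> ((norm v)\<^sup>2)" if "v \<noteq> 0" for v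
  proof -
    have "v /\<^sub>R norm v \<in> sphere 0 1" using that by simp
    then show ?thesis
      using radial_gradient[OF F[rule_format, OF that] that d\<Gamma>[of "norm v"]] that \<Gamma>(2) \<gamma>(2) by (simp add: \<kappa>_def)
  qed
  \<comment> \<open>A unit vector: restricting F(v) . v to its ray expresses \<kappa> through
    \<open>F\<close>, so continuity of \<kappa> follows from that of \<open>F\<close> without
    returning to the derivative of \<Gamma>.\<close>
  define e where "e = (axis undefined 1 :: real ^ 'n)"
  have e: "norm e = 1" by (simp add: e_def)
  have c\<kappa>: "continuous_on {0<..} \<kappa>"
  proof -
    have "continuous_on {0<..} (\<lambda>q. F (sqrt q *\<^sub>R e) \<bullet> (sqrt q *\<^sub>R e))"
    proof (intro continuous_on_inner continuous_intros)
      have "continuous_on (- {0}) F" by (intro continuous_at_imp_continuous_on ballI lipschitz_near_isCont lip) simp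
      then show "continuous_on {0<..} (\<lambda>q. F (sqrt q *\<^sub>R e))"
        by (rule continuous_on_compose2) (use e in \<open>auto intro!: continuous_intros\<close>)
    qed
    then show ?thesis
    proof (rule continuous_on_eq)
      fix q :: real assume "q \<in> {0<..}"
      then have ne: "sqrt q *\<^sub>R e \<noteq> 0" and sq: "(norm (sqrt q *\<^sub>R e))\<^sup>2 = q" using e by auto
      show "F (sqrt q *\<^sub>R e) \<bullet> sqrt q *\<^sub>R e = \<kappa> q" by (rule rad[OF ne, unfolded sq])
    qed
  qed
  define G where "G q = \<Gamma> (sqrt q) powr \<beta>" for q
  have dG: "(G has_real_derivative \<beta> * \<kappa> q / (2 * q) * G q) (at q)" if q: "q > 0" for q
  proof -
    have s: "sqrt q > 0" "\<Gamma> (sqrt q) > 0" using q \<Gamma>(2) by auto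
    have "((\<lambda>q. \<Gamma> (sqrt q)) has_real_derivative deriv \<Gamma> (sqrt q) * (inverse (sqrt q) / 2)) (at q)"
      by (rule DERIV_chain2[OF d\<Gamma>[OF s(1)] DERIV_real_sqrt[OF q]])
    from DERIV_fun_powr[OF this s(2), of \<beta>]
    have "(G has_real_derivative \<beta> * \<Gamma> (sqrt q) powr (\<beta> - 1) * (deriv \<Gamma> (sqrt q) * (inverse (sqrt q) / 2))) (at q)"
      by (simp add: G_def[abs_def])
    moreover have "\<beta> * \<Gamma> (sqrt q) powr (\<beta> - 1) * (deriv \<Gamma> (sqrt q) * (inverse (sqrt q) / 2)) = \<beta> * \<kappa> q / (2 * q) * G q"
    proof -
      have "inverse (q / sqrt q) = inverse (sqrt q)" using real_div_sqrt[of q] q by simp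
      then have "sqrt q / q = inverse (sqrt q)" by (simp only: inverse_divide)
      have "\<beta> * \<kappa> q / (2 * q) * G q = \<beta> * (sqrt q / q * (deriv \<Gamma> (sqrt q) / \<Gamma> (sqrt q))) / 2 * G q"
        by (simp add: \<kappa>_def)
      also have "sqrt q / q = inverse (sqrt q)" by fact
      finally show ?thesis using s by (simp add: G_def powr_diff)
    qed
    ultimately show ?thesis by (rule DERIV_cong)
  qed
  \<comment> \<open>Positivity and continuity of \<Gamma> up to r = 0 give a positive minimum on
    [0, 1], hence the lower bound of \<open>G\<close> near 0.\<close>
  have "continuous_on {0..1} \<Gamma>" by (rule continuous_on_subset[OF smooth_on_continuous_on[OF \<Gamma>(1)]]) auto
  then have "\<exists>r\<in>{0..1}. \<forall>y\<in>{0..1}. \<Gamma> r \<le> \<Gamma> y" by (intro continuous_attains_inf) auto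
  then obtain r0 where r0: "r0 \<in> {0..1}" "\<forall>r\<in>{0..1}. \<Gamma> r0 \<le> \<Gamma> r" by blast
  have \<Gamma>r0: "\<Gamma> r0 > 0" using \<Gamma>(2) r0 by simp
  have G0: "\<Gamma> r0 powr \<beta> \<le> G q" if "0 < q" "q \<le> 1" for q
    unfolding G_def using that \<Gamma>r0 assms(2) by (intro powr_mono2 r0(2)[rule_format]) auto
  have "\<exists>R>0. \<forall>r\<ge>R. r / 2 \<le> \<Gamma> r \<and> \<Gamma> r \<le> 2 * r"
  proof -
    \<comment> \<open>The conditional is the 0/0 convention inside asymptotic equivalence; it is
      inactive for r > 0.\<close>
    have "((\<lambda>r. if \<Gamma> r = 0 \<and> r = 0 then 1 else \<Gamma> r / r) \<longlongrightarrow> 1) at_top"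
      using asym by (simp add: asymp_equiv_def)
    then have "\<forall>\<^sub>F r in at_top. dist (if \<Gamma> r = 0 \<and> r = 0 then 1 else \<Gamma> r / r) 1 < 1 / 2"
      by (rule tendstoD) simp
    then obtain R0 where R0: "\<And>r. r \<ge> R0 \<Longrightarrow> dist (if \<Gamma> r = 0 \<and> r = 0 then 1 else \<Gamma> r / r) 1 < 1 / 2"
      unfolding eventually_at_top_linorder by blast
    show ?thesis
    proof (rule exI[of _ "max R0 1"], intro conjI allI impI)
      show "max R0 1 > 0" by simp
      fix r assume "r \<ge> max R0 1"
      then have r: "r \<ge> R0" "r > 0" by auto
      have "\<bar>\<Gamma> r / r - 1\<bar> < 1 / 2" using R0[OF r(1)] r(2) by (simp add: dist_real_def)
      then have "1 / 2 \<le> \<Gamma> r / r" "\<Gamma> r / r \<le> 2" by linarith+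
      then show "r / 2 \<le> \<Gamma> r" "\<Gamma> r \<le> 2 * r" using r(2) by (simp_all add: field_simps)
    qed
  qed
  then obtain R where "R > 0" and R': "\<forall>r\<ge>R. r / 2 \<le> \<Gamma> r \<and> \<Gamma> r \<le> 2 * r" by blast
  have Ginf: "(sqrt q / 2) powr \<beta> \<le> G q" "G q \<le> (2 * sqrt q) powr \<beta>" if "q \<ge> R\<^sup>2" for q
  proof -
    have R: "sqrt q \<ge> R" using that \<open>R > 0\<close> by (simp add: real_le_rsqrt)
    then have "sqrt q > 0" using \<open>R > 0\<close> by linarith
    moreover have "sqrt q / 2 \<le> \<Gamma> (sqrt q)" "\<Gamma> (sqrt q) \<le> 2 * sqrt q" using R'[rule_format, OF R] by auto
    moreover have "\<beta> \<ge> 0" "\<Gamma> (sqrt q) \<ge> 0" using assms(2) \<Gamma>(2) \<open>sqrt q > 0\<close> by (auto intro: less_imp_le)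
    ultimately show "(sqrt q / 2) powr \<beta> \<le> G q" "G q \<le> (2 * sqrt q) powr \<beta>"
      unfolding G_def by (simp_all add: powr_mono2)
  qed
  have Gpos: "G q > 0" if "q > 0" for q using that \<Gamma>(2)[rule_format, of "sqrt q"] by (simp add: G_def)
  have d2: "real CARD('n) \<ge> 2" using assms(1) by simp
  have c0: "\<Gamma> r0 powr \<beta> > 0" using \<Gamma>r0 by simp
  have "\<exists>g g1 g2. (\<forall>q>0. (g has_real_derivative g1 q) (at q)) \<and> (\<forall>q>0. (g1 has_real_derivative g2 q) (at q)) \<and>
    continuous_on {0<..} g2 \<and> (\<forall>q>0. g q \<ge> 0) \<and>
    (\<forall>q>0. (real CARD('n) - \<beta> * \<kappa> q) * g1 q + 2 * q * g2 q = 1) \<and>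
    (\<forall>m. \<exists>n0::nat. \<forall>n\<ge>n0. \<forall>q>0. q < 1 / (real n + 1) \<or> q > real n + 1 \<longrightarrow> g q \<ge> m)"
    by (rule lyapunov_function[OF d2 Gpos dG c\<kappa> c0 G0 Ginf assms(2)])
  then obtain g g1 g2 where g: "\<forall>q>0. (g has_real_derivative g1 q) (at q)" "\<forall>q>0. (g1 has_real_derivative g2 q) (at q)"
    "continuous_on {0<..} g2" "\<forall>q>0. g q \<ge> 0"
    and eq: "\<forall>q>0. (real CARD('n) - \<beta> * \<kappa> q) * g1 q + 2 * q * g2 q = 1"
    and inf: "\<forall>m. \<exists>n0::nat. \<forall>n\<ge>n0. \<forall>q>0. q < 1 / (real n + 1) \<or> q > real n + 1 \<longrightarrow> g q \<ge> m"
    by (elim exE conjE) (rule that)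
  have gen: "2 * g1 ((norm x)\<^sup>2) * (x \<bullet> (- (\<beta> / 2)) *\<^sub>R F x) + real CARD('n) * g1 ((norm x)\<^sup>2)
         + 2 * (norm x)\<^sup>2 * g2 ((norm x)\<^sup>2) = 1" if x: "x \<noteq> 0" for x
  proof -
    have xF: "x \<bullet> (- (\<beta> / 2)) *\<^sub>R F x = - (\<beta> / 2) * \<kappa> ((norm x)\<^sup>2)"
      using rad[OF x] by (simp add: inner_commute)
    show ?thesis unfolding xF using eq[rule_format, of "(norm x)\<^sup>2"] x by (simp add: algebra_simps)
  qed
  show "\<exists>g g1 g2. (\<forall>q>0. (g has_real_derivative g1 q) (at q)) \<and> (\<forall>q>0. (g1 has_real_derivative g2 q) (at q)) \<and>
      continuous_on {0<..} g2 \<and> (\<forall>q>0. g q \<ge> 0) \<and>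
      (\<forall>x. x \<noteq> 0 \<longrightarrow> 2 * g1 ((norm x)\<^sup>2) * (x \<bullet> (- (\<beta> / 2)) *\<^sub>R F x) + real CARD('n) * g1 ((norm x)\<^sup>2)
         + 2 * (norm x)\<^sup>2 * g2 ((norm x)\<^sup>2) = 1) \<and>
      (\<forall>m. \<exists>n0::nat. \<forall>n\<ge>n0. \<forall>q>0. q < 1 / (real n + 1) \<or> q > real n + 1 \<longrightarrow> g q \<ge> m)"
  proof (rule exI[of _ g], rule exI[of _ g1], rule exI[of _ g2], intro conjI)
  qed (rule g inf | intro allI impI gen, assumption)+
qed

text \<open>An increasing exhaustion of the punctured space, stated in |x|^2 because this is the
  variable of \<open>g\<close>; the thresholds are those in the growth statement of
  \<open>lyapunov_function\<close>.\<close>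

definition annulus :: "nat \<Rightarrow> 'a::real_normed_vector set" where
  "annulus n = {x. (norm x)\<^sup>2 \<in> {1 / (real n + 1)..real n + 1}}"

lemma annulus_closed: "closed (annulus n :: 'a::real_normed_vector set)"
proof -
  have "closed ((\<lambda>x::'a. (norm x)\<^sup>2) -` {1 / (real n + 1)..real n + 1})"
    by (rule continuous_closed_vimage) (auto intro!: continuous_intros)
  then show ?thesis by (simp add: annulus_def vimage_def)
qed

lemma annulus_mono: "n \<le> m \<Longrightarrow> annulus n \<subseteq> annulus m"
proof
  fix x :: 'a assume nm: "n \<le> m" and x: "x \<in> annulus n"
  have "1 / (real m + 1) \<le> 1 / (real n + 1)" using nm by (intro divide_left_mono) auto
  then show "x \<in> annulus m" using x nm by (auto simp: annulus_def)
qed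

lemma annulus_nonzero: "x \<in> annulus n \<Longrightarrow> x \<noteq> 0"
  by (auto simp: annulus_def field_simps)

lemma in_annulus:
  assumes "x \<noteq> 0" obtains n where "x \<in> annulus n"
proof -
  obtain n :: nat where n: "real n > max ((norm x)\<^sup>2) (1 / (norm x)\<^sup>2)" using reals_Archimedean2 by blast
  then have "1 / (norm x)\<^sup>2 \<le> real n + 1" "(norm x)\<^sup>2 \<le> real n + 1" by auto
  moreover from this(1) have "1 / (real n + 1) \<le> (norm x)\<^sup>2" using assms by (simp add: field_simps)
  ultimately show ?thesis by (intro that[of n]) (simp add: annulus_def)
qed

lemma truncated_drifts:
  fixes F :: "'a::euclidean_space \<Rightarrow> 'a"
  assumes F: "\<And>x. x \<noteq> 0 \<Longrightarrow> lipschitz_near F x"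
  shows "\<exists>b L M. (\<forall>n. (L n)-lipschitz_on UNIV (b n)) \<and> (\<forall>n x. norm (b n x) \<le> M n) \<and>
    (\<forall>n. \<forall>x\<in>annulus n. b n x = F x)"
proof -
  define P where "P n p \<longleftrightarrow> (fst (snd p))-lipschitz_on UNIV (fst p) \<and> (\<forall>x. norm (fst p x) \<le> snd (snd p))
    \<and> (\<forall>x\<in>annulus n. fst p x = F x)" for n and p :: "('a \<Rightarrow> 'a) \<times> real \<times> real"
  have "\<exists>p. P n p" for n
  proof -
    let ?r = "sqrt (1 / (real n + 1))" and ?R = "sqrt (real n + 1)"
    have r: "0 < ?r" by simp
    have rR: "?r \<le> ?R" by (intro real_sqrt_le_mono) (simp add: field_simps)
    obtain b L M where b: "L-lipschitz_on UNIV b" "\<forall>x. norm (b x) \<le> M"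
      "\<forall>x. ?r \<le> norm x \<longrightarrow> norm x \<le> ?R \<longrightarrow> b x = F x"
      using lipschitz_extension_annulus[OF F r rR] by blast
    have "b x = F x" if "x \<in> annulus n" for x
    proof (rule b(3)[rule_format])
      have "?r \<le> sqrt ((norm x)\<^sup>2)" "sqrt ((norm x)\<^sup>2) \<le> ?R"
        using that by (auto simp: annulus_def simp del: real_sqrt_abs intro!: real_sqrt_le_mono)
      then show "?r \<le> norm x" "norm x \<le> ?R" by simp_all
    qed
    then show ?thesis using b(1,2) by (intro exI[of _ "(b, L, M)"]) (simp add: P_def)
  qed
  then have "\<exists>p. \<forall>n. P n (p n)" by (intro choice allI)
  then obtain p where p: "P n (p n)" for n by blast
  show ?thesis
    by (rule exI[of _ "\<lambda>n. fst (p n)"], rule exI[of _ "\<lambda>n. fst (snd (p n))"], rule exI[of _ "\<lambda>n. snd (snd (p n))"])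
      (use p in \<open>simp add: P_def\<close>)
qed

text \<open>The bridge between \<open>solves\<close> with drift c F and the form used in
  \<open>kinetic_solution\<close>, with c = - \<beta> / 2.\<close>

lemma solves_scaleR:
  fixes F :: "'a::euclidean_space \<Rightarrow> 'a"
  assumes "c \<noteq> 0"
  shows "solves (\<lambda>x. c *\<^sub>R F x) w v0 V T \<longleftrightarrow> continuous_on {0..T} V \<and>
     (\<forall>t\<in>{0..T}. set_integrable lborel {0..t} (\<lambda>s. F (V s)) \<and>
        V t = v0 + w t + c *\<^sub>R (LINT s:{0..t}|lborel. F (V s)))"
proof -
  have "set_integrable lborel {0..t} (\<lambda>s. c *\<^sub>R F (V s)) \<longleftrightarrow> set_integrable lborel {0..t} (\<lambda>s. F (V s))" for t
  proof
    assume *: "set_integrable lborel {0..t} (\<lambda>s. c *\<^sub>R F (V s))"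
    have "set_integrable lborel {0..t} (\<lambda>s. inverse c *\<^sub>R c *\<^sub>R F (V s))"
      by (rule set_integrable_scaleR_right) (rule *)
    then show "set_integrable lborel {0..t} (\<lambda>s. F (V s))" using assms by simp
  qed (rule set_integrable_scaleR_right)
  then show ?thesis by (simp add: solves_def set_integral_scaleR_right)
qed

lemma continuous_on_half_line:
  fixes f :: "real \<Rightarrow> 'a::topological_space"
  assumes "\<And>T. T > 0 \<Longrightarrow> continuous_on {0..T} f"
  shows "continuous_on {0..} f"
  unfolding continuous_on_def
proof
  fix t :: real assume t: "t \<in> {0..}"
  have "(f \<longlongrightarrow> f t) (at t within {0..t + 1})"
    using assms[of "t + 1"] t unfolding continuous_on_def by auto
  moreover have "at t within {0..t + 1} = at t within {0..}"
    by (rule at_within_nhd[of _ "{..<t + 1}"]) auto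
  ultimately show "(f \<longlongrightarrow> f t) (at t within {0..})" by simp
qed

text \<open>For each level m there is an annulus outside which g \<ge> m, and exit from it before
  \<open>T\<close> is contained in an event of probability at most c / m. Measurable covers
  \<open>D\<close> are used because \<open>S\<close> is an arbitrary family of path solutions, not
  assumed measurable in the sample point.\<close>

lemma AE_never_leaves_annuli:
  fixes B :: "real \<Rightarrow> 'w \<Rightarrow> real^'n" and b :: "nat \<Rightarrow> real^'n \<Rightarrow> real^'n"
  assumes d: "CARD('n) \<ge> 2" and "\<beta> > 0" and "drift_assumption F"
    and B: "brownian_motion_wrt M G B"
    and v0: "v0 \<in> annulus n1"
    and b: "\<And>n. (L n)-lipschitz_on UNIV (b n)" "\<And>n x. norm (b n x) \<le> bd n"
    and bF: "\<And>n x. x \<in> annulus n \<Longrightarrow> b n x = (- (\<beta> / 2)) *\<^sub>R F x"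
    and S: "\<And>n \<omega> T. B 0 \<omega> = 0 \<Longrightarrow> continuous_on {0..} (\<lambda>t. B t \<omega>) \<Longrightarrow>
      solves (b n) (\<lambda>t. B t \<omega>) v0 (\<lambda>t. S n t \<omega>) T"
    and "T > 0"
  shows "AE \<omega> in M. \<exists>n\<ge>n1. \<forall>t\<in>{0..T}. S n t \<omega> \<in> annulus n"
proof -
  interpret prob_space M by (rule brownian_motion_wrtD(1)[OF B])
  obtain g g1 g2 where g: "\<forall>q>0. (g has_real_derivative g1 q) (at q)" "\<forall>q>0. (g1 has_real_derivative g2 q) (at q)"
    "continuous_on {0<..} g2" "\<forall>q>0. g q \<ge> 0"
    "\<forall>x. x \<noteq> 0 \<longrightarrow> 2 * g1 ((norm x)\<^sup>2) * (x \<bullet> (- (\<beta> / 2)) *\<^sub>R F x) + real CARD('n) * g1 ((norm x)\<^sup>2)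
         + 2 * (norm x)\<^sup>2 * g2 ((norm x)\<^sup>2) = 1"
    "\<forall>m. \<exists>n0::nat. \<forall>n\<ge>n0. \<forall>q>0. q < 1 / (real n + 1) \<or> q > real n + 1 \<longrightarrow> g q \<ge> m"
    using drift_lyapunov(2)[OF assms(1-3)] by (elim exE conjE) (rule that)
  \<comment> \<open>Independent of the annulus: the cutoff agrees with \<open>g\<close> at the
    starting point.\<close>
  define c where "c = g ((norm v0)\<^sup>2) + 2 * T"
  define good where "good \<omega> \<longleftrightarrow> B 0 \<omega> = 0 \<and> continuous_on {0..} (\<lambda>t. B t \<omega>)" for \<omega>
  have "\<exists>n D. n \<ge> n1 \<and> D \<in> sets M \<and> measure M D \<le> c / (real j + 1) \<and>
      (\<forall>\<omega>\<in>space M - D. good \<omega> \<longrightarrow> (\<forall>t\<in>{0..T}. S n t \<omega> \<in> annulus n))" for j :: nat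
  proof -
    define m where "m = real j + 1"
    have m: "m > 0" by (simp add: m_def)
    obtain n0 :: nat where n0: "\<forall>n\<ge>n0. \<forall>q>0. q < 1 / (real n + 1) \<or> q > real n + 1 \<longrightarrow> g q \<ge> m"
      using g(6) by blast
    define n where "n = max n0 n1"
    define a where "a = 1 / (real n + 1)"
    define A where "A = real n + 1"
    define \<phi> where "\<phi> = (cutoff g m a A :: real^'n \<Rightarrow> real)"
    have aA: "0 < a" "a \<le> A" by (auto simp: a_def A_def field_simps)
    have K: "x \<in> annulus n \<longleftrightarrow> (norm x)\<^sup>2 \<in> {a..A}" for x :: "real^'n" by (simp add: annulus_def a_def A_def)
    have \<phi>K: "\<phi> x = g ((norm x)\<^sup>2)" if "x \<in> annulus n" for x
      using that aA by (auto simp: \<phi>_def cutoff_def K)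
    have nn: "0 \<le> \<phi> x" if "x \<in> annulus n" for x
      using \<phi>K[OF that] g(4) annulus_nonzero[OF that] by simp
    have out: "m \<le> \<phi> x" if "x \<notin> annulus n" for x
    proof (cases "(norm x)\<^sup>2 \<in> {a/2..2*A}")
      case True
      then have "(norm x)\<^sup>2 > 0" using aA by auto
      moreover have "(norm x)\<^sup>2 < a \<or> (norm x)\<^sup>2 > A" using that unfolding K by auto
      ultimately have "m \<le> g ((norm x)\<^sup>2)" using n0[rule_format, of n "(norm x)\<^sup>2"] by (simp add: n_def a_def A_def)
      then show ?thesis using True by (simp add: \<phi>_def cutoff_def)
    next
      case False
      then show ?thesis by (simp only: \<phi>_def cutoff_def if_False order_refl)
    qed
    have g': "\<And>t. t > 0 \<Longrightarrow> (g has_real_derivative g1 t) (at t)" "\<And>t. t > 0 \<Longrightarrow> (g1 has_real_derivative g2 t) (at t)"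
      using g(1,2) by auto
    have gen: "2 * g1 ((norm x)\<^sup>2) * (x \<bullet> b n x) + real CARD('n) * g1 ((norm x)\<^sup>2) + 2 * (norm x)\<^sup>2 * g2 ((norm x)\<^sup>2) \<le> 1"
      if "(norm x)\<^sup>2 \<in> {a..A}" for x
    proof -
      have x: "x \<in> annulus n" using that K by blast
      show ?thesis using g(5)[rule_format, OF annulus_nonzero[OF x]] unfolding bF[OF x] by (rule eq_refl)
    qed
    have "\<exists>\<delta>0>0. \<forall>\<delta> x. 0 < \<delta> \<longrightarrow> \<delta> < \<delta>0 \<longrightarrow> (norm x)\<^sup>2 \<in> {a..A} \<longrightarrow>
       (\<integral>w. gauss_density (sqrt \<delta>) w * cutoff g m a A (x + (w + \<delta> *\<^sub>R b n x)) \<partial>lborel) \<le> g ((norm x)\<^sup>2) + 2 * \<delta>"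
      by (rule cutoff_one_step[OF aA g' g(3) b(2) gen])
    then obtain \<delta>0 where \<delta>0: "\<delta>0 > 0" "\<forall>\<delta> x. 0 < \<delta> \<longrightarrow> \<delta> < \<delta>0 \<longrightarrow> (norm x)\<^sup>2 \<in> {a..A} \<longrightarrow>
       (\<integral>w. gauss_density (sqrt \<delta>) w * cutoff g m a A (x + (w + \<delta> *\<^sub>R b n x)) \<partial>lborel) \<le> g ((norm x)\<^sup>2) + 2 * \<delta>"
      by (elim exE conjE) (rule that)
    have step: "(\<integral>w. gauss_density (sqrt \<delta>) w * \<phi> (x + (w + \<delta> *\<^sub>R b n x)) \<partial>lborel) \<le> \<phi> x + 2 * \<delta>"
      if "0 < \<delta>" "\<delta> < \<delta>0" "x \<in> annulus n" for \<delta> x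
      unfolding \<phi>K[OF that(3)] unfolding \<phi>_def
      by (rule \<delta>0(2)[rule_format, OF that(1,2) that(3)[unfolded K]])
    have v0n: "v0 \<in> annulus n" using v0 annulus_mono[of n1 n] by (auto simp: n_def)
    have bm: "b n \<in> borel_measurable borel"
      by (intro borel_measurable_continuous_onI lipschitz_on_continuous_on[OF b(1)])
    have \<phi>m: "\<phi> \<in> borel_measurable borel" unfolding \<phi>_def by (rule cutoff_measurable[OF g'(1) aA(1)])
    obtain C where C: "\<And>x. \<bar>\<phi> x\<bar> \<le> C" unfolding \<phi>_def using cutoff_bounded[OF g'(1) aA(1)] by blast
    have Km: "annulus n \<in> sets (borel :: (real^'n) measure)" by (rule borel_closed[OF annulus_closed])
    have "\<exists>D\<in>sets M. measure M D \<le> (\<phi> v0 + 2 * T) / m \<and> (\<forall>\<omega> N0. \<omega> \<in> space M \<longrightarrow>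
       (\<forall>N\<ge>N0. \<exists>k\<le>N. euler (b n) (\<lambda>s. B s \<omega>) v0 (T / real N) k \<notin> annulus n) \<longrightarrow> \<omega> \<in> D)"
      by (rule exit_probability[OF B \<open>T > 0\<close> bm \<phi>m C nn Km v0n out m \<delta>0(1) step])
    then obtain D where D: "D \<in> sets M" "measure M D \<le> (\<phi> v0 + 2 * T) / m"
      and Dout: "\<forall>\<omega> N0. \<omega> \<in> space M \<longrightarrow>
       (\<forall>N\<ge>N0. \<exists>k\<le>N. euler (b n) (\<lambda>s. B s \<omega>) v0 (T / real N) k \<notin> annulus n) \<longrightarrow> \<omega> \<in> D"
      by (elim bexE conjE) (rule that)
    have "S n t \<omega> \<in> annulus n" if "\<omega> \<in> space M - D" "good \<omega>" "t \<in> {0..T}" for \<omega> t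
    proof (rule ccontr)
      assume no: "S n t \<omega> \<notin> annulus n"
      have w0: "B 0 \<omega> = 0" and sol: "solves (b n) (\<lambda>t. B t \<omega>) v0 (\<lambda>t. S n t \<omega>) T"
        using that(2) S by (auto simp: good_def)
      from solution_exit_euler_exit[OF sol w0 b(1) \<open>T > 0\<close> annulus_closed that(3) no]
      obtain N0 where N0: "\<forall>N\<ge>N0. \<exists>k\<le>N. euler (b n) (\<lambda>s. B s \<omega>) v0 (T / real N) k \<notin> annulus n"
        by (elim exE) (rule that)
      have "\<omega> \<in> D"
        by (rule Dout[THEN spec, THEN spec, THEN mp, THEN mp, OF _ N0]) (use that(1) in simp)
      with that(1) show False by simp
    qed
    moreover have "n1 \<le> n" by (simp add: n_def)
    moreover have "measure M D \<le> c / (real j + 1)" using D(2) \<phi>K[OF v0n] by (simp add: c_def m_def)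
    ultimately show ?thesis using D(1) by blast
  qed
  then obtain n D where n: "\<And>j. n j \<ge> n1" and D: "\<And>j. D j \<in> sets M" "\<And>j. measure M (D j) \<le> c / (real j + 1)"
      and nD: "\<And>j \<omega> t. \<omega> \<in> space M - D j \<Longrightarrow> good \<omega> \<Longrightarrow> t \<in> {0..T} \<Longrightarrow> S (n j) t \<omega> \<in> annulus (n j)"
    by metis
  \<comment> \<open>A path outside the intersection avoids some \<open>D j\<close>, so it stays in
    one annulus up to \<open>T\<close>; the intersection has measure at most c / (j + 1) for every
    j, hence 0.\<close>
  have I: "(\<Inter>j. D j) \<in> sets M" using D(1) by auto
  have lim: "(\<lambda>j. c / (real j + 1)) \<longlonglongrightarrow> 0"
    using tendsto_mult_right_zero[OF LIMSEQ_inverse_real_of_nat, of c] by (simp add: divide_inverse add.commute)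
  have "measure M (\<Inter>j. D j) \<le> c / (real j + 1)" for j
    by (rule order_trans[OF finite_measure_mono[OF _ D(1)] D(2)[of j]]) auto
  then have "measure M (\<Inter>j. D j) \<le> 0" by (intro LIMSEQ_le_const[OF lim]) blast
  then have "(\<Inter>j. D j) \<in> null_sets M"
    using I by (simp add: null_sets_def emeasure_eq_measure measure_le_0_iff)
  then have "AE \<omega> in M. \<omega> \<notin> (\<Inter>j. D j)" by (rule AE_not_in)
  from this AE_space brownian_motion_wrtD(7,8)[OF B] show ?thesis
  proof eventually_elim
    case (elim \<omega>)
    then obtain j where j: "\<omega> \<in> space M - D j" by blast
    have "good \<omega>" using elim by (simp add: good_def)
    then have "\<forall>t\<in>{0..T}. S (n j) t \<omega> \<in> annulus (n j)" using nD[OF j] by blast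
    with n[of j] show ?case by blast
  qed
qed


text \<open>The inner limit is the solution for the truncated drift \<open>b n\<close>. The outer
  one is of an eventually constant sequence: once the path stays in \<open>annulus n\<close>,
  truncation further out changes nothing. The formula for \<open>V\<close> does not mention the
  horizon \<open>T\<close>.\<close>

lemma euler_path_limit:
  fixes F :: "'a::euclidean_space \<Rightarrow> 'a"
  assumes F: "\<And>x. x \<noteq> 0 \<Longrightarrow> lipschitz_near F x"
    and b: "\<And>n. (L n)-lipschitz_on UNIV (b n)" "\<And>n x. x \<in> annulus n \<Longrightarrow> b n x = F x"
    and w: "w 0 = 0" and S: "\<And>n T. solves (b n) w v0 (S n) T"
    and n: "\<And>t. t \<in> {0..T} \<Longrightarrow> S n t \<in> annulus n"
  defines "V \<equiv> (\<lambda>t. lim (\<lambda>n. lim (\<lambda>N. euler (b n) w v0 (t / real N) N)))"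
  shows "solves F w v0 V T" and "\<And>t. t \<in> {0..T} \<Longrightarrow> V t \<noteq> 0"
proof -
  have V: "V t = S n t" if t: "t \<in> {0..T}" for t
  proof -
    have "S m t = S n t" if "m \<ge> n" for m
    proof (rule solves_unique[OF _ S _ t])
      \<comment> \<open>The path \<open>S n\<close> stays where \<open>b m\<close> and
        \<open>b n\<close> coincide, so it also solves the equation with drift \<open>b m\<close>;
        uniqueness for the latter identifies the two.\<close>
      show "solves (b m) w v0 (S n) T"
      proof (rule solves_cong[OF S[of n T]])
        fix t assume "t \<in> {0..T}"
        then have "S n t \<in> annulus n" by (rule n)
        moreover from this have "S n t \<in> annulus m" using annulus_mono[OF that] by blast
        ultimately show "b m (S n t) = b n (S n t)" by (simp add: b(2))
      qed simp
      show "lipschitz_near (b m) (S n t)" for t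
        unfolding lipschitz_near_def using lipschitz_on_subset[OF b(1)[of m], of "ball (S n t) 1"]
        by (intro exI[of _ "1::real"]) auto
    qed
    then have "\<forall>\<^sub>F m in sequentially. S m t = S n t" unfolding eventually_sequentially by blast
    then have l: "lim (\<lambda>m. S m t) = S n t" by (intro limI tendsto_eventually)
    have "lim (\<lambda>N. euler (b m) w v0 (t / real N) N) = S m t" for m
      using t by (intro limI euler_LIMSEQ[OF S w b(1)]) simp
    then show ?thesis using l by (simp add: V_def)
  qed
  show "solves F w v0 V T"
    by (rule solves_cong[OF S[of n T] V]) (use n b(2) in auto)
  show "V t \<noteq> 0" if "t \<in> {0..T}" for t
    using annulus_nonzero[OF n[OF that]] V[OF that] by simp
qed

theorem proposition2:
  fixes F :: "real ^ 'n \<Rightarrow> real ^ 'n"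
    and \<beta> :: real
    and v\<^sub>0 x\<^sub>0 :: "real ^ 'n"
    and M :: "'w measure"
    and B :: "real \<Rightarrow> 'w \<Rightarrow> real ^ 'n"
  assumes "CARD('n) \<ge> 2"
    and "\<beta> > 0"
    and "drift_assumption F"
    and "v\<^sub>0 \<noteq> 0"
    and "brownian_motion M B"
  shows "\<exists>V X.
     kinetic_solution M (augmented_filtration M (natural_filtration M B)) B F \<beta> v\<^sub>0 x\<^sub>0 V X \<and>
     (AE \<omega> in M. \<forall>t\<ge>0. V t \<omega> \<noteq> 0) \<and>
     (\<forall>G V' X'. brownian_motion_wrt M G B \<and> kinetic_solution M G B F \<beta> v\<^sub>0 x\<^sub>0 V' X' \<longrightarrow>
        (AE \<omega> in M. \<forall>t\<ge>0. V' t \<omega> = V t \<omega> \<and> X' t \<omega> = X t \<omega>))"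
proof -
  let ?N = "natural_filtration M B"
  have B: "brownian_motion_wrt M ?N B" using assms(5) by (simp add: brownian_motion_def)
  define c where "c = - (\<beta> / 2)"
  have c0: "c \<noteq> 0" using assms(2) by (simp add: c_def)
  have lip: "lipschitz_near (\<lambda>x. c *\<^sub>R F x) x" if "x \<noteq> 0" for x
    by (intro lipschitz_near_scaleR lipschitz_near_const drift_lyapunov(1)[OF assms(1-3) that])
  obtain b L bd where b0: "\<forall>n. (L n)-lipschitz_on UNIV (b n)" "\<forall>n x. norm (b n x) \<le> bd n"
    "\<forall>n. \<forall>x\<in>annulus n. b n x = c *\<^sub>R F x"
  proof -
    have "\<exists>b L bd. (\<forall>n. (L n)-lipschitz_on UNIV (b n)) \<and> (\<forall>n x. norm (b n x) \<le> bd n) \<and>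
      (\<forall>n. \<forall>x\<in>annulus n. b n x = c *\<^sub>R F x)"
      by (rule truncated_drifts) (rule lip)
    then show thesis by (elim exE conjE) (rule that)
  qed
  note b = b0[rule_format]
  obtain n1 where n1: "v\<^sub>0 \<in> annulus n1" using in_annulus[OF assms(4)] .
  define w where "w \<omega> t = B t \<omega>" for \<omega> t
  \<comment> \<open>A choice for each path, with no measurability claimed. It only witnesses that
    the limits defining \<open>V\<close> exist, whereas adaptedness is read off from
    \<open>V\<close> itself.\<close>
  define S where "S n t \<omega> = (SOME V. \<forall>T. solves (b n) (w \<omega>) v\<^sub>0 V T) t" for n t \<omega>
  have S: "solves (b n) (w \<omega>) v\<^sub>0 (\<lambda>t. S n t \<omega>) T" if "continuous_on {0..} (w \<omega>)" for n \<omega> T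
  proof -
    have "\<exists>V. \<forall>T. solves (b n) (w \<omega>) v\<^sub>0 V T"
      using lipschitz_drift_solution[OF b(1)[of n] b(2) that] by blast
    from someI_ex[OF this] show ?thesis by (simp add: S_def)
  qed
  define V where "V t \<omega> = lim (\<lambda>n. lim (\<lambda>N. euler (b n) (w \<omega>) v\<^sub>0 (t / real N) N))" for t \<omega>
  define X where "X t \<omega> = x\<^sub>0 + lim (\<lambda>N. \<Sum>k<N. (t / real N) *\<^sub>R V (real k * (t / real N)) \<omega>)" for t \<omega>
  \<comment> \<open>Integer horizons suffice and keep the exceptional set a countable union of null
    sets.\<close>
  have "AE \<omega> in M. \<forall>i. \<exists>n\<ge>n1. \<forall>t\<in>{0..real (Suc i)}. S n t \<omega> \<in> annulus n"
    unfolding AE_all_countable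
    by (intro allI AE_never_leaves_annuli[OF assms(1-3) B n1 b(1,2) b(3)[unfolded c_def]])
      (use S in \<open>auto simp: w_def[abs_def]\<close>)
  then have path: "AE \<omega> in M. (\<forall>T. solves (\<lambda>x. c *\<^sub>R F x) (w \<omega>) v\<^sub>0 (\<lambda>t. V t \<omega>) T) \<and> (\<forall>t\<ge>0. V t \<omega> \<noteq> 0)"
    using brownian_motion_wrtD(7,8)[OF B]
  proof eventually_elim
    case (elim \<omega>)
    have w: "w \<omega> 0 = 0" "continuous_on {0..} (w \<omega>)" using elim by (auto simp: w_def[abs_def])
    have *: "solves (\<lambda>x. c *\<^sub>R F x) (w \<omega>) v\<^sub>0 (\<lambda>t. V t \<omega>) (real (Suc i))"
        "t \<in> {0..real (Suc i)} \<Longrightarrow> V t \<omega> \<noteq> 0" for i t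
    proof -
      obtain n where n: "\<And>t. t \<in> {0..real (Suc i)} \<Longrightarrow> S n t \<omega> \<in> annulus n" using elim(1) by blast
      note lim = euler_path_limit[where F = "\<lambda>x. c *\<^sub>R F x" and S = "\<lambda>n t. S n t \<omega>" and w = "w \<omega>" and b = b
        and n = n and L = L, OF lip b(1) b(3) w(1) S[OF w(2)] n, folded V_def]
      show "solves (\<lambda>x. c *\<^sub>R F x) (w \<omega>) v\<^sub>0 (\<lambda>t. V t \<omega>) (real (Suc i))" by (rule lim(1))
      show "t \<in> {0..real (Suc i)} \<Longrightarrow> V t \<omega> \<noteq> 0" by (rule lim(2))
    qed
    have ex: "\<exists>i. T \<le> real (Suc i)" for T using real_arch_simple[of T] by (metis of_nat_Suc le_add_same_cancel2 order_trans zero_le_one add.commute)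
    have "solves (\<lambda>x. c *\<^sub>R F x) (w \<omega>) v\<^sub>0 (\<lambda>t. V t \<omega>) T" for T
      using ex[of T] solves_mono[OF *(1)] by blast
    moreover have "V t \<omega> \<noteq> 0" if "t \<ge> 0" for t
      using ex[of t] *(2)[of t] that by auto
    ultimately show ?case by blast
  qed
  \<comment> \<open>Limits of measurable functions are measurable also where they do not converge,
    since \<open>lim\<close> then takes a fixed default value. So adaptedness holds without
    completing the filtration. For N = 0 the mesh is 0 by the convention on division.\<close>
  have V_adapted: "V s \<in> borel_measurable (?N t)" if "0 \<le> s" "s \<le> t" for s t
  proof -
    have "(\<lambda>\<omega>. euler (b n) (w \<omega>) v\<^sub>0 (s / real N) N) \<in> borel_measurable (?N t)" for n N
      unfolding w_def using that
      by (intro euler_adapted[OF B] borel_measurable_continuous_onI lipschitz_on_continuous_on[OF b(1)])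
        (cases "N = 0"; simp)+
    then show ?thesis unfolding V_def[abs_def] by (intro borel_measurable_lim_metric)
  qed
  have X_adapted: "X t \<in> borel_measurable (?N t)" if t: "t \<ge> 0" for t
  proof -
    have "V (real k * (t / real N)) \<in> borel_measurable (?N t)" if "k < N" for k N
    proof (rule V_adapted)
      have "real k * t \<le> real N * t" using that t by (intro mult_right_mono) auto
      then show "real k * (t / real N) \<le> t" using that by (simp add: field_simps)
    qed (use t in simp)
    then have "(\<lambda>\<omega>. lim (\<lambda>N. \<Sum>k<N. (t / real N) *\<^sub>R V (real k * (t / real N)) \<omega>)) \<in> borel_measurable (?N t)"
      by (intro borel_measurable_lim_metric borel_measurable_sum borel_measurable_scaleR borel_measurable_const) auto
    then show ?thesis unfolding X_def[abs_def] by (intro borel_measurable_add borel_measurable_const)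
  qed
  have aug: "subalgebra (augmented_filtration M ?N t) (?N t)" if "t \<ge> 0" for t
  proof -
    have "subalgebra M (?N t)" using B that by (intro brownian_motion_wrtD(2))
    then have s: "space (?N t) = space M" "sets (?N t) \<subseteq> sets M" by (auto simp: subalgebra_def)
    have "sets (?N t) \<union> null_sets M \<subseteq> Pow (space M)"
      using s sets.sets_into_space[of _ M] by (auto simp: null_sets_def)
    then show ?thesis
      by (auto simp: subalgebra_def augmented_filtration_def s sets_measure_of space_measure_of)
  qed
  \<comment> \<open>Only continuity of the velocity path enters: it turns the limit of Riemann sums
    that defines \<open>X\<close> into the integral.\<close>
  have X_path: "continuous_on {0..} (\<lambda>t. X t \<omega>) \<and> (\<forall>t\<ge>0. X t \<omega> = x\<^sub>0 + (LINT s:{0..t}|lborel. V s \<omega>))"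
    if sol: "\<And>T. solves b' w' v\<^sub>0 (\<lambda>t. V t \<omega>) T" for \<omega> b' w'
  proof -
    have cV: "continuous_on {0..T} (\<lambda>t. V t \<omega>)" for T using sol by (simp add: solves_def)
    have X: "X t \<omega> = x\<^sub>0 + integral {0..t} (\<lambda>s. V s \<omega>)" if "t \<ge> 0" for t
      unfolding X_def using limI[OF riemann_LIMSEQ[OF cV that]] by simp
    have "continuous_on {0..T} (\<lambda>t. X t \<omega>)" for T
    proof (rule continuous_on_eq)
      show "continuous_on {0..T} (\<lambda>t. x\<^sub>0 + integral {0..t} (\<lambda>s. V s \<omega>))"
        by (intro continuous_on_add continuous_on_const indefinite_integral_continuous_1 integrable_continuous_real cV)
    qed (simp add: X)
    then have "continuous_on {0..} (\<lambda>t. X t \<omega>)" by (intro continuous_on_half_line)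
    moreover have "X t \<omega> = x\<^sub>0 + (LINT s:{0..t}|lborel. V s \<omega>)" if "t \<ge> 0" for t
      using X[OF that] set_borel_integral_eq_integral(2)[OF borel_integrable_atLeastAtMost'[OF cV]] by simp
    ultimately show ?thesis by blast
  qed
  have "kinetic_solution M (augmented_filtration M ?N) B F \<beta> v\<^sub>0 x\<^sub>0 V X"
    unfolding kinetic_solution_def
  proof (intro conjI)
    show "\<forall>t\<ge>0. V t \<in> borel_measurable (augmented_filtration M ?N t) \<and> X t \<in> borel_measurable (augmented_filtration M ?N t)"
      using measurable_from_subalg[OF aug] V_adapted X_adapted by blast
    show "AE \<omega> in M.
        continuous_on {0..} (\<lambda>t. V t \<omega>) \<and> continuous_on {0..} (\<lambda>t. X t \<omega>) \<and>
        (\<forall>t\<ge>0.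
           set_integrable lborel {0..t} (\<lambda>s. F (V s \<omega>)) \<and>
           V t \<omega> = v\<^sub>0 + B t \<omega> - (\<beta> / 2) *\<^sub>R (LINT s:{0..t}|lborel. F (V s \<omega>)) \<and>
           X t \<omega> = x\<^sub>0 + (LINT s:{0..t}|lborel. V s \<omega>))"
      using path
    proof eventually_elim
      case (elim \<omega>)
      then have sol: "solves (\<lambda>x. c *\<^sub>R F x) (w \<omega>) v\<^sub>0 (\<lambda>t. V t \<omega>) T" for T by blast
      have "continuous_on {0..} (\<lambda>t. V t \<omega>)"
        using sol by (intro continuous_on_half_line) (simp add: solves_def)
      moreover have "set_integrable lborel {0..t} (\<lambda>s. F (V s \<omega>)) \<and>
           V t \<omega> = v\<^sub>0 + B t \<omega> - (\<beta> / 2) *\<^sub>R (LINT s:{0..t}|lborel. F (V s \<omega>))" if "t \<ge> 0" for t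
        using sol[of t] that unfolding solves_scaleR[OF c0] by (auto simp: c_def w_def)
      ultimately show ?case using X_path[OF sol] by blast
    qed
  qed
  moreover have "AE \<omega> in M. \<forall>t\<ge>0. V t \<omega> \<noteq> 0" using path by eventually_elim blast
  \<comment> \<open>Off the union of the two null sets the comparison is deterministic: both
    velocities solve the same equation along the same Brownian path, and the positions are their
    integrals.\<close>
  moreover have "AE \<omega> in M. \<forall>t\<ge>0. V' t \<omega> = V t \<omega> \<and> X' t \<omega> = X t \<omega>"
    if kin: "kinetic_solution M G B F \<beta> v\<^sub>0 x\<^sub>0 V' X'" for G V' X'
    using kin[unfolded kinetic_solution_def, THEN conjunct2] path
  proof eventually_elim
    case (elim \<omega>)
    then have sol: "solves (\<lambda>x. c *\<^sub>R F x) (w \<omega>) v\<^sub>0 (\<lambda>t. V t \<omega>) T" for T by blast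
    have sol': "solves (\<lambda>x. c *\<^sub>R F x) (w \<omega>) v\<^sub>0 (\<lambda>t. V' t \<omega>) T" for T
      unfolding solves_scaleR[OF c0] using elim(1) by (auto simp: c_def w_def intro: continuous_on_subset)
    have eq: "V' t \<omega> = V t \<omega>" if "t \<ge> 0" for t
    proof (rule solves_unique[OF sol sol', of t t])
      \<comment> \<open>Local Lipschitz continuity is checked along \<open>V\<close>, which avoids
        the origin; where \<open>V'\<close> goes is not known beforehand.\<close>
      show "lipschitz_near (\<lambda>x. c *\<^sub>R F x) (V s \<omega>)" if "s \<in> {0..t}" for s
        using elim(2) that by (intro lip) auto
    qed (use that in simp)
    have "X' t \<omega> = X t \<omega>" if "t \<ge> 0" for t
    proof -
      have "X' t \<omega> = x\<^sub>0 + (LINT s:{0..t}|lborel. V' s \<omega>)" using elim(1) that by blast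
      also have "(LINT s:{0..t}|lborel. V' s \<omega>) = (LINT s:{0..t}|lborel. V s \<omega>)"
        using eq by (intro set_lebesgue_integral_cong) auto
      finally show ?thesis using X_path[OF sol] that by simp
    qed
    with eq show ?case by blast
  qed
  ultimately show ?thesis by blast
qed

end
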